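(* Consider a weakly connected network graph with $L$ nodes and $n$ edges (unknown transfer functions), and a given set $\mathcal{C}$ of measured nodes. Then: (1) checking whether all edges of the network can generically be identified from $\mathcal{C}$ can be achieved in $O(L^2 n)$ operations; (2) for a given edge $(i,j)$, determining whether it can generically be identified from $\mathcal{C}$ can be achieved in $O(Ln)$ operations; (3) determining the exact set of edges that can generically be identified from $\mathcal{C}$ can be achieved in $O(n^2 L)$ operations.
   Context: Network. There are $L$ nodes with signals $w(t)=[w_1(t),\dots,w_L(t)]^T$ obeying $w(t)=G^0(q)w(t)+r(t)+v(t)$, where $q^{-1}$ is the delay operator, $r(t)$ is a vector of known external excitation signals (one at each node), $v(t)$ is a noise vector, and the network matrix $G^0$ is an $L\times L$ matrix with zero diagonal whose entries are proper rational transfer functions; the network is well-posed ($(I-G^0)^{-1}$ is proper and stable). $T^0=(I-G^0)^{-1}$. Topology. The topology (the input of the decision problems, together with $\mathcal{C}$) is a known directed graph on $\{1,\dots,L\}$ without self-loops; an edge $(j,i)$ from $j$ to $i$ corresponds to a transfer function $G_{ij}$ that is not known to be zero. A directed graph is weakly connected if for any partition of its vertices in two sets there is at least one edge starting in one of the sets and ending in the other. A matrix $M$ is consistent with the graph if $M_{ij}\neq 0$ only if $(j,i)$ is an edge (an edge does not force $M_{ij}\ne0$). $G^0$ is consistent with its graph. Measurements. $y(t)=Cw(t)$, where $C$ is a $p\times L$ matrix each row of which has one entry $1$ and all others $0$; $\mathcal{C}$ is the set of $p$ nodes selected by $C$. The matrix $CT^0$ is assumed exactly known. Generic identifiability. A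 rational transfer matrix parametrization consistent with the graph: for every edge $(j,i)$ fix nonnegative integers $p_{ij},n_{ij}$ and set $$G_{ij}(z)=\kappa_{ij}z^{-p_{ij}}\frac{z^{n_{ij}}+\beta_{ij}^{(n_{ij}-1)}z^{n_{ij}-1}+\dots+\beta_{ij}^{(0)}}{z^{n_{ij}}+\alpha_{ij}^{(n_{ij}-1)}z^{n_{ij}-1}+\dots+\alpha_{ij}^{(0)}}$$ with real parameters $\kappa_{ij},\alpha_{ij}^{(m)},\beta_{ij}^{(m)}$, and $G_{ij}(z)=0$ when $(j,i)$ is not an edge. All parameters are collected in $P\in\mathbb{R}^N$, and the resulting matrix is $G(P,z)$. A group of edges is generically identifiable from $\mathcal{C}$ if for every such parametrization, for all $P$ except possibly those in a zero-measure subset of $\mathbb{R}^N$, the following holds: for every network matrix $\tilde G(z)$ consistent with the graph, $C(I-G(P,z))^{-1}=C(I-\tilde G(z))^{-1}$ implies $G_{ji}(P,z)=\tilde G_{ji}(z)$ for every edge $(i,j)$ of the group. *)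

theory Defs
  imports
    "HOL-Analysis.Lebesgue_Measure"
    "HOL-Analysis.Finite_Product_Measure"
    "HOL-Computational_Algebra.Polynomial"
    "HOL-Computational_Algebra.Fraction_Field"
    "Jordan_Normal_Form.Matrix"
begin

section \<open>Dynamical networks\<close>

text \<open>
  Nodes are numbered from \<open>0\<close> to \<open>L - 1\<close>, matching the matrix indices. An edge is the pair
  (tail, head), so the edge \<open>(j, i)\<close> carries the entry in row \<open>i\<close> and column \<open>j\<close> of a network
  matrix. Transfer functions are elements of the field of real rational functions in \<open>z\<close>.
\<close>

type_synonym edge = "nat \<times> nat"
type_synonym transfer = "real poly fract"

definition digraph :: "nat \<Rightarrow> edge set \<Rightarrow> bool" where
  "digraph L E \<longleftrightarrow> 0 < L \<and> E \<subseteq> {..<L} \<times> {..<L} \<and> (\<forall>i. (i, i) \<notin> E)"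

definition weakly_connected :: "nat \<Rightarrow> edge set \<Rightarrow> bool" where
  "weakly_connected L E \<longleftrightarrow>
     (\<forall>A B. A \<noteq> {} \<and> B \<noteq> {} \<and> A \<inter> B = {} \<and> A \<union> B = {..<L} \<longrightarrow>
       (\<exists>(u, v)\<in>E. (u \<in> A \<and> v \<in> B) \<or> (u \<in> B \<and> v \<in> A)))"

definition proper :: "transfer \<Rightarrow> bool" where
  "proper f \<longleftrightarrow> (\<exists>p q. q \<noteq> 0 \<and> f = Fract p q \<and> degree p \<le> degree q)"

text \<open>
  Discrete-time stability: every pole lies in the open unit disc. The representation of \<open>f\<close> is not
  required to be reduced; a cancelled common factor only removes zeros of the denominator.
\<close>

definition stable :: "transfer \<Rightarrow> bool" where
  "stable f \<longleftrightarrow>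
     (\<exists>p q. q \<noteq> 0 \<and> f = Fract p q \<and>
       (\<forall>z::complex. 1 \<le> norm z \<longrightarrow> poly (map_poly complex_of_real q) z \<noteq> 0))"

definition consistent_with :: "nat \<Rightarrow> edge set \<Rightarrow> transfer mat \<Rightarrow> bool" where
  "consistent_with L E G \<longleftrightarrow> (\<forall>i<L. \<forall>j<L. G $$ (i, j) \<noteq> 0 \<longrightarrow> (j, i) \<in> E)"

text \<open>\<open>is_inverse_of_I_minus L G T\<close> says that \<open>T\<close> is the inverse of \<open>I - G\<close>.\<close>

definition is_inverse_of_I_minus :: "nat \<Rightarrow> transfer mat \<Rightarrow> transfer mat \<Rightarrow> bool" where
  "is_inverse_of_I_minus L G T \<longleftrightarrow>
     T \<in> carrier_mat L L \<and> inverts_mat (1\<^sub>m L - G) T \<and> inverts_mat T (1\<^sub>m L - G)"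

definition well_posed :: "nat \<Rightarrow> transfer mat \<Rightarrow> bool" where
  "well_posed L G \<longleftrightarrow>
     (\<exists>T. is_inverse_of_I_minus L G T \<and>
       (\<forall>i<L. \<forall>j<L. proper (T $$ (i, j)) \<and> stable (T $$ (i, j))))"

definition network_matrix :: "nat \<Rightarrow> transfer mat \<Rightarrow> bool" where
  "network_matrix L G \<longleftrightarrow>
     G \<in> carrier_mat L L \<and> (\<forall>i<L. G $$ (i, i) = 0) \<and>
     (\<forall>i<L. \<forall>j<L. proper (G $$ (i, j))) \<and> well_posed L G"

text \<open>The measurement matrix whose rows select the nodes listed in \<open>cs\<close>.\<close>

definition selection_matrix :: "nat \<Rightarrow> nat list \<Rightarrow> transfer mat" where
  "selection_matrix L cs = mat (length cs) L (\<lambda>(r, k). if k = cs ! r then 1 else 0)"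


section \<open>Rational parametrizations and generic identifiability\<close>

text \<open>
  The coordinates of the parameter vector: for each edge \<open>e\<close> a gain \<open>\<kappa>\<close> and the non-leading
  coefficients \<open>\<beta>\<close> (numerator) and \<open>\<alpha>\<close> (denominator). A parametrization is given by the delay
  \<open>d e\<close> and the order \<open>ord e\<close> of every edge.
\<close>

datatype coord = Kappa edge | Beta edge nat | Alpha edge nat

definition coords :: "edge set \<Rightarrow> (edge \<Rightarrow> nat) \<Rightarrow> coord set" where
  "coords E ord =
     Kappa ` E \<union> {Beta e m |e m. e \<in> E \<and> m < ord e} \<union> {Alpha e m |e m. e \<in> E \<and> m < ord e}"

definition monic_poly :: "nat \<Rightarrow> (nat \<Rightarrow> real) \<Rightarrow> real poly" where
  "monic_poly k c = Polynomial.monom 1 k + (\<Sum>m<k. Polynomial.monom (c m) m)"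

definition edge_transfer ::
  "(edge \<Rightarrow> nat) \<Rightarrow> (edge \<Rightarrow> nat) \<Rightarrow> (coord \<Rightarrow> real) \<Rightarrow> edge \<Rightarrow> transfer" where
  "edge_transfer d ord P e =
     Fract (Polynomial.smult (P (Kappa e)) (monic_poly (ord e) (\<lambda>m. P (Beta e m))))
           (Polynomial.monom 1 (d e) * monic_poly (ord e) (\<lambda>m. P (Alpha e m)))"

definition param_matrix ::
  "nat \<Rightarrow> edge set \<Rightarrow> (edge \<Rightarrow> nat) \<Rightarrow> (edge \<Rightarrow> nat) \<Rightarrow> (coord \<Rightarrow> real) \<Rightarrow> transfer mat" where
  "param_matrix L E d ord P =
     mat L L (\<lambda>(i, j). if (j, i) \<in> E then edge_transfer d ord P (j, i) else 0)"

text \<open>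
  Parameter vectors are functions on the finite set of coordinates, with the product Lebesgue
  measure. Parameters for which \<open>I - G(P,z)\<close> has no inverse impose no condition; they form a null
  set. As \<open>T'\<close> belongs to a well-posed \<open>G'\<close>, it is proper and stable, whereas no such requirement
  is made on \<open>T\<close>.
\<close>

definition generically_identifiable ::
  "nat \<Rightarrow> edge set \<Rightarrow> nat list \<Rightarrow> edge set \<Rightarrow> bool" where
  "generically_identifiable L E cs S \<longleftrightarrow>
     (\<forall>d ord. AE P in (\<Pi>\<^sub>M x\<in>coords E ord. lborel).
        \<forall>G' T T'.
          network_matrix L G' \<and> consistent_with L E G' \<and>
          is_inverse_of_I_minus L (param_matrix L E d ord P) T \<and>
          is_inverse_of_I_minus L G' T' \<and>
          selection_matrix L cs * T = selection_matrix L cs * T' \<longrightarrow>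
          (\<forall>(i, j)\<in>S. param_matrix L E d ord P $$ (j, i) = G' $$ (j, i)))"


section \<open>Machine model\<close>

text \<open>
  A random access machine with unit-cost addition, truncated subtraction, comparison and indirect
  addressing on natural numbers, presented as a structured language over named registers and named
  arrays. Every program mentions only finitely many names. Comparison returns \<open>0\<close> or \<open>1\<close>; a test
  succeeds if its value is nonzero.
\<close>

datatype exp =
    Const nat
  | Reg string
  | Elem string exp
  | Add exp exp
  | Sub exp exp
  | Less exp exp

datatype com =
    Skip
  | SetReg string exp
  | SetElem string exp exp
  | Seq com com
  | Cond exp com com
  | While exp com

record state =
  reg :: "string \<Rightarrow> nat"
  arr :: "string \<Rightarrow> nat \<Rightarrow> nat"

primrec eval_exp :: "exp \<Rightarrow> state \<Rightarrow> nat" where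
  "eval_exp (Const k) s = k"
| "eval_exp (Reg x) s = reg s x"
| "eval_exp (Elem a e) s = arr s a (eval_exp e s)"
| "eval_exp (Add e f) s = eval_exp e s + eval_exp f s"
| "eval_exp (Sub e f) s = eval_exp e s - eval_exp f s"
| "eval_exp (Less e f) s = (if eval_exp e s < eval_exp f s then 1 else 0)"

primrec exp_cost :: "exp \<Rightarrow> nat" where
  "exp_cost (Const k) = 1"
| "exp_cost (Reg x) = 1"
| "exp_cost (Elem a e) = 1 + exp_cost e"
| "exp_cost (Add e f) = 1 + exp_cost e + exp_cost f"
| "exp_cost (Sub e f) = 1 + exp_cost e + exp_cost f"
| "exp_cost (Less e f) = 1 + exp_cost e + exp_cost f"

definition set_reg :: "string \<Rightarrow> nat \<Rightarrow> state \<Rightarrow> state" where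
  "set_reg x v s = s\<lparr>reg := (reg s)(x := v)\<rparr>"

definition set_elem :: "string \<Rightarrow> nat \<Rightarrow> nat \<Rightarrow> state \<Rightarrow> state" where
  "set_elem a k v s = s\<lparr>arr := (arr s)(a := (arr s a)(k := v))\<rparr>"

text \<open>\<open>exec c s t s'\<close>: started in \<open>s\<close>, the program \<open>c\<close> halts in \<open>s'\<close> after \<open>t\<close> operations.\<close>

inductive exec :: "com \<Rightarrow> state \<Rightarrow> nat \<Rightarrow> state \<Rightarrow> bool" where
  exec_Skip: "exec Skip s 1 s"
| exec_SetReg: "exec (SetReg x e) s (1 + exp_cost e) (set_reg x (eval_exp e s) s)"
| exec_SetElem:
    "exec (SetElem a e f) s (1 + exp_cost e + exp_cost f)
       (set_elem a (eval_exp e s) (eval_exp f s) s)"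
| exec_Seq: "exec c s t s' \<Longrightarrow> exec c' s' t' s'' \<Longrightarrow> exec (Seq c c') s (t + t') s''"
| exec_CondTrue:
    "eval_exp b s \<noteq> 0 \<Longrightarrow> exec c s t s' \<Longrightarrow> exec (Cond b c c') s (1 + exp_cost b + t) s'"
| exec_CondFalse:
    "eval_exp b s = 0 \<Longrightarrow> exec c' s t s' \<Longrightarrow> exec (Cond b c c') s (1 + exp_cost b + t) s'"
| exec_WhileFalse: "eval_exp b s = 0 \<Longrightarrow> exec (While b c) s (1 + exp_cost b) s"
| exec_WhileTrue:
    "eval_exp b s \<noteq> 0 \<Longrightarrow> exec c s t s' \<Longrightarrow> exec (While b c) s' t' s'' \<Longrightarrow>
     exec (While b c) s (1 + exp_cost b + t + t') s''"


section \<open>Problem instances\<close>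

text \<open>
  An instance consists of the number of nodes, an enumeration \<open>es\<close> of the edges and an enumeration
  \<open>cs\<close> of the measured nodes, each in arbitrary order and without repetition.
\<close>

definition network_instance :: "nat \<Rightarrow> edge list \<Rightarrow> nat list \<Rightarrow> bool" where
  "network_instance L es cs \<longleftrightarrow>
     digraph L (set es) \<and> distinct es \<and> weakly_connected L (set es) \<and>
     set cs \<subseteq> {..<L} \<and> distinct cs"

definition list_to_array :: "nat list \<Rightarrow> nat \<Rightarrow> nat" where
  "list_to_array xs k = (if k < length xs then xs ! k else 0)"

text \<open>All registers and array cells that do not hold input are initially zero.\<close>

definition input_state :: "nat \<Rightarrow> edge list \<Rightarrow> nat list \<Rightarrow> state" where
  "input_state L es cs =
     \<lparr>reg = (\<lambda>_. 0)(''L'' := L, ''n'' := length es, ''p'' := length cs),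
      arr = (\<lambda>_ _. 0)(''tail'' := list_to_array (map fst es),
                      ''head'' := list_to_array (map snd es),
                      ''measured'' := list_to_array cs)\<rparr>"

definition edge_input_state :: "nat \<Rightarrow> edge list \<Rightarrow> nat list \<Rightarrow> edge \<Rightarrow> state" where
  "edge_input_state L es cs e =
     set_reg ''i'' (fst e) (set_reg ''j'' (snd e) (input_state L es cs))"

end

theory Submission
  imports Defs "Jordan_Normal_Form.Determinant"
begin

text \<open>
  If \<open>C T = C T'\<close>, column \<open>i\<close> of \<open>G - G'\<close> has the form \<open>(I - G) x\<close> with \<open>x\<close> vanishing on the measured
  nodes, and it vanishes in every row \<open>r\<close> such that \<open>(i, r)\<close> is not an edge; conversely, every such
  \<open>x\<close> with \<open>x i \<noteq> 1\<close> yields an indistinguishable network. Hence \<open>(i, j)\<close> is identifiable iff, in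
  \<open>I - G\<close> restricted to the unmeasured columns, row \<open>j\<close> is generically in the span of the rows \<open>r\<close>
  with \<open>(i, r)\<close> not an edge. In spite of the fixed diagonal, this independence is decided by matchings
  in the bipartite graph that joins row \<open>r\<close> to the unmeasured columns among \<open>r\<close> and its in-neighbours:
  a failed search for an augmenting path yields a square submatrix that is generically nonsingular and
  spans the row, and a successful one a larger nonsingular submatrix. Since \<open>L \<le> n + 1\<close>, a search
  costs \<open>O(n)\<close>, and all edges leaving one node are settled by \<open>L\<close> searches. This is the dual of the
  criterion by vertex-disjoint paths from the out-neighbours of \<open>i\<close> to the measured nodes.
\<close>

section \<open>Zero sets of polynomial functions\<close>

text \<open>Two difficulties shape the proof. Genericity concerns real parameters, while the linear
  algebra lives over rational functions in \<open>z\<close>. Multiplying \<open>I - G\<close> by the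
  product of all denominators gives polynomials in \<open>z\<close>, and their values at
  \<open>z = 1\<close> are polynomials in the parameters; a minor that is nonzero at one parameter
  vector is then nonzero almost everywhere, for every choice of delays and orders. The converse
  needs a single parametrization with a nonnull exceptional set, and constant gains are chosen:
  constants are proper and stable, so the competing network is well-posed as soon as
  \<open>I - G'\<close> is invertible. It is a rank-one change of \<open>G\<close>, and its inverse
  is explicit. On the combinatorial side, a failed search leaves a certificate that carries a
  matching of its own instead of referring to the current one. It therefore survives all later
  augmentations, and one pass over the admissible rows yields a matched set on which every other
  admissible row depends.\<close>

definition separately_polynomial :: "'i set \<Rightarrow> (('i \<Rightarrow> real) \<Rightarrow> real) \<Rightarrow> bool" where
  "separately_polynomial I f \<longleftrightarrow>
     f \<in> borel_measurable (\<Pi>\<^sub>M x\<in>I. lborel) \<and> (\<forall>P x. \<exists>p. \<forall>t. f (P(x := t)) = poly p t)"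

lemma separately_polynomial_const: "separately_polynomial I (\<lambda>P. a)"
  unfolding separately_polynomial_def by (auto intro!: exI[of _ "[:a:]"])

lemma separately_polynomial_coord: "x \<in> I \<Longrightarrow> separately_polynomial I (\<lambda>P. P x)"
proof -
  assume "x \<in> I"
  moreover have "\<exists>p. \<forall>t. (P(y := t)) x = poly p t" for P :: "'a \<Rightarrow> real" and y
    by (cases "x = y") (auto intro: exI[of _ "[:0, 1:]"] exI[of _ "[:P x:]"])
  moreover have "(\<lambda>P :: 'a \<Rightarrow> real. P x) \<in> borel_measurable (\<Pi>\<^sub>M x\<in>I. lborel)"
    using measurable_component_singleton[OF \<open>x \<in> I\<close>, of "\<lambda>_. lborel :: real measure"] by simp
  ultimately show ?thesis
    unfolding separately_polynomial_def by blast
qed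

lemma separately_polynomial_add:
  assumes "separately_polynomial I f" "separately_polynomial I g"
  shows "separately_polynomial I (\<lambda>P. f P + g P)"
  unfolding separately_polynomial_def
proof (intro conjI allI)
  show "(\<lambda>P. f P + g P) \<in> borel_measurable (\<Pi>\<^sub>M x\<in>I. lborel)"
    using assms unfolding separately_polynomial_def by (intro borel_measurable_add) auto
  fix P x
  obtain p q where "\<forall>t. f (P(x := t)) = poly p t" "\<forall>t. g (P(x := t)) = poly q t"
    using assms unfolding separately_polynomial_def by metis
  then show "\<exists>p. \<forall>t. f (P(x := t)) + g (P(x := t)) = poly p t"
    by (intro exI[of _ "p + q"]) simp
qed

lemma separately_polynomial_mult:
  assumes "separately_polynomial I f" "separately_polynomial I g"
  shows "separately_polynomial I (\<lambda>P. f P * g P)"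
  unfolding separately_polynomial_def
proof (intro conjI allI)
  show "(\<lambda>P. f P * g P) \<in> borel_measurable (\<Pi>\<^sub>M x\<in>I. lborel)"
    using assms unfolding separately_polynomial_def by (intro borel_measurable_times) auto
  fix P x
  obtain p q where "\<forall>t. f (P(x := t)) = poly p t" "\<forall>t. g (P(x := t)) = poly q t"
    using assms unfolding separately_polynomial_def by metis
  then show "\<exists>p. \<forall>t. f (P(x := t)) * g (P(x := t)) = poly p t"
    by (intro exI[of _ "p * q"]) simp
qed

lemma separately_polynomial_sum:
  "(\<And>k. k \<in> K \<Longrightarrow> separately_polynomial I (f k)) \<Longrightarrow>
   separately_polynomial I (\<lambda>P. \<Sum>k\<in>K. f k P)"
  by (induction K rule: infinite_finite_induct)
    (auto intro: separately_polynomial_const separately_polynomial_add)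

lemma separately_polynomial_prod:
  "(\<And>k. k \<in> K \<Longrightarrow> separately_polynomial I (f k)) \<Longrightarrow>
   separately_polynomial I (\<lambda>P. \<Prod>k\<in>K. f k P)"
  by (induction K rule: infinite_finite_induct)
    (auto intro: separately_polynomial_const separately_polynomial_mult)

lemma separately_polynomial_diff:
  assumes "separately_polynomial I f" "separately_polynomial I g"
  shows "separately_polynomial I (\<lambda>P. f P - g P)"
  using separately_polynomial_add[OF assms(1)
      separately_polynomial_mult[OF separately_polynomial_const[of I "-1"] assms(2)]]
  by simp

lemma separately_polynomial_det:
  assumes "\<And>a b. a < m \<Longrightarrow> b < m \<Longrightarrow> separately_polynomial I (\<lambda>P. F P a b)"
  shows "separately_polynomial I (\<lambda>P. det (mat m m (\<lambda>(a, b). F P a b)))"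
proof -
  have "det (mat m m (\<lambda>(a, b). F P a b)) =
      (\<Sum>p\<in>{p. p permutes {0..<m}}. signof p * (\<Prod>i = 0..<m. F P i (p i)))" for P
    unfolding det_def by (auto intro!: sum.cong prod.cong simp: permutes_in_image)
  then show ?thesis
    using assms
    by (auto intro!: separately_polynomial_sum separately_polynomial_mult
        separately_polynomial_const separately_polynomial_prod)
qed

lemma AE_lborel_poly_nonzero:
  fixes p :: "real poly"
  assumes "p \<noteq> 0"
  shows "AE t in lborel. poly p t \<noteq> 0"
  using AE_not_in[OF countable_imp_null_set_lborel[OF
      countable_finite[OF poly_roots_finite[OF assms]]]] by simp

text \<open>Fubini, one coordinate at a time. Freezing coordinate \<open>x\<close> at
  \<open>P0 x\<close> gives a function of the other coordinates that is again nonzero somewhere,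
  hence almost everywhere; wherever it is nonzero, \<open>f\<close> is a nonzero polynomial in
  coordinate \<open>x\<close> and has finitely many roots. The induction works with polynomiality in
  each variable separately, so multivariate polynomials never appear.\<close>

lemma AE_separately_polynomial_nonzero:
  fixes f :: "('i \<Rightarrow> real) \<Rightarrow> real"
  assumes "finite I" "separately_polynomial I f" "P0 \<in> extensional I" "f P0 \<noteq> 0"
  shows "AE P in (\<Pi>\<^sub>M x\<in>I. lborel). f P \<noteq> 0"
  using assms
proof (induction I arbitrary: f P0 rule: finite_induct)
  \<comment> \<open>The product over no coordinates consists of one point. As \<open>P0\<close> is
    extensional, it is that point.\<close>
  case empty
  then show ?case
    by (auto simp: AE_iff_nn_integral space_PiM PiM_empty intro!: AE_I2)
next
  case (insert x I)
  interpret product_sigma_finite "\<lambda>_::'i. lborel :: real measure" ..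
  let ?M = "\<lambda>I. \<Pi>\<^sub>M x\<in>I. (lborel :: real measure)"
  have meas: "f \<in> borel_measurable (?M (insert x I))"
    and pol: "\<And>P y. \<exists>p. \<forall>t. f (P(y := t)) = poly p t"
    using insert.prems unfolding separately_polynomial_def by auto
  define g where "g P = f (P(x := P0 x))" for P
  have "separately_polynomial I g"
    unfolding separately_polynomial_def
  proof (intro conjI allI)
    have "(\<lambda>P. P(x := P0 x)) \<in> measurable (?M I) (?M (insert x I))"
      by (rule measurable_fun_upd) auto
    then show "g \<in> borel_measurable (?M I)"
      unfolding g_def using meas by (rule measurable_compose)
    fix P y
    show "\<exists>p. \<forall>t. g (P(y := t)) = poly p t"
    proof (cases "y = x")
      case True
      then show ?thesis by (auto simp: g_def intro!: exI[of _ "[:f (P(x := P0 x)):]"])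
    next
      case False
      then show ?thesis using pol[of "P(x := P0 x)" y] by (simp add: g_def fun_upd_twist)
    qed
  qed
  moreover have "P0(x := undefined) \<in> extensional I"
    using insert.prems(2) by (auto simp: extensional_def)
  ultimately have "AE P in ?M I. g P \<noteq> 0"
    using insert.IH[of g "P0(x := undefined)"] insert.prems(3)
    unfolding g_def fun_upd_upd fun_upd_triv by blast
  then have AE: "AE P in ?M I. AE t in lborel. f (P(x := t)) \<noteq> 0"
  proof eventually_elim
    case (elim P)
    obtain p where p: "\<forall>t. f (P(x := t)) = poly p t" using pol by blast
    then have "p \<noteq> 0" using elim by (auto simp: g_def)
    with p show ?case using AE_lborel_poly_nonzero by simp
  qed
  let ?i = "\<lambda>P. indicator {0} (f P) :: ennreal"
  have meas': "?i \<in> borel_measurable (?M (insert x I))"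
    using meas by measurable
  have "(\<integral>\<^sup>+ P. ?i P \<partial>?M (insert x I)) = (\<integral>\<^sup>+ P. (\<integral>\<^sup>+ t. ?i (P(x := t)) \<partial>lborel) \<partial>?M I)"
    using insert.hyps meas' by (rule product_nn_integral_insert)
  also have "\<dots> = (\<integral>\<^sup>+ P. 0 \<partial>?M I)"
  proof (rule nn_integral_cong_AE)
    show "AE P in ?M I. (\<integral>\<^sup>+ t. ?i (P(x := t)) \<partial>lborel) = 0"
      using AE
    proof eventually_elim
      case (elim P)
      have "(\<integral>\<^sup>+ t. ?i (P(x := t)) \<partial>lborel) = (\<integral>\<^sup>+ t. 0 \<partial>(lborel :: real measure))"
        by (rule nn_integral_cong_AE) (use elim in eventually_elim, simp)
      then show ?case by simp
    qed
  qed
  finally have "(\<integral>\<^sup>+ P. ?i P \<partial>?M (insert x I)) = 0" by simp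
  then have "AE P in ?M (insert x I). ?i P = 0"
    using nn_integral_0_iff_AE[OF meas'] by simp
  then show ?case by eventually_elim (auto split: split_indicator_asm)
qed

section \<open>Nonsingular submatrices\<close>

lemma bij_betw_matched_columns:
  assumes "distinct xs" "inj_on \<mu> (set xs)"
  shows "bij_betw (\<lambda>b. \<mu> (xs ! b)) {0..<length xs} (\<mu> ` set xs)"
  using bij_betw_trans[OF bij_betw_nth[OF assms(1), of "{0..<length xs}" "set xs"]
      inj_on_imp_bij_betw[OF assms(2)]]
  by (auto simp: o_def atLeast0LessThan)

lemma det_nonzero_inverse:
  fixes A :: "'a :: field mat"
  assumes "A \<in> carrier_mat n n" "det A \<noteq> 0"
  obtains B where "B \<in> carrier_mat n n" "A * B = 1\<^sub>m n" "B * A = 1\<^sub>m n"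
  using det_non_zero_imp_unit[OF assms, of "()"]
  unfolding Units_def ring_mat_def by auto

text \<open>The column in position \<open>b\<close> is the partner of the row in position
  \<open>b\<close>, so the matched entries lie on the diagonal. This lemma and the next two
  translate between determinants, which need positions, and sums over the set of matched columns,
  which do not depend on an ordering.\<close>

lemma det_submatrix_nonzero_imp_kernel_zero:
  fixes M :: "nat \<Rightarrow> nat \<Rightarrow> 'a :: field"
  assumes det: "det (mat (length xs) (length xs) (\<lambda>(a, b). M (xs ! a) (\<mu> (xs ! b)))) \<noteq> 0"
    and "distinct xs" "inj_on \<mu> (set xs)"
    and zero: "\<And>r. r \<in> set xs \<Longrightarrow> (\<Sum>c\<in>\<mu> ` set xs. M r c * x c) = 0"
    and "c \<in> \<mu> ` set xs"
  shows "x c = 0"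
proof -
  define n where "n = length xs"
  define A where "A = mat n n (\<lambda>(a, b). M (xs ! a) (\<mu> (xs ! b)))"
  define v where "v = vec n (\<lambda>b. x (\<mu> (xs ! b)))"
  have A: "A \<in> carrier_mat n n" by (simp add: A_def)
  have bij: "bij_betw (\<lambda>b. \<mu> (xs ! b)) {0..<n} (\<mu> ` set xs)"
    unfolding n_def using assms(2,3) by (rule bij_betw_matched_columns)
  have "A *\<^sub>v v = 0\<^sub>v n"
  proof (rule eq_vecI)
    fix a assume "a < dim_vec (0\<^sub>v n :: 'a vec)"
    then have a: "a < n" by simp
    then have "(A *\<^sub>v v) $ a = (\<Sum>b = 0..<n. M (xs ! a) (\<mu> (xs ! b)) * x (\<mu> (xs ! b)))"
      by (simp add: A_def v_def scalar_prod_def)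
    also have "\<dots> = (\<Sum>c\<in>\<mu> ` set xs. M (xs ! a) c * x c)"
      by (rule sum.reindex_bij_betw[OF bij])
    also have "\<dots> = 0" using zero a by (simp add: n_def)
    finally show "(A *\<^sub>v v) $ a = 0\<^sub>v n $ a" using a by simp
  qed (simp add: A_def)
  moreover have "det A \<noteq> 0" using det by (simp add: A_def n_def)
  moreover have "v \<in> carrier_vec n" by (simp add: v_def)
  ultimately have "v = 0\<^sub>v n"
    using det_0_iff_vec_prod_zero_field[OF A] by blast
  have "c \<in> (\<lambda>b. \<mu> (xs ! b)) ` {0..<n}"
    using bij \<open>c \<in> \<mu> ` set xs\<close> by (simp add: bij_betw_def)
  then obtain b where "b < n" "c = \<mu> (xs ! b)" by auto
  then have "x c = v $ b" by (simp add: v_def)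
  then show ?thesis using \<open>v = 0\<^sub>v n\<close> \<open>b < n\<close> by simp
qed

lemma kernel_zero_imp_det_submatrix_nonzero:
  fixes M :: "nat \<Rightarrow> nat \<Rightarrow> 'a :: field"
  assumes "distinct xs" "inj_on \<mu> (set xs)"
    and ker: "\<And>x. (\<And>r. r \<in> set xs \<Longrightarrow> (\<Sum>c\<in>\<mu> ` set xs. M r c * x c) = 0) \<Longrightarrow>
      \<forall>c\<in>\<mu> ` set xs. x c = 0"
  shows "det (mat (length xs) (length xs) (\<lambda>(a, b). M (xs ! a) (\<mu> (xs ! b)))) \<noteq> 0"
proof
  define n where "n = length xs"
  define A where "A = mat n n (\<lambda>(a, b). M (xs ! a) (\<mu> (xs ! b)))"
  have A: "A \<in> carrier_mat n n" by (simp add: A_def)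
  have bij: "bij_betw (\<lambda>b. \<mu> (xs ! b)) {0..<n} (\<mu> ` set xs)"
    unfolding n_def using assms(1,2) by (rule bij_betw_matched_columns)
  assume "det (mat (length xs) (length xs) (\<lambda>(a, b). M (xs ! a) (\<mu> (xs ! b)))) = 0"
  then obtain v where v: "v \<in> carrier_vec n" "v \<noteq> 0\<^sub>v n" "A *\<^sub>v v = 0\<^sub>v n"
    using det_0_iff_vec_prod_zero_field[OF A] by (auto simp: A_def n_def)
  \<comment> \<open>The kernel vector is indexed by positions; \<open>ix\<close> recovers the
    position of a column, which makes it a function on columns to which \<open>ker\<close>
    applies.\<close>
  define ix where "ix = the_inv_into {0..<n} (\<lambda>b. \<mu> (xs ! b))"
  have ix: "ix (\<mu> (xs ! b)) = b" if "b < n" for b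
    unfolding ix_def using that bij
    by (intro the_inv_into_f_f[where f = "\<lambda>b. \<mu> (xs ! b)"]) (auto simp: bij_betw_def)
  have "(\<Sum>c\<in>\<mu> ` set xs. M r c * v $ ix c) = 0" if r: "r \<in> set xs" for r
  proof -
    obtain a where a: "a < n" "r = xs ! a"
      using r by (auto simp: in_set_conv_nth n_def)
    have "(\<Sum>c\<in>\<mu> ` set xs. M r c * v $ ix c) = (\<Sum>b = 0..<n. M r (\<mu> (xs ! b)) * v $ ix (\<mu> (xs ! b)))"
      by (rule sum.reindex_bij_betw[OF bij, symmetric])
    also have "\<dots> = (A *\<^sub>v v) $ a"
      using a v(1) by (simp add: A_def scalar_prod_def ix)
    finally show ?thesis using a v by simp
  qed
  then have "\<forall>c\<in>\<mu> ` set xs. v $ ix c = 0" by (rule ker)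
  then have "v $ b = 0" if "b < n" for b
    using ix[OF that] that by (metis image_eqI n_def nth_mem)
  then have "v = 0\<^sub>v n" using v(1) by (intro eq_vecI) auto
  with v show False by simp
qed

lemma det_submatrix_nonzero_imp_solvable:
  fixes M :: "nat \<Rightarrow> nat \<Rightarrow> 'a :: field"
  assumes det: "det (mat (length xs) (length xs) (\<lambda>(a, b). M (xs ! a) (\<mu> (xs ! b)))) \<noteq> 0"
    and "distinct xs" "inj_on \<mu> (set xs)"
  obtains x where "\<And>r. r \<in> set xs \<Longrightarrow> (\<Sum>c\<in>\<mu> ` set xs. M r c * x c) = y r"
    "\<And>c. c \<notin> \<mu> ` set xs \<Longrightarrow> x c = 0"
proof -
  define n where "n = length xs"
  define A where "A = mat n n (\<lambda>(a, b). M (xs ! a) (\<mu> (xs ! b)))"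
  have A: "A \<in> carrier_mat n n" by (simp add: A_def)
  have bij: "bij_betw (\<lambda>b. \<mu> (xs ! b)) {0..<n} (\<mu> ` set xs)"
    unfolding n_def using assms(2,3) by (rule bij_betw_matched_columns)
  have "det A \<noteq> 0" using det by (simp add: A_def n_def)
  then obtain B where B: "B \<in> carrier_mat n n" "A * B = 1\<^sub>m n"
    using det_nonzero_inverse[OF A] by metis
  define w where "w = vec n (\<lambda>a. y (xs ! a))"
  define v where "v = B *\<^sub>v w"
  have w: "w \<in> carrier_vec n" by (simp add: w_def)
  have v: "v \<in> carrier_vec n" unfolding v_def using B(1) w by (rule mult_mat_vec_carrier)
  have Av: "A *\<^sub>v v = w"
    unfolding v_def using A B w by (simp flip: assoc_mult_mat_vec)
  define ix where "ix = the_inv_into {0..<n} (\<lambda>b. \<mu> (xs ! b))"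
  define x where "x c = (if c \<in> \<mu> ` set xs then v $ ix c else 0)" for c
  have x: "x (\<mu> (xs ! b)) = v $ b" if "b < n" for b
  proof -
    have "ix (\<mu> (xs ! b)) = b"
      unfolding ix_def using that bij
      by (intro the_inv_into_f_f[where f = "\<lambda>b. \<mu> (xs ! b)"]) (auto simp: bij_betw_def)
    then show ?thesis using that by (simp add: x_def n_def)
  qed
  have "(\<Sum>c\<in>\<mu> ` set xs. M r c * x c) = y r" if r: "r \<in> set xs" for r
  proof -
    obtain a where a: "a < n" "r = xs ! a"
      using r by (auto simp: in_set_conv_nth n_def)
    have "(\<Sum>c\<in>\<mu> ` set xs. M r c * x c) = (\<Sum>b = 0..<n. M r (\<mu> (xs ! b)) * x (\<mu> (xs ! b)))"
      by (rule sum.reindex_bij_betw[OF bij, symmetric])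
    also have "\<dots> = (A *\<^sub>v v) $ a"
      using a v by (simp add: A_def scalar_prod_def x)
    finally show ?thesis using a by (simp add: Av w_def)
  qed
  then show ?thesis using that by (metis x_def)
qed

section \<open>Matchings and generic nonsingularity\<close>

definition matching :: "(nat \<Rightarrow> nat \<Rightarrow> bool) \<Rightarrow> (nat \<Rightarrow> nat) \<Rightarrow> nat set \<Rightarrow> bool" where
  "matching adj \<mu> X \<longleftrightarrow> inj_on \<mu> X \<and> (\<forall>r\<in>X. adj r (\<mu> r))"

text \<open>For \<open>r\<close> outside \<open>X\<close> this is a violation of Hall's condition:
  the rows of \<open>insert r X\<close> together reach only the partners of \<open>X\<close>. The
  matching is quantified existentially so that the certificate does not depend on the matching that
  the search currently holds.\<close>

definition blocked :: "(nat \<Rightarrow> nat \<Rightarrow> bool) \<Rightarrow> nat \<Rightarrow> nat set \<Rightarrow> bool" where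
  "blocked adj r Z \<longleftrightarrow>
     (\<exists>X\<subseteq>Z. \<exists>\<mu>. matching adj \<mu> X \<and> (\<forall>r'\<in>insert r X. \<forall>c. adj r' c \<longrightarrow> c \<in> \<mu> ` X))"

definition row_column :: "nat \<Rightarrow> edge set \<Rightarrow> nat set \<Rightarrow> nat \<Rightarrow> nat \<Rightarrow> bool" where
  "row_column L E C r c \<longleftrightarrow> c < L \<and> c \<notin> C \<and> (c = r \<or> (c, r) \<in> E)"

text \<open>Applied when an augmentation enlarges \<open>Z\<close>: a certificate mentions only the
  rows of its own \<open>X\<close>.\<close>

lemma blocked_mono: "blocked adj r Z \<Longrightarrow> Z \<subseteq> Z' \<Longrightarrow> blocked adj r Z'"
  unfolding blocked_def by (meson order_trans)

text \<open>On vectors that vanish at the measured nodes, the rows \<open>xs\<close> form a square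
  system in the columns matched to them. Nonsingularity forces \<open>x\<close> to vanish on these
  columns, and row \<open>r\<close> meets no other unmeasured column. This is the dependence of row
  \<open>r\<close> on the rows \<open>xs\<close>, phrased through kernels.\<close>

lemma blocked_row_zero:
  fixes M :: "nat \<Rightarrow> nat \<Rightarrow> 'a :: field"
  assumes supp: "\<And>r c. M r c \<noteq> 0 \<Longrightarrow> c = r \<or> (c, r) \<in> E"
    and x: "\<And>c. c \<in> C \<Longrightarrow> x c = 0"
    and xs: "distinct xs"
    and match: "matching (row_column L E C) \<mu> (set xs)"
    and closed: "\<forall>r'\<in>insert r (set xs). \<forall>c. row_column L E C r' c \<longrightarrow> c \<in> \<mu> ` set xs"
    and det: "det (mat (length xs) (length xs) (\<lambda>(a, b). M (xs ! a) (\<mu> (xs ! b)))) \<noteq> 0"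
    and zero: "\<And>r'. r' \<in> set xs \<Longrightarrow> (\<Sum>c<L. M r' c * x c) = 0"
  shows "(\<Sum>c<L. M r c * x c) = 0"
proof -
  have sub: "\<mu> ` set xs \<subseteq> {..<L}"
    using match by (auto simp: matching_def row_column_def)
  have eq: "(\<Sum>c<L. M r' c * x c) = (\<Sum>c\<in>\<mu> ` set xs. M r' c * x c)"
    if "r' \<in> insert r (set xs)" for r'
  proof (rule sum.mono_neutral_right)
    show "\<forall>c\<in>{..<L} - \<mu> ` set xs. M r' c * x c = 0"
    proof
      fix c assume c: "c \<in> {..<L} - \<mu> ` set xs"
      then have "\<not> row_column L E C r' c" using closed that by blast
      then show "M r' c * x c = 0" using c supp[of r' c] x by (auto simp: row_column_def)
    qed
  qed (use sub in auto)
  have "x c = 0" if "c \<in> \<mu> ` set xs" for c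
    using det xs _ _ that
  proof (rule det_submatrix_nonzero_imp_kernel_zero)
    show "inj_on \<mu> (set xs)" using match by (simp add: matching_def)
    show "(\<Sum>c\<in>\<mu> ` set xs. M r c * x c) = 0" if "r \<in> set xs" for r
      using zero[OF that] eq[of r] that by simp
  qed
  then show ?thesis by (simp add: eq)
qed

section \<open>Clearing denominators and evaluating at \<open>z = 1\<close>\<close>

definition num_poly :: "(edge \<Rightarrow> nat) \<Rightarrow> (coord \<Rightarrow> real) \<Rightarrow> edge \<Rightarrow> real poly" where
  "num_poly ord P e = Polynomial.smult (P (Kappa e)) (monic_poly (ord e) (\<lambda>m. P (Beta e m)))"

definition den_poly :: "(edge \<Rightarrow> nat) \<Rightarrow> (edge \<Rightarrow> nat) \<Rightarrow> (coord \<Rightarrow> real) \<Rightarrow> edge \<Rightarrow> real poly" where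
  "den_poly d ord P e = Polynomial.monom 1 (d e) * monic_poly (ord e) (\<lambda>m. P (Alpha e m))"

text \<open>The factor is the same at all positions, so clearing scales a minor by a power of it and
  cannot change whether it vanishes.\<close>

definition cleared_entry ::
  "edge set \<Rightarrow> (edge \<Rightarrow> nat) \<Rightarrow> (edge \<Rightarrow> nat) \<Rightarrow> (coord \<Rightarrow> real) \<Rightarrow> nat \<Rightarrow> nat \<Rightarrow> real poly" where
  "cleared_entry E d ord P r c =
     (if r = c then \<Prod>e\<in>E. den_poly d ord P e else 0) -
     (if (c, r) \<in> E then num_poly ord P (c, r) * (\<Prod>e\<in>E - {(c, r)}. den_poly d ord P e) else 0)"

definition entry ::
  "edge set \<Rightarrow> (edge \<Rightarrow> nat) \<Rightarrow> (edge \<Rightarrow> nat) \<Rightarrow> (coord \<Rightarrow> real) \<Rightarrow> nat \<Rightarrow> nat \<Rightarrow> transfer" where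
  "entry E d ord P r c =
     (if r = c then 1 else 0) - (if (c, r) \<in> E then edge_transfer d ord P (c, r) else 0)"

lemma monic_poly_nonzero: "monic_poly k c \<noteq> 0"
proof -
  have "Polynomial.coeff (monic_poly k c) k = 1"
    unfolding monic_poly_def by (simp add: coeff_sum)
  then show ?thesis by auto
qed

lemma den_poly_nonzero: "den_poly d ord P e \<noteq> 0"
  by (simp add: den_poly_def monic_poly_nonzero)

lemma poly_monic_poly_1: "poly (monic_poly k c) 1 = 1 + (\<Sum>m<k. c m)"
  by (simp add: monic_poly_def poly_monom poly_sum)

lemma to_fract_cleared_entry:
  assumes "finite E"
  shows "to_fract (cleared_entry E d ord P r c) =
    to_fract (\<Prod>e\<in>E. den_poly d ord P e) * entry E d ord P r c"
proof -
  have "to_fract (num_poly ord P e * (\<Prod>e\<in>E - {e}. den_poly d ord P e)) =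
      to_fract (\<Prod>e\<in>E. den_poly d ord P e) * edge_transfer d ord P e" if "e \<in> E" for e
    using that assms den_poly_nonzero[of d ord P e]
    by (simp add: prod.remove[of E e] to_fract_def edge_transfer_def
        flip: num_poly_def den_poly_def) (simp add: eq_fract mult_ac)
  then show ?thesis
    by (auto simp: cleared_entry_def entry_def algebra_simps simp del: to_fract_mult)
qed

lemma Kappa_in_coords [simp]: "Kappa e \<in> coords E ord \<longleftrightarrow> e \<in> E"
  and Beta_in_coords [simp]: "Beta e m \<in> coords E ord \<longleftrightarrow> e \<in> E \<and> m < ord e"
  and Alpha_in_coords [simp]: "Alpha e m \<in> coords E ord \<longleftrightarrow> e \<in> E \<and> m < ord e"
  by (auto simp: coords_def simp del: split_paired_All split_paired_Ex)

text \<open>At \<open>z = 1\<close> the delay factor becomes 1 and a monic polynomial becomes 1 plus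
  the sum of its other coefficients, so each parameter enters polynomially.\<close>

lemma separately_polynomial_cleared_entry:
  "separately_polynomial (coords E ord) (\<lambda>P. poly (cleared_entry E d ord P r c) 1)"
proof -
  have num: "separately_polynomial (coords E ord) (\<lambda>P. poly (num_poly ord P e) 1)"
    if "e \<in> E" for e
    unfolding num_poly_def poly_smult poly_monic_poly_1 using that
    by (intro separately_polynomial_mult separately_polynomial_add separately_polynomial_sum
        separately_polynomial_const separately_polynomial_coord) auto
  have den: "separately_polynomial (coords E ord) (\<lambda>P. poly (den_poly d ord P e) 1)"
    if "e \<in> E" for e
    unfolding den_poly_def poly_mult poly_monom poly_monic_poly_1 using that
    by (intro separately_polynomial_mult separately_polynomial_add separately_polynomial_sum
        separately_polynomial_const separately_polynomial_coord) auto
  have "separately_polynomial (coords E ord)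
      (\<lambda>P. if r = c then \<Prod>e\<in>E. poly (den_poly d ord P e) 1 else 0)"
    using den by (cases "r = c")
      (auto intro: separately_polynomial_prod separately_polynomial_const)
  moreover have "separately_polynomial (coords E ord)
      (\<lambda>P. if (c, r) \<in> E then poly (num_poly ord P (c, r)) 1 *
        (\<Prod>e\<in>E - {(c, r)}. poly (den_poly d ord P e) 1) else 0)"
    using num den by (cases "(c, r) \<in> E")
      (auto intro!: separately_polynomial_prod separately_polynomial_mult separately_polynomial_const)
  ultimately have "separately_polynomial (coords E ord)
      (\<lambda>P. (if r = c then \<Prod>e\<in>E. poly (den_poly d ord P e) 1 else 0) -
        (if (c, r) \<in> E then poly (num_poly ord P (c, r)) 1 *
        (\<Prod>e\<in>E - {(c, r)}. poly (den_poly d ord P e) 1) else 0))"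
    by (rule separately_polynomial_diff)
  moreover have "poly (cleared_entry E d ord P r c) 1 =
      (if r = c then \<Prod>e\<in>E. poly (den_poly d ord P e) 1 else 0) -
        (if (c, r) \<in> E then poly (num_poly ord P (c, r)) 1 *
        (\<Prod>e\<in>E - {(c, r)}. poly (den_poly d ord P e) 1) else 0)" for P
    by (simp add: cleared_entry_def poly_prod)
  ultimately show ?thesis by simp
qed

text \<open>With all entries free, the product of the matched entries would be a monomial that
  nothing cancels. The diagonal of \<open>I - G\<close> is fixed, so this argument is replaced by an
  explicit parameter vector at which the determinant is nonzero.\<close>

lemma AE_det_cleared_nonzero:
  assumes "finite E" "\<And>v. (v, v) \<notin> E"
    and xs: "distinct xs" and inj: "inj_on \<mu> (set xs)"
    and adj: "\<And>r. r \<in> set xs \<Longrightarrow> \<mu> r = r \<or> (\<mu> r, r) \<in> E"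
  shows "AE P in (\<Pi>\<^sub>M x\<in>coords E ord. lborel).
    det (mat (length xs) (length xs)
      (\<lambda>(a, b). poly (cleared_entry E d ord P (xs ! a) (\<mu> (xs ! b))) 1)) \<noteq> 0"
proof (rule AE_separately_polynomial_nonzero)
  have "coords E ord =
      Kappa ` E \<union> (\<Union>e\<in>E. Beta e ` {..<ord e}) \<union> (\<Union>e\<in>E. Alpha e ` {..<ord e})"
    unfolding coords_def by auto
  then show "finite (coords E ord)" using \<open>finite E\<close> by simp
  show "separately_polynomial (coords E ord) (\<lambda>P. det (mat (length xs) (length xs)
      (\<lambda>(a, b). poly (cleared_entry E d ord P (xs ! a) (\<mu> (xs ! b))) 1)))"
    by (intro separately_polynomial_det separately_polynomial_cleared_entry)
  \<comment> \<open>At \<open>P0\<close> the matched entries are \<open>2\<close>, or \<open>1\<close> on the diagonal, and the only other nonzero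
    entries are the diagonal ones of rows matched elsewhere: the submatrix is diagonally dominant up
    to permutation.\<close>
  define P0 where "P0 = restrict (\<lambda>x. case x of
      Kappa (c, r) \<Rightarrow> if r \<in> set xs \<and> \<mu> r = c then -2 else 0 | _ \<Rightarrow> (0::real)) (coords E ord)"
  show "P0 \<in> extensional (coords E ord)" by (simp add: P0_def)
  have den: "poly (den_poly d ord P0 e) 1 = 1" if "e \<in> E" for e
    using that by (simp add: den_poly_def poly_monom poly_monic_poly_1 P0_def)
  have num: "poly (num_poly ord P0 (c, r)) 1 = (if r \<in> set xs \<and> \<mu> r = c then -2 else 0)"
    if "(c, r) \<in> E" for c r
  proof -
    have "P0 (Beta (c, r) m) = 0" if "m < ord (c, r)" for m
      using that \<open>(c, r) \<in> E\<close> by (simp add: P0_def)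
    moreover have "P0 (Kappa (c, r)) = (if r \<in> set xs \<and> \<mu> r = c then -2 else 0)"
      using \<open>(c, r) \<in> E\<close> by (simp add: P0_def)
    ultimately show ?thesis by (simp add: num_poly_def poly_monic_poly_1)
  qed
  have val: "poly (cleared_entry E d ord P0 r c) 1 =
      (if r = c then 1 else 0) + (if (c, r) \<in> E \<and> r \<in> set xs \<and> \<mu> r = c then 2 else 0)" for r c
    by (auto simp: cleared_entry_def poly_prod den num)
  show "det (mat (length xs) (length xs)
      (\<lambda>(a, b). poly (cleared_entry E d ord P0 (xs ! a) (\<mu> (xs ! b))) 1)) \<noteq> 0"
    using xs inj
  proof (rule kernel_zero_imp_det_submatrix_nonzero)
    fix x :: "nat \<Rightarrow> real"
    assume zero: "\<And>r. r \<in> set xs \<Longrightarrow>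
      (\<Sum>c\<in>\<mu> ` set xs. poly (cleared_entry E d ord P0 r c) 1 * x c) = 0"
    show "\<forall>c\<in>\<mu> ` set xs. x c = 0"
    proof (cases "set xs = {}")
      case False
      then have "Max ((\<lambda>c. \<bar>x c\<bar>) ` \<mu> ` set xs) \<in> (\<lambda>c. \<bar>x c\<bar>) ` \<mu> ` set xs"
        by (intro Max_in) auto
      \<comment> \<open>Choose the row whose partner carries the largest absolute value. If the row
        is matched to itself, its equation says that this value is 0. Otherwise it reads
        \<open>x r + 2 * x (\<mu> r) = 0\<close>, with \<open>x r\<close> present only if column
        \<open>r\<close> is matched, and maximality again leaves only 0.\<close>
      then obtain r where r: "r \<in> set xs" "Max ((\<lambda>c. \<bar>x c\<bar>) ` \<mu> ` set xs) = \<bar>x (\<mu> r)\<bar>" by auto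
      have max: "\<bar>x c\<bar> \<le> \<bar>x (\<mu> r)\<bar>" if "c \<in> \<mu> ` set xs" for c
        using that by (auto simp flip: r(2))
      have "(\<Sum>c\<in>\<mu> ` set xs. poly (cleared_entry E d ord P0 r c) 1 * x c) =
          (\<Sum>c\<in>\<mu> ` set xs. (if r = c then x c else 0) +
            (if c = \<mu> r then (if \<mu> r = r then 0 else 2 * x c) else 0))"
        using adj[OF r(1)] r(1) assms(2) unfolding val by (intro sum.cong) auto
      also have "\<dots> = (if r \<in> \<mu> ` set xs then x r else 0) + (if \<mu> r = r then 0 else 2 * x (\<mu> r))"
        using r(1) by (simp add: sum.distrib)
      finally have eq: "(if r \<in> \<mu> ` set xs then x r else 0) + (if \<mu> r = r then 0 else 2 * x (\<mu> r)) = 0"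
        using zero[OF r(1)] by simp
      have "x (\<mu> r) = 0"
      proof (cases "\<mu> r = r")
        case True
        then show ?thesis using eq r(1) by (metis add.right_neutral imageI)
      next
        case False
        then show ?thesis using eq max[of r] by (auto split: if_splits)
      qed
      then show ?thesis using max by auto
    qed simp
  qed
qed

text \<open>Evaluation at 1 and the embedding into rational functions are ring homomorphisms and
  commute with \<open>det\<close>, so a zero determinant would remain zero after clearing and
  evaluation. Denominators are cleared before evaluating because they may themselves vanish at
  \<open>z = 1\<close>.\<close>

lemma det_cleared_nonzero_imp_det_entry_nonzero:
  assumes "finite E"
    and det: "det (mat m m (\<lambda>(a, b). poly (cleared_entry E d ord P (f a) (g b)) 1)) \<noteq> 0"
  shows "det (mat m m (\<lambda>(a, b). entry E d ord P (f a) (g b))) \<noteq> 0"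
proof
  interpret ev: comm_ring_hom "\<lambda>p :: real poly. poly p 1" by standard auto
  interpret fr: comm_ring_hom "to_fract :: real poly \<Rightarrow> transfer" by standard auto
  let ?D = "mat m m (\<lambda>(a, b). cleared_entry E d ord P (f a) (g b))"
  let ?M = "mat m m (\<lambda>(a, b). entry E d ord P (f a) (g b))"
  let ?q = "to_fract (\<Prod>e\<in>E. den_poly d ord P e)"
  assume M: "det ?M = 0"
  have "map_mat to_fract ?D = ?q \<cdot>\<^sub>m ?M"
    by (auto simp: to_fract_cleared_entry[OF \<open>finite E\<close>])
  then have "to_fract (det ?D) = det (?q \<cdot>\<^sub>m ?M)"
    by (metis fr.hom_det)
  also have "\<dots> = 0" using M by simp
  finally have "det ?D = 0" by simp
  then have "det (map_mat (\<lambda>p. poly p 1) ?D) = 0" by simp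
  moreover have "map_mat (\<lambda>p. poly p 1) ?D =
      mat m m (\<lambda>(a, b). poly (cleared_entry E d ord P (f a) (g b)) 1)" by auto
  ultimately show False using det by metis
qed

section \<open>The identifiability criterion\<close>

text \<open>The conclusion stays with the real determinant: it implies that the determinant of
  \<open>entry\<close> is nonzero, and for constant gains it can be used as it is.\<close>

lemma AE_det_entry_nonzero:
  assumes "digraph L E" "distinct xs" "matching (row_column L E C) \<mu> (set xs)"
  shows "AE P in (\<Pi>\<^sub>M x\<in>coords E ord. lborel).
    det (mat (length xs) (length xs)
      (\<lambda>(a, b). poly (cleared_entry E d ord P (xs ! a) (\<mu> (xs ! b))) 1)) \<noteq> 0"
  using assms by (intro AE_det_cleared_nonzero)
    (auto simp: digraph_def matching_def row_column_def intro: finite_subset)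

lemma entry_eq_one_minus_param_matrix:
  "r < L \<Longrightarrow> c < L \<Longrightarrow> (1\<^sub>m L - param_matrix L E d ord P) $$ (r, c) = entry E d ord P r c"
  by (auto simp: entry_def param_matrix_def)

lemma selection_matrix_mult_index:
  assumes "W \<in> carrier_mat L L" "k < length cs" "cs ! k < L" "c < L"
  shows "(selection_matrix L cs * W) $$ (k, c) = W $$ (cs ! k, c)"
proof -
  have "(selection_matrix L cs * W) $$ (k, c) = (\<Sum>l = 0..<L. (if l = cs ! k then 1 else 0) * W $$ (l, c))"
    using assms by (simp add: selection_matrix_def scalar_prod_def)
  also have "\<dots> = (\<Sum>l = 0..<L. if l = cs ! k then W $$ (l, c) else 0)"
    by (intro sum.cong) auto
  also have "\<dots> = W $$ (cs ! k, c)" using assms by simp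
  finally show ?thesis .
qed

text \<open>\<open>x\<close> is column \<open>i\<close> of \<open>W = T * (I - G') - I\<close>.
  Replacing \<open>C T\<close> by \<open>C T'\<close> gives \<open>C W = 0\<close>, and multiplying
  by \<open>I - G\<close> gives \<open>(I - G) W = (I - G') - (I - G) = G - G'\<close>.\<close>

lemma indistinguishable_column:
  assumes G: "G \<in> carrier_mat L L" "G' \<in> carrier_mat L L"
    and T: "is_inverse_of_I_minus L G T" "is_inverse_of_I_minus L G' T'"
    and eq: "selection_matrix L cs * T = selection_matrix L cs * T'"
    and cs: "set cs \<subseteq> {..<L}" and "i < L"
  obtains x where "\<And>c. c \<in> set cs \<Longrightarrow> x c = 0"
    "\<And>r. r < L \<Longrightarrow> (\<Sum>c<L. (1\<^sub>m L - G) $$ (r, c) * x c) = G $$ (r, i) - G' $$ (r, i)"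
proof -
  let ?S = "selection_matrix L cs"
  define A A' where "A = 1\<^sub>m L - G" and "A' = 1\<^sub>m L - G'"
  have S: "?S \<in> carrier_mat (length cs) L" by (simp add: selection_matrix_def)
  have A: "A \<in> carrier_mat L L" "A' \<in> carrier_mat L L" using G by (auto simp: A_def A'_def)
  have T_mat: "T \<in> carrier_mat L L" "T' \<in> carrier_mat L L"
    and inv: "A * T = 1\<^sub>m L" "T' * A' = 1\<^sub>m L"
    using T A G by (auto simp: is_inverse_of_I_minus_def inverts_mat_def A_def A'_def)
  define W where "W = T * A' - 1\<^sub>m L"
  have W: "W \<in> carrier_mat L L"
    unfolding W_def using T_mat A by (intro minus_carrier_mat one_carrier_mat)
  have "?S * W = ?S * (T * A') - ?S * 1\<^sub>m L"
    unfolding W_def using S T_mat A by (intro mult_minus_distrib_mat) auto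
  also have "?S * (T * A') = ?S * T' * A'"
    unfolding eq[symmetric] using S T_mat A by (intro assoc_mult_mat[symmetric]) auto
  also have "\<dots> = ?S * (T' * A')" using S T_mat A by (intro assoc_mult_mat) auto
  also have "\<dots> = ?S" using S inv by simp
  finally have SW: "?S * W = 0\<^sub>m (length cs) L" using S by auto
  have "A * W = A * (T * A') - A * 1\<^sub>m L"
    unfolding W_def using T_mat A by (intro mult_minus_distrib_mat) auto
  also have "A * (T * A') = A * T * A'"
    using T_mat A by (intro assoc_mult_mat[symmetric]) auto
  also have "\<dots> = A'" using A inv by simp
  finally have AW: "A * W = A' - A" using A by simp
  show ?thesis
  proof (rule that[of "\<lambda>c. W $$ (c, i)"])
    fix c assume c: "c \<in> set cs"
    then obtain k where k: "k < length cs" "c = cs ! k" by (metis in_set_conv_nth)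
    have "cs ! k < L" using subsetD[OF cs c] k(2) by simp
    then have "W $$ (c, i) = (?S * W) $$ (k, i)"
      using selection_matrix_mult_index[OF W k(1) _ \<open>i < L\<close>] k by simp
    then show "W $$ (c, i) = 0" using SW k(1) \<open>i < L\<close> by simp
  next
    fix r assume r: "r < L"
    have "(\<Sum>c<L. A $$ (r, c) * W $$ (c, i)) = (A * W) $$ (r, i)"
      using A W r \<open>i < L\<close> by (simp add: scalar_prod_def atLeast0LessThan)
    also have "\<dots> = A' $$ (r, i) - A $$ (r, i)" using AW A r \<open>i < L\<close> by simp
    also have "\<dots> = G $$ (r, i) - G' $$ (r, i)"
      using G r \<open>i < L\<close> by (simp add: A_def A'_def)
    finally show "(\<Sum>c<L. (1\<^sub>m L - G) $$ (r, c) * W $$ (c, i)) = G $$ (r, i) - G' $$ (r, i)"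
      by (simp add: A_def)
  qed
qed

text \<open>Consistency puts a zero in column \<open>i\<close> of both networks at every row of
  \<open>Z\<close>, so \<open>(I - G) x\<close> vanishes on the rows of the certificate and hence in
  row \<open>j\<close>. One determinant controls the exceptional set, uniformly over all competing
  networks.\<close>

theorem blocked_imp_generically_identifiable:
  assumes dig: "digraph L E" and cs: "set cs \<subseteq> {..<L}" and e: "(i, j) \<in> E"
    and Z: "Z \<subseteq> {r. r < L \<and> (i, r) \<notin> E}"
    and bl: "blocked (row_column L E (set cs)) j Z"
  shows "generically_identifiable L E cs {(i, j)}"
  unfolding generically_identifiable_def
proof (intro allI)
  fix d ord
  have "finite E" and ij: "i < L" "j < L" using dig e by (auto simp: digraph_def intro: finite_subset)
  obtain X \<mu> where X: "X \<subseteq> Z" "matching (row_column L E (set cs)) \<mu> X"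
    "\<forall>r'\<in>insert j X. \<forall>c. row_column L E (set cs) r' c \<longrightarrow> c \<in> \<mu> ` X"
    using bl unfolding blocked_def by blast
  have XL: "r < L \<and> (i, r) \<notin> E" if "r \<in> X" for r using that X(1) Z by auto
  then have "finite X" by (meson bounded_nat_set_is_finite)
  then obtain xs where xs: "distinct xs" "set xs = X" by (metis finite_distinct_list)
  show "AE P in (\<Pi>\<^sub>M x\<in>coords E ord. lborel).
        \<forall>G' T T'. network_matrix L G' \<and> consistent_with L E G' \<and>
          is_inverse_of_I_minus L (param_matrix L E d ord P) T \<and>
          is_inverse_of_I_minus L G' T' \<and>
          selection_matrix L cs * T = selection_matrix L cs * T' \<longrightarrow>
          (\<forall>(i, j)\<in>{(i, j)}. param_matrix L E d ord P $$ (j, i) = G' $$ (j, i))"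
    using AE_det_entry_nonzero[OF dig xs(1), where C = "set cs" and \<mu> = \<mu> and d = d and ord = ord, unfolded xs(2), OF X(2)]
  proof (eventually_elim, intro allI impI)
    fix P G' T T'
    let ?G = "param_matrix L E d ord P"
    assume det: "det (mat (length xs) (length xs)
        (\<lambda>(a, b). poly (cleared_entry E d ord P (xs ! a) (\<mu> (xs ! b))) 1)) \<noteq> 0"
      and H: "network_matrix L G' \<and> consistent_with L E G' \<and>
        is_inverse_of_I_minus L ?G T \<and> is_inverse_of_I_minus L G' T' \<and>
        selection_matrix L cs * T = selection_matrix L cs * T'"
    have G: "?G \<in> carrier_mat L L" "G' \<in> carrier_mat L L"
      using H by (auto simp: param_matrix_def network_matrix_def)
    obtain x where x: "\<And>c. c \<in> set cs \<Longrightarrow> x c = 0"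
      and eq: "\<And>r. r < L \<Longrightarrow> (\<Sum>c<L. (1\<^sub>m L - ?G) $$ (r, c) * x c) = ?G $$ (r, i) - G' $$ (r, i)"
      by (rule indistinguishable_column[OF G _ _ _ cs ij(1), of T T']) (use H in auto)
    have eq': "(\<Sum>c<L. entry E d ord P r c * x c) = ?G $$ (r, i) - G' $$ (r, i)" if "r < L" for r
      unfolding eq[OF that, symmetric] using that
      by (intro sum.cong) (auto simp: entry_eq_one_minus_param_matrix)
    have "(\<Sum>c<L. entry E d ord P j c * x c) = 0"
    proof (rule blocked_row_zero[where M = "entry E d ord P"])
      show "c = r \<or> (c, r) \<in> E" if "entry E d ord P r c \<noteq> 0" for r c
        using that by (auto simp: entry_def split: if_splits)
      show "det (mat (length xs) (length xs) (\<lambda>(a, b). entry E d ord P (xs ! a) (\<mu> (xs ! b)))) \<noteq> 0"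
        using det by (rule det_cleared_nonzero_imp_det_entry_nonzero[OF \<open>finite E\<close>])
      fix r assume "r \<in> set xs"
      then have r: "r < L" "(i, r) \<notin> E" using XL xs by auto
      then have "?G $$ (r, i) = 0" "G' $$ (r, i) = 0"
        using H ij by (auto simp: param_matrix_def consistent_with_def)
      then show "(\<Sum>c<L. entry E d ord P r c * x c) = 0" using eq'[OF r(1)] by simp
    qed (use x xs X in auto)
    then show "\<forall>(i, j)\<in>{(i, j)}. ?G $$ (j, i) = G' $$ (j, i)"
      using eq'[OF ij(2)] by simp
  qed
qed

text \<open>The unit cube has measure 1. This is what turns a contradiction at almost every
  parameter vector into a contradiction.\<close>

lemma not_AE_False_lborel_PiM:
  assumes "finite I"
  shows "\<not> (AE P in (\<Pi>\<^sub>M x\<in>I. (lborel :: real measure)). False)"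
proof
  interpret product_sigma_finite "\<lambda>_. lborel :: real measure" ..
  let ?B = "\<Pi>\<^sub>E x\<in>I. {0..1::real}"
  assume "AE P in (\<Pi>\<^sub>M x\<in>I. (lborel :: real measure)). False"
  then obtain N where N: "space (\<Pi>\<^sub>M x\<in>I. (lborel :: real measure)) \<subseteq> N"
    "emeasure (\<Pi>\<^sub>M x\<in>I. (lborel :: real measure)) N = 0" "N \<in> sets (\<Pi>\<^sub>M x\<in>I. (lborel :: real measure))"
    by (rule AE_E) auto
  have "emeasure (\<Pi>\<^sub>M x\<in>I. lborel) ?B = (\<Prod>x\<in>I. emeasure lborel {0..1::real})"
    using assms by (intro emeasure_PiM) auto
  also have "\<dots> = 1" by simp
  finally have "emeasure (\<Pi>\<^sub>M x\<in>I. lborel) ?B = 1" .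
  moreover have "?B \<subseteq> N"
    using N(1) by (auto simp: space_PiM)
  then have "emeasure (\<Pi>\<^sub>M x\<in>I. lborel) ?B \<le> 0"
    using emeasure_mono[OF _ N(3)] N(2) by metis
  ultimately show False by simp
qed


section \<open>Constant networks and their rank-one perturbations\<close>

abbreviation cst :: "real \<Rightarrow> transfer" where
  "cst a \<equiv> to_fract [:a:]"

lemma comm_ring_hom_cst: "comm_ring_hom cst"
proof
  show "cst 1 = 1" by (metis one_pCons to_fract_1)
qed (auto simp flip: to_fract_add to_fract_mult)

lemma proper_cst: "proper (cst a)"
  unfolding proper_def to_fract_def by (intro exI[of _ "[:a:]"] exI[of _ 1]) auto

lemma stable_cst: "stable (cst a)"
  unfolding stable_def to_fract_def by (intro exI[of _ "[:a:]"] exI[of _ 1]) auto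

lemma is_inverse_of_I_minus_cst:
  assumes "K \<in> carrier_mat L L" "B \<in> carrier_mat L L"
    and "(1\<^sub>m L - K) * B = 1\<^sub>m L" "B * (1\<^sub>m L - K) = 1\<^sub>m L"
  shows "is_inverse_of_I_minus L (map_mat cst K) (map_mat cst B)"
proof -
  interpret comm_ring_hom cst by (rule comm_ring_hom_cst)
  have "1\<^sub>m L - map_mat cst K = map_mat cst (1\<^sub>m L - K)"
    using assms(1) by (auto simp: one_mat_def hom_distribs)
  moreover have "map_mat cst (1\<^sub>m L - K) * map_mat cst B = map_mat cst ((1\<^sub>m L - K) * B)"
    "map_mat cst B * map_mat cst (1\<^sub>m L - K) = map_mat cst (B * (1\<^sub>m L - K))"
    using assms(1,2) by (auto intro!: mat_hom_mult[symmetric])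
  ultimately show ?thesis
    using assms unfolding is_inverse_of_I_minus_def inverts_mat_def by (simp add: mat_hom_one)
qed

text \<open>Constants are proper and have no poles, so an inverse of \<open>I - K\<close> over the
  reals already gives well-posedness.\<close>

lemma network_matrix_cst:
  assumes "K \<in> carrier_mat L L" "B \<in> carrier_mat L L"
    and "(1\<^sub>m L - K) * B = 1\<^sub>m L" "B * (1\<^sub>m L - K) = 1\<^sub>m L"
    and "\<And>r. r < L \<Longrightarrow> K $$ (r, r) = 0"
  shows "network_matrix L (map_mat cst K)"
  unfolding network_matrix_def well_posed_def
  using is_inverse_of_I_minus_cst[OF assms(1-4)] assms(1,2,5)
  by (auto simp: proper_cst stable_cst intro!: exI[of _ "map_mat cst B"])

text \<open>\<open>A - A * W\<close> is \<open>A * (1 - W)\<close>, and \<open>W * W = t W\<close>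
  gives \<open>(1 - W) * (1 + s W) = 1 + (s - 1 - s t) W\<close>, whose last coefficient is 0 by the
  choice of \<open>s\<close>. For \<open>W\<close> of rank one this is the Sherman-Morrison
  formula.\<close>

lemma rank_one_perturbation_inverse:
  fixes A B W :: "'a :: field mat"
  assumes "A \<in> carrier_mat n n" "B \<in> carrier_mat n n" "W \<in> carrier_mat n n"
    and AB: "A * B = 1\<^sub>m n" "B * A = 1\<^sub>m n"
    and WW: "W * W = t \<cdot>\<^sub>m W" and t: "t \<noteq> 1"
  defines "s \<equiv> 1 / (1 - t)"
  shows "(A - A * W) * ((1\<^sub>m n + s \<cdot>\<^sub>m W) * B) = 1\<^sub>m n"
    "((1\<^sub>m n + s \<cdot>\<^sub>m W) * B) * (A - A * W) = 1\<^sub>m n"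
proof -
  let ?U = "1\<^sub>m n - W" and ?V = "1\<^sub>m n + s \<cdot>\<^sub>m W"
  have UV: "?U \<in> carrier_mat n n" "?V \<in> carrier_mat n n" using assms by auto
  have sW: "s \<cdot>\<^sub>m W \<in> carrier_mat n n" using assms(3) by simp
  have s: "s - 1 - s * t = 0" using t by (simp add: s_def field_simps)
  have "?U * ?V = ?V - W * ?V"
    using minus_mult_distrib_mat[OF one_carrier_mat assms(3) UV(2)]
    by (simp only: left_mult_one_mat[OF UV(2)])
  also have "W * ?V = W + s \<cdot>\<^sub>m (W * W)"
    using mult_add_distrib_mat[OF assms(3) one_carrier_mat sW] mult_smult_distrib[OF assms(3,3), of s]
    by (simp only: right_mult_one_mat[OF assms(3)])
  also have "?V - (W + s \<cdot>\<^sub>m (W * W)) = 1\<^sub>m n + (s - 1 - s * t) \<cdot>\<^sub>m W"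
    unfolding WW using assms(3) by (intro eq_matI) (auto simp: algebra_simps)
  also have "\<dots> = 1\<^sub>m n" unfolding s using assms(3) by (intro eq_matI) auto
  finally have 1: "?U * ?V = 1\<^sub>m n" .
  have "?V * ?U = ?V - ?V * W" 
    using mult_minus_distrib_mat[OF UV(2) one_carrier_mat assms(3)]
    by (simp only: right_mult_one_mat[OF UV(2)])
  also have "?V * W = W + s \<cdot>\<^sub>m (W * W)"
    using add_mult_distrib_mat[OF one_carrier_mat sW assms(3)] mult_smult_assoc_mat[OF assms(3,3), of s]
    by (simp only: left_mult_one_mat[OF assms(3)])
  also have "?V - (W + s \<cdot>\<^sub>m (W * W)) = 1\<^sub>m n + (s - 1 - s * t) \<cdot>\<^sub>m W"
    unfolding WW using assms(3) by (intro eq_matI) (auto simp: algebra_simps)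
  also have "\<dots> = 1\<^sub>m n" unfolding s using assms(3) by (intro eq_matI) auto
  finally have 2: "?V * ?U = 1\<^sub>m n" .
  have AU: "A - A * W = A * ?U"
    using mult_minus_distrib_mat[OF assms(1) one_carrier_mat assms(3)]
    by (simp only: right_mult_one_mat[OF assms(1)])
  have regroup: "X * Y * (Z * B) = X * (Y * Z) * B" "X * B * (A * Y) = X * (B * A) * Y"
    if "X \<in> carrier_mat n n" "Y \<in> carrier_mat n n" "Z \<in> carrier_mat n n" for X Y Z
    using that assms(1,2) by (simp_all add: assoc_mult_mat[of _ n n _ n _ n])
  show "(A - A * W) * (?V * B) = 1\<^sub>m n"
    unfolding AU regroup(1)[OF assms(1) UV] 1 right_mult_one_mat[OF assms(1)] by (rule AB)
  show "(?V * B) * (A - A * W) = 1\<^sub>m n"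
    unfolding AU regroup(2)[OF UV(2,1,1)] AB right_mult_one_mat[OF UV(2)] by (rule 2)
qed

lemma cleared_entry_static:
  "poly (cleared_entry E (\<lambda>_. 0) (\<lambda>_. 0) P r c) 1 =
    (if r = c then 1 else 0) - (if (c, r) \<in> E then P (Kappa (c, r)) else 0)"
  by (simp add: cleared_entry_def den_poly_def num_poly_def monic_poly_def)

lemma param_matrix_static:
  "param_matrix L E (\<lambda>_. 0) (\<lambda>_. 0) P =
    map_mat cst (mat L L (\<lambda>(r, c). if (c, r) \<in> E then P (Kappa (c, r)) else 0))"
  by (auto simp: param_matrix_def edge_transfer_def monic_poly_def to_fract_def Zero_fract_def[symmetric]
      intro!: eq_matI)

text \<open>With all delays and orders 0, almost every parameter vector admits an \<open>x\<close>,
  supported on the columns matched to \<open>insert j Z\<close>, such that \<open>(I - G) x\<close>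
  is 0 in every row of \<open>Z\<close> and nonzero in row \<open>j\<close>; the certificates extend
  the zeros to all rows without an edge from \<open>i\<close>. Adding \<open>(I - G) x\<close> to
  column \<open>i\<close> of \<open>G\<close> respects the graph, keeps the measured responses and
  changes the edge \<open>(i, j)\<close>.\<close>

theorem augmentable_imp_not_generically_identifiable:
  assumes dig: "digraph L E" and cs: "set cs \<subseteq> {..<L}" and e: "(i, j) \<in> E"
    and Z: "Z \<subseteq> {r. r < L \<and> (i, r) \<notin> E}"
    and match: "matching (row_column L E (set cs)) \<mu> (insert j Z)"
    and bl: "\<And>r. r < L \<Longrightarrow> (i, r) \<notin> E \<Longrightarrow> r \<notin> Z \<Longrightarrow> blocked (row_column L E (set cs)) r Z"
  shows "\<not> generically_identifiable L E cs {(i, j)}"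
proof
  let ?adj = "row_column L E (set cs)"
  let ?R = "\<lambda>P r c. poly (cleared_entry E (\<lambda>_. 0) (\<lambda>_. 0) P r c) 1"
  let ?I = "coords E (\<lambda>_. 0)"
  assume "generically_identifiable L E cs {(i, j)}"
  then have ident: "AE P in (\<Pi>\<^sub>M x\<in>?I. lborel).
        \<forall>G' T T'. network_matrix L G' \<and> consistent_with L E G' \<and>
          is_inverse_of_I_minus L (param_matrix L E (\<lambda>_. 0) (\<lambda>_. 0) P) T \<and>
          is_inverse_of_I_minus L G' T' \<and>
          selection_matrix L cs * T = selection_matrix L cs * T' \<longrightarrow>
          (\<forall>(i, j)\<in>{(i, j)}. param_matrix L E (\<lambda>_. 0) (\<lambda>_. 0) P $$ (j, i) = G' $$ (j, i))"
    unfolding generically_identifiable_def by blast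
  have ij: "i < L" "j < L" and "finite E" and noloop: "\<And>v. (v, v) \<notin> E"
    using dig e by (auto simp: digraph_def intro: finite_subset)
  have "finite ?I" using \<open>finite E\<close> by (simp add: coords_def)
  have "finite Z" using Z by (auto intro: finite_subset[of _ "{..<L}"])
  then obtain zs where zs: "distinct zs" "set zs = insert j Z" by (metis finite.insertI finite_distinct_list)
  \<comment> \<open>Matching each row with its own column, as if nothing were measured, shows that
    \<open>I - G\<close> itself is generically invertible.\<close>
  have "matching (row_column L E {}) id (set [0..<L])"
    by (auto simp: matching_def row_column_def)
  from AE_det_entry_nonzero[OF dig distinct_upt this]
  have full: "AE P in (\<Pi>\<^sub>M x\<in>?I. lborel). det (mat L L (\<lambda>(a, b). ?R P ([0..<L] ! a) ([0..<L] ! b))) \<noteq> 0"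
    by simp
  have aug: "AE P in (\<Pi>\<^sub>M x\<in>?I. lborel).
      det (mat (length zs) (length zs) (\<lambda>(a, b). ?R P (zs ! a) (\<mu> (zs ! b)))) \<noteq> 0"
    using AE_det_entry_nonzero[OF dig zs(1), unfolded zs(2), OF match] .
  \<comment> \<open>Each certificate comes with a null set of its own; there are finitely many rows,
    so one null set serves all of them.\<close>
  have blk: "AE P in (\<Pi>\<^sub>M x\<in>?I. lborel). \<forall>r\<in>{r. r < L \<and> (i, r) \<notin> E \<and> r \<notin> Z}.
      \<exists>xs \<nu>. distinct xs \<and> set xs \<subseteq> Z \<and> matching ?adj \<nu> (set xs) \<and>
        (\<forall>r'\<in>insert r (set xs). \<forall>c. ?adj r' c \<longrightarrow> c \<in> \<nu> ` set xs) \<and>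
        det (mat (length xs) (length xs) (\<lambda>(a, b). ?R P (xs ! a) (\<nu> (xs ! b)))) \<noteq> 0"
  proof (rule eventually_ball_finite)
    show "\<forall>r\<in>{r. r < L \<and> (i, r) \<notin> E \<and> r \<notin> Z}. AE P in (\<Pi>\<^sub>M x\<in>?I. lborel).
      \<exists>xs \<nu>. distinct xs \<and> set xs \<subseteq> Z \<and> matching ?adj \<nu> (set xs) \<and>
        (\<forall>r'\<in>insert r (set xs). \<forall>c. ?adj r' c \<longrightarrow> c \<in> \<nu> ` set xs) \<and>
        det (mat (length xs) (length xs) (\<lambda>(a, b). ?R P (xs ! a) (\<nu> (xs ! b)))) \<noteq> 0"
    proof
      fix r assume "r \<in> {r. r < L \<and> (i, r) \<notin> E \<and> r \<notin> Z}"
      then obtain X \<nu> where X: "X \<subseteq> Z" "matching ?adj \<nu> X"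
        "\<forall>r'\<in>insert r X. \<forall>c. ?adj r' c \<longrightarrow> c \<in> \<nu> ` X"
        using bl[of r] unfolding blocked_def by auto
      obtain xs where xs: "distinct xs" "set xs = X"
        using finite_subset[OF X(1) \<open>finite Z\<close>] by (metis finite_distinct_list)
      show "AE P in (\<Pi>\<^sub>M x\<in>?I. lborel).
        \<exists>xs \<nu>. distinct xs \<and> set xs \<subseteq> Z \<and> matching ?adj \<nu> (set xs) \<and>
        (\<forall>r'\<in>insert r (set xs). \<forall>c. ?adj r' c \<longrightarrow> c \<in> \<nu> ` set xs) \<and>
        det (mat (length xs) (length xs) (\<lambda>(a, b). ?R P (xs ! a) (\<nu> (xs ! b)))) \<noteq> 0"
        using AE_det_entry_nonzero[OF dig xs(1), unfolded xs(2), OF X(2), of "\<lambda>_. 0" "\<lambda>_. 0"]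
        by eventually_elim (use X xs in blast)
    qed
  qed simp
  have "AE P in (\<Pi>\<^sub>M x\<in>?I. (lborel :: real measure)). False"
    using ident full aug blk
  proof eventually_elim
    case (elim P)
    define K where "K = mat L L (\<lambda>(r, c). if (c, r) \<in> E then P (Kappa (c, r)) else 0)"
    define A where "A = 1\<^sub>m L - K"
    have K: "K \<in> carrier_mat L L" and A: "A \<in> carrier_mat L L"
      by (auto simp: K_def A_def)
    have A_index: "A $$ (r, c) = ?R P r c" if "r < L" "c < L" for r c
      using that by (simp add: A_def K_def cleared_entry_static)
    have "mat L L (\<lambda>(a, b). ?R P ([0..<L] ! a) ([0..<L] ! b)) = A"
      using A by (intro eq_matI) (auto simp: A_index)
    with elim(2) have "det A \<noteq> 0" by simp
    then obtain B where B: "B \<in> carrier_mat L L" and AB: "A * B = 1\<^sub>m L" "B * A = 1\<^sub>m L"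
      by (rule det_nonzero_inverse[OF A])
    have inj: "inj_on \<mu> (set zs)" using match zs(2) by (simp add: matching_def)
    \<comment> \<open>Independence of the rows \<open>insert j Z\<close> on their matched columns
      permits arbitrary right-hand sides: 0 on \<open>Z\<close> and 1 in row
      \<open>j\<close>.\<close>
    obtain x0 where x0: "\<And>r. r \<in> set zs \<Longrightarrow> (\<Sum>c\<in>\<mu> ` set zs. ?R P r c * x0 c) = (if r = j then 1 else 0)"
      "\<And>c. c \<notin> \<mu> ` set zs \<Longrightarrow> x0 c = 0"
      using det_submatrix_nonzero_imp_solvable[OF elim(3) zs(1) inj, where y = "\<lambda>r. if r = j then 1 else 0"]
      by metis
    \<comment> \<open>Scaling keeps the perturbation below invertible.\<close>
    define b :: real where "b = (if x0 i = 1 then 2 else 1)"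
    define x where "x c = b * x0 c" for c
    have "b \<noteq> 0" "x i \<noteq> 1" by (auto simp: b_def x_def)
    have cols: "c < L" "c \<notin> set cs" if "c \<in> \<mu> ` set zs" for c
      using that match zs(2) by (auto simp: matching_def row_column_def)
    have x_cs: "x c = 0" if "c \<in> set cs" for c
      using that cols x0(2)[of c] by (auto simp: x_def)
    have x_zs: "(\<Sum>c<L. ?R P r c * x c) = (if r = j then b else 0)" if "r \<in> set zs" for r
    proof -
      have "(\<Sum>c<L. ?R P r c * x c) = (\<Sum>c\<in>\<mu> ` set zs. ?R P r c * x c)"
        by (rule sum.mono_neutral_right) (use cols x0(2) in \<open>auto simp: x_def\<close>)
      also have "\<dots> = b * (\<Sum>c\<in>\<mu> ` set zs. ?R P r c * x0 c)"
        by (simp add: x_def sum_distrib_left mult_ac)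
      finally show ?thesis using x0(1)[OF that] by simp
    qed
    have x_rows: "(\<Sum>c<L. ?R P r c * x c) = 0" if r: "r < L" "(i, r) \<notin> E" for r
    proof (cases "r \<in> Z")
      case True
      then have "r \<noteq> j" using Z e by auto
      with True show ?thesis using x_zs[of r] zs(2) by simp
    next
      case False
      then obtain xs \<nu> where xs: "distinct xs" "set xs \<subseteq> Z" "matching ?adj \<nu> (set xs)"
        "\<forall>r'\<in>insert r (set xs). \<forall>c. ?adj r' c \<longrightarrow> c \<in> \<nu> ` set xs"
        "det (mat (length xs) (length xs) (\<lambda>(a, b). ?R P (xs ! a) (\<nu> (xs ! b)))) \<noteq> 0"
        using elim(4) r by blast
      show ?thesis
      proof (rule blocked_row_zero[where M = "?R P", OF _ x_cs xs(1,3,4,5)])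
        show "c = r \<or> (c, r) \<in> E" if "?R P r c \<noteq> 0" for r c
          using that by (auto simp: cleared_entry_static split: if_splits)
        fix r' assume "r' \<in> set xs"
        then have "r' \<in> Z" using xs(2) by auto
        moreover then have "r' \<noteq> j" using Z e by auto
        ultimately show "(\<Sum>c<L. ?R P r' c * x c) = 0" using x_zs[of r'] zs(2) by simp
      qed
    qed
    \<comment> \<open>\<open>W\<close> is \<open>x\<close> times the transposed \<open>i\<close>-th
      unit vector, so \<open>A * W\<close> has only column \<open>i\<close>, and
      \<open>W * W\<close> is the multiple \<open>x i\<close> of \<open>W\<close>.\<close>
    define W where "W = mat L L (\<lambda>(r, c). if c = i then x r else 0)"
    have W: "W \<in> carrier_mat L L" by (simp add: W_def)
    have WW: "W * W = x i \<cdot>\<^sub>m W"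
    proof (rule eq_matI)
      fix r c assume "r < dim_row (x i \<cdot>\<^sub>m W)" "c < dim_col (x i \<cdot>\<^sub>m W)"
      then have rc: "r < L" "c < L" using W by auto
      then have "(W * W) $$ (r, c) = (\<Sum>l = 0..<L. W $$ (r, l) * W $$ (l, c))"
        using W by (simp add: scalar_prod_def)
      also have "\<dots> = (\<Sum>l = 0..<L. if l = i then x r * W $$ (i, c) else 0)"
        using rc ij by (intro sum.cong) (auto simp: W_def)
      finally show "(W * W) $$ (r, c) = (x i \<cdot>\<^sub>m W) $$ (r, c)"
        using rc ij by (simp add: W_def)
    qed (auto simp: W_def)
    have AW: "(A * W) $$ (r, c) = (if c = i then \<Sum>l<L. ?R P r l * x l else 0)" if "r < L" "c < L" for r c
      using that A by (auto simp: W_def scalar_prod_def A_index atLeast0LessThan intro!: sum.cong)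
    define K' where "K' = K + A * W"
    define B' where "B' = (1\<^sub>m L + (1 / (1 - x i)) \<cdot>\<^sub>m W) * B"
    have K': "K' \<in> carrier_mat L L" and B': "B' \<in> carrier_mat L L"
      using K A B W by (auto simp: K'_def B'_def)
    have "1\<^sub>m L - K' = A - A * W"
      using K A W by (intro eq_matI) (auto simp: A_def K'_def)
    then have inv': "(1\<^sub>m L - K') * B' = 1\<^sub>m L" "B' * (1\<^sub>m L - K') = 1\<^sub>m L"
      using rank_one_perturbation_inverse[OF A B W AB WW \<open>x i \<noteq> 1\<close>] by (simp_all add: B'_def)
    have K'_index: "K' $$ (r, c) = K $$ (r, c) + (if c = i then \<Sum>l<L. ?R P r l * x l else 0)"
      if "r < L" "c < L" for r c
      using that K A W AW by (simp add: K'_def)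
    have "network_matrix L (map_mat cst K')"
    proof (rule network_matrix_cst[OF K' B' inv'])
      fix r assume "r < L"
      \<comment> \<open>There is no loop at \<open>i\<close>, so \<open>i\<close> is one of the rows
        covered by \<open>x_rows\<close> and the diagonal remains zero.\<close>
      then show "K' $$ (r, r) = 0" using x_rows[of i] noloop ij by (simp add: K'_index K_def)
    qed
    moreover have "consistent_with L E (map_mat cst K')"
      unfolding consistent_with_def
    proof (intro allI impI)
      fix r c assume rc: "r < L" "c < L" and "map_mat cst K' $$ (r, c) \<noteq> 0"
      then have "K' $$ (r, c) \<noteq> 0" using K' by auto
      then show "(c, r) \<in> E"
        using rc x_rows[of r] by (auto simp: K'_index K_def split: if_splits)
    qed
    moreover have "is_inverse_of_I_minus L (param_matrix L E (\<lambda>_. 0) (\<lambda>_. 0) P) (map_mat cst B)"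
      unfolding param_matrix_static using is_inverse_of_I_minus_cst[OF K B] AB by (simp add: A_def K_def)
    moreover have "is_inverse_of_I_minus L (map_mat cst K') (map_mat cst B')"
      using is_inverse_of_I_minus_cst[OF K' B' inv'] .
    \<comment> \<open>\<open>B' - B\<close> is a multiple of \<open>W * B\<close>, and the rows of
      \<open>W\<close> at measured nodes vanish because \<open>x\<close> does.\<close>
    moreover have "selection_matrix L cs * map_mat cst B = selection_matrix L cs * map_mat cst B'"
    proof (rule eq_matI)
      fix k c
      assume "k < dim_row (selection_matrix L cs * map_mat cst B')"
        "c < dim_col (selection_matrix L cs * map_mat cst B')"
      then have kc: "k < length cs" "c < L" using B' by (auto simp: selection_matrix_def)
      then have k: "cs ! k \<in> set cs" by simp
      have "cs ! k < L" using subsetD[OF cs k] by simp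
      note k = k this
      have "B' = B + (1 / (1 - x i)) \<cdot>\<^sub>m W * B"
        unfolding B'_def using B W by (simp add: add_mult_distrib_mat[of _ L L])
      moreover have "((1 / (1 - x i)) \<cdot>\<^sub>m W * B) $$ (cs ! k, c) = 0"
        using k kc B x_cs[OF k(1)] by (auto simp: W_def scalar_prod_def intro!: sum.neutral)
      ultimately have "B' $$ (cs ! k, c) = B $$ (cs ! k, c)"
        using k kc B W by simp
      then show "(selection_matrix L cs * map_mat cst B) $$ (k, c) =
          (selection_matrix L cs * map_mat cst B') $$ (k, c)"
        using B B' k kc by (simp add: selection_matrix_mult_index)
    qed (use B B' in auto)
    ultimately have "param_matrix L E (\<lambda>_. 0) (\<lambda>_. 0) P $$ (j, i) = map_mat cst K' $$ (j, i)"
      using elim(1) by blast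
    then have "K $$ (j, i) = K' $$ (j, i)"
      unfolding param_matrix_static using ij K K' by (simp add: K_def)
    moreover have "K' $$ (j, i) = K $$ (j, i) + b"
      using ij x_zs[of j] zs(2) by (simp add: K'_index)
    ultimately show False using \<open>b \<noteq> 0\<close> by simp
  qed
  then show False using not_AE_False_lborel_PiM[OF \<open>finite ?I\<close>] by blast
qed

text \<open>A finite union of null sets is null, so a group of edges can be decided edge by
  edge.\<close>

lemma generically_identifiable_iff_singletons:
  assumes "finite S"
  shows "generically_identifiable L E cs S \<longleftrightarrow> (\<forall>e\<in>S. generically_identifiable L E cs {e})"
proof
  assume H: "generically_identifiable L E cs S"
  show "\<forall>e\<in>S. generically_identifiable L E cs {e}"
    unfolding generically_identifiable_def
  proof (intro ballI allI)
    fix e d ord assume "e \<in> S"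
    show "AE P in (\<Pi>\<^sub>M x\<in>coords E ord. lborel). \<forall>G' T T'.
          network_matrix L G' \<and> consistent_with L E G' \<and>
          is_inverse_of_I_minus L (param_matrix L E d ord P) T \<and>
          is_inverse_of_I_minus L G' T' \<and>
          selection_matrix L cs * T = selection_matrix L cs * T' \<longrightarrow>
          (\<forall>(i, j)\<in>{e}. param_matrix L E d ord P $$ (j, i) = G' $$ (j, i))"
      using H[unfolded generically_identifiable_def, rule_format, of d ord]
      by eventually_elim (use \<open>e \<in> S\<close> in blast)
  qed
next
  assume H: "\<forall>e\<in>S. generically_identifiable L E cs {e}"
  show "generically_identifiable L E cs S"
    unfolding generically_identifiable_def
  proof (intro allI)
    fix d ord
    have "AE P in (\<Pi>\<^sub>M x\<in>coords E ord. lborel). \<forall>e\<in>S. \<forall>G' T T'.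
          network_matrix L G' \<and> consistent_with L E G' \<and>
          is_inverse_of_I_minus L (param_matrix L E d ord P) T \<and>
          is_inverse_of_I_minus L G' T' \<and>
          selection_matrix L cs * T = selection_matrix L cs * T' \<longrightarrow>
          (\<forall>(i, j)\<in>{e}. param_matrix L E d ord P $$ (j, i) = G' $$ (j, i))"
      using H unfolding generically_identifiable_def
      by (intro eventually_ball_finite[OF assms]) blast
    then show "AE P in (\<Pi>\<^sub>M x\<in>coords E ord. lborel). \<forall>G' T T'.
          network_matrix L G' \<and> consistent_with L E G' \<and>
          is_inverse_of_I_minus L (param_matrix L E d ord P) T \<and>
          is_inverse_of_I_minus L G' T' \<and>
          selection_matrix L cs * T = selection_matrix L cs * T' \<longrightarrow>
          (\<forall>(i, j)\<in>S. param_matrix L E d ord P $$ (j, i) = G' $$ (j, i))"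
      by eventually_elim blast
  qed
qed

section \<open>Program logic\<close>

text \<open>Total correctness with cost: the postcondition sees the final state and the number of
  operations. The rules for loop-free programs are equivalences, so rewriting with them computes
  weakest preconditions.\<close>

definition runs :: "com \<Rightarrow> state \<Rightarrow> (state \<Rightarrow> nat \<Rightarrow> bool) \<Rightarrow> bool" where
  "runs c s Q \<longleftrightarrow> (\<exists>t s'. exec c s t s' \<and> Q s' t)"

inductive_cases exec_SkipE: "exec Skip s t s'"
  and exec_SetRegE: "exec (SetReg x e) s t s'"
  and exec_SetElemE: "exec (SetElem a e f) s t s'"
  and exec_SeqE: "exec (Seq c c') s t s'"
  and exec_CondE: "exec (Cond b c c') s t s'"

lemma runsI: "exec c s t s' \<Longrightarrow> Q s' t \<Longrightarrow> runs c s Q"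
  unfolding runs_def by blast

lemma runs_Skip [simp]: "runs Skip s Q \<longleftrightarrow> Q s 1"
proof
  show "runs Skip s Q \<Longrightarrow> Q s 1" unfolding runs_def by (elim exE conjE exec_SkipE) simp
qed (rule runsI[OF exec_Skip])

lemma runs_SetReg [simp]:
  "runs (SetReg x e) s Q \<longleftrightarrow> Q (set_reg x (eval_exp e s) s) (1 + exp_cost e)"
proof
  show "runs (SetReg x e) s Q \<Longrightarrow> Q (set_reg x (eval_exp e s) s) (1 + exp_cost e)"
    unfolding runs_def by (elim exE conjE exec_SetRegE) simp
qed (rule runsI[OF exec_SetReg])

lemma runs_SetElem [simp]:
  "runs (SetElem a e f) s Q \<longleftrightarrow>
     Q (set_elem a (eval_exp e s) (eval_exp f s) s) (1 + exp_cost e + exp_cost f)"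
proof
  show "runs (SetElem a e f) s Q \<Longrightarrow>
     Q (set_elem a (eval_exp e s) (eval_exp f s) s) (1 + exp_cost e + exp_cost f)"
    unfolding runs_def by (elim exE conjE exec_SetElemE) simp
qed (rule runsI[OF exec_SetElem])

lemma runs_Seq [simp]:
  "runs (Seq c c') s Q \<longleftrightarrow> runs c s (\<lambda>s' t. runs c' s' (\<lambda>s'' t'. Q s'' (t + t')))"
proof
  assume "runs (Seq c c') s Q"
  then obtain t s'' where "exec (Seq c c') s t s''" "Q s'' t" unfolding runs_def by blast
  then show "runs c s (\<lambda>s' t. runs c' s' (\<lambda>s'' t'. Q s'' (t + t')))"
    unfolding runs_def by (blast elim: exec_SeqE)
qed (unfold runs_def, blast intro: exec_Seq)

lemma runs_Cond [simp]:
  "runs (Cond b c c') s Q \<longleftrightarrow>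
     runs (if eval_exp b s \<noteq> 0 then c else c') s (\<lambda>s' t. Q s' (1 + exp_cost b + t))"
proof
  assume "runs (Cond b c c') s Q"
  then obtain t s' where "exec (Cond b c c') s t s'" "Q s' t" unfolding runs_def by blast
  then show "runs (if eval_exp b s \<noteq> 0 then c else c') s (\<lambda>s' t. Q s' (1 + exp_cost b + t))"
    unfolding runs_def by (auto elim!: exec_CondE)
next
  assume "runs (if eval_exp b s \<noteq> 0 then c else c') s (\<lambda>s' t. Q s' (1 + exp_cost b + t))"
  then show "runs (Cond b c c') s Q"
    by (cases "eval_exp b s = 0")
      (auto simp: runs_def[of c] runs_def[of c'] intro: runsI[OF exec_CondTrue] runsI[OF exec_CondFalse])
qed

lemma runs_conseq:
  "runs c s Q \<Longrightarrow> (\<And>s' t. Q s' t \<Longrightarrow> Q' s' t) \<Longrightarrow> runs c s Q'"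
  unfolding runs_def by blast

text \<open>The index \<open>m\<close> of the invariant is a bound on the remaining cost.\<close>

lemma runs_While:
  assumes I: "I m s"
    and step: "\<And>m s. I m s \<Longrightarrow> eval_exp b s \<noteq> 0 \<Longrightarrow>
      runs c s (\<lambda>s' t. \<exists>m'. I m' s' \<and> m' + 1 + exp_cost b + t \<le> m)"
    and exit: "\<And>m' s' t. I m' s' \<Longrightarrow> eval_exp b s' = 0 \<Longrightarrow> t + m' \<le> m + 1 + exp_cost b \<Longrightarrow> Q s' t"
  shows "runs (While b c) s Q"
proof -
  have "\<exists>t s' m'. exec (While b c) s t s' \<and> I m' s' \<and> eval_exp b s' = 0 \<and>
      t + m' \<le> m + 1 + exp_cost b"
    using I
  \<comment> \<open>Every test costs at least 1, so the bound strictly decreases from round to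
    round: one induction gives termination and cost. The extra \<open>1 + exp_cost b\<close> in the
    claim pays for the final failing test.\<close>
  proof (induction m arbitrary: s rule: less_induct)
    case (less m)
    show ?case
    proof (cases "eval_exp b s = 0")
      case True
      then have "exec (While b c) s (1 + exp_cost b) s" by (rule exec_WhileFalse)
      moreover have "1 + exp_cost b + m \<le> m + 1 + exp_cost b" by simp
      ultimately show ?thesis using True less.prems by blast
    next
      case False
      then obtain t1 s1 m1 where 1: "exec c s t1 s1" "I m1 s1" "m1 + 1 + exp_cost b + t1 \<le> m"
        using step[OF less.prems] unfolding runs_def by blast
      then have "m1 < m" by simp
      from less.IH[OF this 1(2)] obtain t s' m' where
        2: "exec (While b c) s1 t s'" "I m' s'" "eval_exp b s' = 0" "t + m' \<le> m1 + 1 + exp_cost b"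
        by blast
      have "exec (While b c) s (1 + exp_cost b + t1 + t) s'"
        using False 1(1) 2(1) by (rule exec_WhileTrue)
      moreover have "1 + exp_cost b + t1 + t + m' \<le> m + 1 + exp_cost b"
        using 1(3) 2(4) by simp
      ultimately show ?thesis using 2(2,3) by blast
    qed
  qed
  then show ?thesis unfolding runs_def using exit by blast
qed

section \<open>A syntactic frame rule and counting loops\<close>

primrec written_regs :: "com \<Rightarrow> string set" where
  "written_regs Skip = {}"
| "written_regs (SetReg x e) = {x}"
| "written_regs (SetElem a e f) = {}"
| "written_regs (Seq c c') = written_regs c \<union> written_regs c'"
| "written_regs (Cond b c c') = written_regs c \<union> written_regs c'"
| "written_regs (While b c) = written_regs c"

primrec written_arrs :: "com \<Rightarrow> string set" where
  "written_arrs Skip = {}"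
| "written_arrs (SetReg x e) = {}"
| "written_arrs (SetElem a e f) = {a}"
| "written_arrs (Seq c c') = written_arrs c \<union> written_arrs c'"
| "written_arrs (Cond b c c') = written_arrs c \<union> written_arrs c'"
| "written_arrs (While b c) = written_arrs c"

lemma reg_set_reg [simp]: "reg (set_reg x v s) y = (if y = x then v else reg s y)"
  and arr_set_reg [simp]: "arr (set_reg x v s) = arr s"
  and reg_set_elem [simp]: "reg (set_elem a k v s) = reg s"
  and arr_set_elem [simp]: "arr (set_elem a k v s) b = (if b = a then (arr s a)(k := v) else arr s b)"
  by (simp_all add: set_reg_def set_elem_def)

lemma exec_frame:
  "exec c s t s' \<Longrightarrow> (\<forall>x. x \<notin> written_regs c \<longrightarrow> reg s' x = reg s x) \<and>
     (\<forall>a. a \<notin> written_arrs c \<longrightarrow> arr s' a = arr s a)"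
  by (induction rule: exec.induct) auto

lemma runs_frame:
  assumes "runs c s Q"
    and "\<And>s' t. Q s' t \<Longrightarrow> (\<And>x. x \<notin> written_regs c \<Longrightarrow> reg s' x = reg s x) \<Longrightarrow>
      (\<And>a. a \<notin> written_arrs c \<Longrightarrow> arr s' a = arr s a) \<Longrightarrow> Q' s' t"
  shows "runs c s Q'"
  using assms exec_frame unfolding runs_def by blast

definition for_loop :: "string \<Rightarrow> string \<Rightarrow> com \<Rightarrow> com" where
  "for_loop x y c = Seq (SetReg x (Const 0))
     (While (Less (Reg x) (Reg y)) (Seq c (SetReg x (Add (Reg x) (Const 1)))))"

lemma written_for_loop [simp]:
  "written_regs (for_loop x y c) = insert x (written_regs c)"
  "written_arrs (for_loop x y c) = written_arrs c"
  by (auto simp: for_loop_def)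

text \<open>Each round adds 4 for the test and 4 for the increment to the cost \<open>k\<close> of
  the body; the first assignment costs 2 and the failing test 4. The counter is incremented after
  the body, hence the \<open>set_reg\<close> in the conclusion of \<open>step\<close>.\<close>

lemma runs_for_loop:
  assumes "x \<noteq> y" "x \<notin> written_regs c" "y \<notin> written_regs c"
    and I: "I 0 (set_reg x 0 s)"
    and step: "\<And>v s'. I v s' \<Longrightarrow> v < reg s y \<Longrightarrow> reg s' x = v \<Longrightarrow> reg s' y = reg s y \<Longrightarrow>
      runs c s' (\<lambda>s'' t. I (Suc v) (set_reg x (Suc v) s'') \<and> t \<le> k)"
    and exit: "\<And>s' t. I (reg s y) s' \<Longrightarrow> t \<le> (k + 8) * reg s y + 6 \<Longrightarrow> Q s' t"
  shows "runs (for_loop x y c) s Q"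
proof -
  define N where "N = reg s y"
  let ?J = "\<lambda>m s'. reg s' y = N \<and> reg s' x \<le> N \<and> I (reg s' x) s' \<and> m = (k + 8) * (N - reg s' x)"
  have "runs (While (Less (Reg x) (Reg y)) (Seq c (SetReg x (Add (Reg x) (Const 1))))) (set_reg x 0 s)
      (\<lambda>s' t. Q s' (2 + t))"
  proof (rule runs_While[where I = ?J and m = "(k + 8) * N"])
    show "?J ((k + 8) * N) (set_reg x 0 s)" using assms by (auto simp: N_def)
  next
    fix m s' assume J: "?J m s'" and "eval_exp (Less (Reg x) (Reg y)) s' \<noteq> 0"
    then have less: "reg s' x < N" by (simp split: if_splits)
    have "runs c s' (\<lambda>s'' t. I (Suc (reg s' x)) (set_reg x (Suc (reg s' x)) s'') \<and> t \<le> k)"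
      using step[of "reg s' x" s'] J less by (simp add: N_def)
    then have "runs c s' (\<lambda>s'' t. I (Suc (reg s' x)) (set_reg x (Suc (reg s' x)) s'') \<and> t \<le> k \<and>
        reg s'' x = reg s' x \<and> reg s'' y = N)"
      by (rule runs_frame) (use assms(2,3) J in auto)
    then show "runs (Seq c (SetReg x (Add (Reg x) (Const 1)))) s'
        (\<lambda>s'' t. \<exists>m'. ?J m' s'' \<and> m' + 1 + exp_cost (Less (Reg x) (Reg y)) + t \<le> m)"
      unfolding runs_Seq runs_SetReg
    proof (rule runs_conseq)
      fix s'' t
      assume H: "I (Suc (reg s' x)) (set_reg x (Suc (reg s' x)) s'') \<and> t \<le> k \<and>
        reg s'' x = reg s' x \<and> reg s'' y = N"
      have "N - reg s' x = Suc (N - Suc (reg s' x))" using less by simp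
      then have "m = (k + 8) * (N - Suc (reg s' x)) + (k + 8)" using J by (simp add: algebra_simps)
      then show "\<exists>m'. ?J m' (set_reg x (eval_exp (Add (Reg x) (Const 1)) s'') s'') \<and>
          m' + 1 + exp_cost (Less (Reg x) (Reg y)) + (t + (1 + exp_cost (Add (Reg x) (Const 1)))) \<le> m"
        using H less \<open>x \<noteq> y\<close> by simp
    qed
  next
    fix m' s' t assume J: "?J m' s'" and "eval_exp (Less (Reg x) (Reg y)) s' = 0"
      and t: "t + m' \<le> (k + 8) * N + 1 + exp_cost (Less (Reg x) (Reg y))"
    then have "reg s' x = N" by (simp split: if_splits)
    with J t show "Q s' (2 + t)" by (intro exit) (auto simp: N_def)
  qed
  then show ?thesis by (simp add: for_loop_def)
qed

section \<open>Alternating search and augmentation\<close>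

text \<open>
  The arrays \<open>rm\<close> and \<open>cm\<close> store the partner of a row and of a column, increased by one, and \<open>0\<close> for
  an unmatched row or column.
\<close>

definition matching_state ::
  "(nat \<Rightarrow> nat \<Rightarrow> bool) \<Rightarrow> nat \<Rightarrow> (nat \<Rightarrow> nat) \<Rightarrow> (nat \<Rightarrow> nat) \<Rightarrow> nat set \<Rightarrow> bool" where
  "matching_state adj L rm cm Z \<longleftrightarrow>
     Z \<subseteq> {..<L} \<and> (\<forall>r<L. rm r \<noteq> 0 \<longleftrightarrow> r \<in> Z) \<and>
     (\<forall>r\<in>Z. adj r (rm r - 1) \<and> cm (rm r - 1) = Suc r) \<and>
     (\<forall>c<L. cm c \<noteq> 0 \<longrightarrow> cm c - 1 \<in> Z \<and> rm (cm c - 1) = Suc c)"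

text \<open>
  The matching during the augmentation, where \<open>a = c + 1\<close> for the column \<open>c\<close> that has just become
  free; the entry \<open>cm c\<close> may be stale.
\<close>

definition matching_except ::
  "(nat \<Rightarrow> nat \<Rightarrow> bool) \<Rightarrow> nat \<Rightarrow> (nat \<Rightarrow> nat) \<Rightarrow> (nat \<Rightarrow> nat) \<Rightarrow> nat set \<Rightarrow> nat \<Rightarrow> bool" where
  "matching_except adj L rm cm Z a \<longleftrightarrow>
     Z \<subseteq> {..<L} \<and> (\<forall>r<L. rm r \<noteq> 0 \<longleftrightarrow> r \<in> Z) \<and>
     (\<forall>r\<in>Z. rm r \<noteq> a \<and> adj r (rm r - 1) \<and> cm (rm r - 1) = Suc r) \<and>
     (\<forall>c<L. Suc c \<noteq> a \<longrightarrow> cm c \<noteq> 0 \<longrightarrow> cm c - 1 \<in> Z \<and> rm (cm c - 1) = Suc c)"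

text \<open>The rows \<open>que 0, \<dots>, que n\<close> have been reached in this order from \<open>que 0\<close>.\<close>

definition alternating_forest ::
  "(nat \<Rightarrow> nat \<Rightarrow> bool) \<Rightarrow> (nat \<Rightarrow> nat) \<Rightarrow> (nat \<Rightarrow> nat) \<Rightarrow> (nat \<Rightarrow> nat) \<Rightarrow> nat set \<Rightarrow> nat \<Rightarrow> nat \<Rightarrow> bool"
where
  "alternating_forest adj rm par que Z r n \<longleftrightarrow>
     que 0 = r \<and> inj_on que {..n} \<and>
     (\<forall>m. 0 < m \<and> m \<le> n \<longrightarrow> que m \<in> Z \<and>
       (\<exists>m'<m. par (rm (que m) - 1) = que m' \<and> adj (que m') (rm (que m) - 1)))"

lemma matching_stateI_matching:
  assumes "matching_state adj L rm cm Z" "X \<subseteq> Z"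
  shows "matching adj (\<lambda>r. rm r - 1) X"
  unfolding matching_def
proof
  show "inj_on (\<lambda>r. rm r - 1) X"
  proof (rule inj_onI)
    fix r r' assume "r \<in> X" "r' \<in> X" "rm r - 1 = rm r' - 1"
    then have "Suc r = Suc r'"
      using assms unfolding matching_state_def by (metis subsetD)
    then show "r = r'" by simp
  qed
  show "\<forall>r\<in>X. adj r (rm r - 1)" using assms unfolding matching_state_def by blast
qed

lemma augment_last:
  assumes M: "matching_except adj L rm cm Z a" and "r < L" "r \<notin> Z" "0 < a" "a - 1 < L" "adj r (a - 1)"
  shows "matching_state adj L (rm(r := a)) (cm(a - 1 := Suc r)) (insert r Z)"
proof -
  have "rm r' - 1 \<noteq> a - 1" if "r' \<in> Z" for r'
    using M that \<open>0 < a\<close> unfolding matching_except_def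
    by (metis Suc_diff_1 bot_nat_0.not_eq_extremum lessThan_iff subsetD)
  moreover have "r' \<noteq> r" if "r' \<in> Z" for r' using that assms(3) by auto
  ultimately show ?thesis
    using assms unfolding matching_except_def matching_state_def by auto
qed

text \<open>Row \<open>u\<close> takes the free column and releases its former one, which is the
  free column of the new state. The \<open>cm\<close> entry of the released column still names
  \<open>u\<close>; this is the stale entry that the invariant tolerates.\<close>

lemma augment_step:
  assumes M: "matching_except adj L rm cm Z a" and "u \<in> Z" "0 < a" "a - 1 < L" "adj u (a - 1)"
  shows "matching_except adj L (rm(u := a)) (cm(a - 1 := Suc u)) Z (rm u)"
proof -
  have Z: "Z \<subseteq> {..<L}" "\<And>r. r \<in> Z \<Longrightarrow> rm r \<noteq> 0" "\<And>r. r \<in> Z \<Longrightarrow> rm r \<noteq> a"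
    "\<And>r. r \<in> Z \<Longrightarrow> adj r (rm r - 1)" "\<And>r. r \<in> Z \<Longrightarrow> cm (rm r - 1) = Suc r"
    "\<And>r. r < L \<Longrightarrow> r \<notin> Z \<Longrightarrow> rm r = 0"
    "\<And>c. c < L \<Longrightarrow> Suc c \<noteq> a \<Longrightarrow> cm c \<noteq> 0 \<Longrightarrow> cm c - 1 \<in> Z \<and> rm (cm c - 1) = Suc c"
    using M unfolding matching_except_def by auto
  have neq: "rm r - 1 \<noteq> a - 1" if "r \<in> Z" for r
    using Z(2,3)[OF that] \<open>0 < a\<close> by auto
  have inj: "rm r \<noteq> rm u" if "r \<in> Z" "r \<noteq> u" for r
    using Z(5)[OF that(1)] Z(5)[OF \<open>u \<in> Z\<close>] that(2) by auto
  show ?thesis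
    unfolding matching_except_def
  proof (intro conjI ballI allI impI)
    show "Z \<subseteq> {..<L}" by fact
    show "((rm(u := a)) r \<noteq> 0) = (r \<in> Z)" if "r < L" for r
      using that Z(2,6) \<open>u \<in> Z\<close> \<open>0 < a\<close> by (cases "r \<in> Z") auto
    fix r assume r: "r \<in> Z"
    show "(rm(u := a)) r \<noteq> rm u" using inj[OF r] Z(3)[OF \<open>u \<in> Z\<close>] by auto
    show "adj r ((rm(u := a)) r - 1)" using Z(4)[OF r] assms(5) by auto
    show "(cm(a - 1 := Suc u)) ((rm(u := a)) r - 1) = Suc r" using Z(5)[OF r] neq[OF r] by auto
  next
    fix c assume c: "c < L" "Suc c \<noteq> rm u" "(cm(a - 1 := Suc u)) c \<noteq> 0"
    have "(cm(a - 1 := Suc u)) c - 1 \<in> Z \<and> (rm(u := a)) ((cm(a - 1 := Suc u)) c - 1) = Suc c"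
    proof (cases "c = a - 1")
      case True
      then show ?thesis using \<open>u \<in> Z\<close> \<open>0 < a\<close> by simp
    next
      case False
      then have "cm c - 1 \<in> Z" "rm (cm c - 1) = Suc c"
        using Z(7)[OF c(1)] c(3) by auto
      then show ?thesis using False c(2) by auto
    qed
    then show "(cm(a - 1 := Suc u)) c - 1 \<in> Z" "(rm(u := a)) ((cm(a - 1 := Suc u)) c - 1) = Suc c"
      by blast+
  qed
qed

text \<open>Queued rows are pairwise distinct, so giving \<open>que n\<close> a new partner leaves
  the tree paths of earlier rows intact.\<close>

lemma alternating_forest_step:
  assumes "alternating_forest adj rm par que Z r n" "m < n"
  shows "alternating_forest adj (rm(que n := a)) par que Z r m"
  unfolding alternating_forest_def
proof (intro conjI allI impI)
  have inj: "inj_on que {..n}" using assms unfolding alternating_forest_def by auto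
  then show "inj_on que {..m}" using assms(2) by (auto intro: inj_on_subset)
  fix k assume k: "0 < k \<and> k \<le> m"
  then have "que k \<noteq> que n" using inj_onD[OF inj, of k n] assms(2) by auto
  then show "\<exists>m'<k. par ((rm(que n := a)) (que k) - 1) = que m' \<and> adj (que m') ((rm(que n := a)) (que k) - 1)"
    and "que k \<in> Z"
    using assms k unfolding alternating_forest_def by auto
qed (use assms in \<open>auto simp: alternating_forest_def\<close>)

definition augment_com :: com where
  "augment_com = While (Reg ''a'')
     (Seq (SetReg ''c'' (Sub (Reg ''a'') (Const 1)))
     (Seq (SetReg ''u'' (Elem ''par'' (Reg ''c'')))
     (Seq (SetElem ''cm'' (Reg ''c'') (Add (Reg ''u'') (Const 1)))
     (Seq (SetReg ''a'' (Elem ''rm'' (Reg ''u'')))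
          (SetElem ''rm'' (Reg ''u'') (Add (Reg ''c'') (Const 1)))))))"

text \<open>\<open>a\<close> becomes 0 exactly when the row just treated had no partner, and the
  root is the only such row on the path. Parents have smaller queue positions, so at most
  \<open>n + 1\<close> rows are treated, each within 30 operations.\<close>

lemma runs_augment_com:
  assumes adjL: "\<And>r c. adj r c \<Longrightarrow> c < L"
    and M: "matching_except adj L (arr s ''rm'') (arr s ''cm'') Z (reg s ''a'')"
    and F: "alternating_forest adj (arr s ''rm'') (arr s ''par'') (arr s ''que'') Z r n"
    and a: "0 < reg s ''a''" "adj (arr s ''que'' n) (reg s ''a'' - 1)"
      "arr s ''par'' (reg s ''a'' - 1) = arr s ''que'' n"
    and r: "r < L" "r \<notin> Z"
  shows "runs augment_com s (\<lambda>s' t. matching_state adj L (arr s' ''rm'') (arr s' ''cm'') (insert r Z) \<and>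
    t \<le> 30 * n + 40)"
proof -
  let ?I = "\<lambda>m s'. if reg s' ''a'' = 0 then
      matching_state adj L (arr s' ''rm'') (arr s' ''cm'') (insert r Z)
    else \<exists>n. matching_except adj L (arr s' ''rm'') (arr s' ''cm'') Z (reg s' ''a'') \<and>
      alternating_forest adj (arr s' ''rm'') (arr s' ''par'') (arr s' ''que'') Z r n \<and>
      adj (arr s' ''que'' n) (reg s' ''a'' - 1) \<and>
      arr s' ''par'' (reg s' ''a'' - 1) = arr s' ''que'' n \<and> 30 * n + 30 \<le> m"
  show ?thesis
    unfolding augment_com_def
  proof (rule runs_While[where I = ?I and m = "30 * n + 30"])
    show "?I (30 * n + 30) s" using assms by auto
  next
    fix m s' assume I: "?I m s'" and "eval_exp (Reg ''a'') s' \<noteq> 0"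
    then have a: "reg s' ''a'' \<noteq> 0" by simp
    define rm cm par que where "rm = arr s' ''rm''" and "cm = arr s' ''cm''"
      and "par = arr s' ''par''" and "que = arr s' ''que''"
    define a where "a = reg s' ''a''"
    have "0 < a" using a by (simp add: a_def)
    obtain n where n: "matching_except adj L rm cm Z a" "alternating_forest adj rm par que Z r n"
      "adj (que n) (a - 1)" "par (a - 1) = que n" "30 * n + 30 \<le> m"
      using I a unfolding rm_def cm_def par_def que_def a_def by auto
    have "a - 1 < L" using n(3) adjL by blast
    let ?rm = "rm(que n := a)" and ?cm = "cm(a - 1 := Suc (que n))"
    have "\<exists>m'. (if rm (que n) = 0 then matching_state adj L ?rm ?cm (insert r Z)
      else \<exists>k. matching_except adj L ?rm ?cm Z (rm (que n)) \<and>
        alternating_forest adj ?rm par que Z r k \<and>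
        adj (que k) (rm (que n) - 1) \<and> par (rm (que n) - 1) = que k \<and> 30 * k + 30 \<le> m') \<and>
        m' + 30 \<le> m"
    proof (cases "n = 0")
      case True
      then have q: "que n = r" using n(2) unfolding alternating_forest_def by simp
      then have "rm (que n) = 0" using n(1) r unfolding matching_except_def by auto
      moreover have "matching_state adj L ?rm ?cm (insert r Z)"
        using augment_last[OF n(1) r \<open>0 < a\<close> \<open>a - 1 < L\<close>] n(3) q by simp
      ultimately show ?thesis using n(5) by (intro exI[of _ "m - 30"]) simp
    next
      case False
      then obtain m' where m': "m' < n" "par (rm (que n) - 1) = que m'" "adj (que m') (rm (que n) - 1)"
        and "que n \<in> Z"
        using n(2) unfolding alternating_forest_def by auto
      then have "rm (que n) \<noteq> 0" using n(1) unfolding matching_except_def by auto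
      moreover have "matching_except adj L ?rm ?cm Z (rm (que n))"
        using augment_step[OF n(1) \<open>que n \<in> Z\<close> \<open>0 < a\<close> \<open>a - 1 < L\<close> n(3)] .
      moreover have "alternating_forest adj ?rm par que Z r m'"
        using alternating_forest_step[OF n(2) m'(1)] .
      ultimately show ?thesis using n(5) m' by (intro exI[of _ "m - 30"]) auto
    qed
    then obtain m' where m': "if rm (que n) = 0 then matching_state adj L ?rm ?cm (insert r Z)
      else \<exists>k. matching_except adj L ?rm ?cm Z (rm (que n)) \<and>
        alternating_forest adj ?rm par que Z r k \<and>
        adj (que k) (rm (que n) - 1) \<and> par (rm (que n) - 1) = que k \<and> 30 * k + 30 \<le> m'"
      "m' + 30 \<le> m"
      by blast
    show "runs (Seq (SetReg ''c'' (Sub (Reg ''a'') (Const 1)))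
     (Seq (SetReg ''u'' (Elem ''par'' (Reg ''c'')))
     (Seq (SetElem ''cm'' (Reg ''c'') (Add (Reg ''u'') (Const 1)))
     (Seq (SetReg ''a'' (Elem ''rm'' (Reg ''u'')))
          (SetElem ''rm'' (Reg ''u'') (Add (Reg ''c'') (Const 1))))))) s'
       (\<lambda>s' t. \<exists>m'. ?I m' s' \<and> m' + 1 + exp_cost (Reg ''a'') + t \<le> m)"
      using \<open>0 < a\<close>
      by (simp add: n(4)[simplified] flip: rm_def cm_def par_def que_def a_def, intro exI[of _ m'])
        (use m' in \<open>auto split: if_splits\<close>)
  next
    fix m' s' t assume "?I m' s'" "eval_exp (Reg ''a'') s' = 0" "t + m' \<le> 30 * n + 30 + 1 + exp_cost (Reg ''a'')"
    then show "matching_state adj L (arr s' ''rm'') (arr s' ''cm'') (insert r Z) \<and> t \<le> 30 * n + 40"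
      by simp
  qed
qed

section \<open>Adjacency lists and the invariant of the search\<close>

locale row_graph =
  fixes L N :: nat and hd tl :: "nat \<Rightarrow> nat" and C :: "nat set"
  assumes hd_less: "k < N \<Longrightarrow> hd k < L" and tl_less: "k < N \<Longrightarrow> tl k < L"
begin

definition adj :: "nat \<Rightarrow> nat \<Rightarrow> bool" where
  "adj r c \<longleftrightarrow> c \<notin> C \<and> (\<exists>k<N. hd k = r \<and> tl k = c)"

text \<open>\<open>latest u K\<close> is the greatest edge below \<open>K\<close> with head \<open>u\<close>, increased by one, or \<open>0\<close>.\<close>

primrec latest :: "nat \<Rightarrow> nat \<Rightarrow> nat" where
  "latest u 0 = 0"
| "latest u (Suc K) = (if hd K = u then Suc K else latest u K)"

lemma latest_le: "latest u K \<le> K"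
  by (induction K) auto

lemma latest_Suc: "latest u K = Suc k \<Longrightarrow> hd k = u"
  by (induction K) (auto split: if_splits)

lemma latest_bound: "k < K \<Longrightarrow> hd k = u \<Longrightarrow> k < latest u K"
  by (induction K) (auto simp: less_Suc_eq)

text \<open>The edges at a head are scanned in decreasing order, and \<open>e\<close> is the next
  one increased by one. Position \<open>qh - 1\<close> holds the row popped last, of whose edges
  those from \<open>e\<close> on have been scanned; rows popped earlier are finished.\<close>

definition processed :: "(nat \<Rightarrow> nat) \<Rightarrow> nat \<Rightarrow> nat \<Rightarrow> nat set" where
  "processed que qh e = {k. k < N \<and> (\<exists>m<qh. hd k = que m \<and> (Suc m = qh \<longrightarrow> e \<le> k))}"

text \<open>Measured columns count as visited from the start, which deletes them from the graph. No
  unmatched column is ever recorded as visited here, since reaching one ends the search.\<close>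

definition search_inv where
  "search_inv rm Z r vis par que qh qt e u \<longleftrightarrow>
     alternating_forest adj rm par que Z r (qt - 1) \<and> 1 \<le> qt \<and> qh \<le> qt \<and> (\<forall>m<qt. que m < L) \<and>
     (\<forall>c<L. c \<in> C \<longrightarrow> vis c \<noteq> (0::nat)) \<and>
     (\<forall>c<L. c \<notin> C \<longrightarrow> vis c \<noteq> 0 \<longleftrightarrow> (\<exists>m. 0 < m \<and> m < qt \<and> rm (que m) = Suc c)) \<and>
     (0 < qh \<longrightarrow> u = que (qh - 1)) \<and> e \<le> N \<and> (0 < e \<longrightarrow> 0 < qh \<and> hd (e - 1) = u) \<and>
     (\<forall>k\<in>processed que qh e. vis (tl k) \<noteq> 0)"

lemma finite_processed: "finite (processed que qh e)"
  and card_processed: "card (processed que qh e) \<le> N"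
proof -
  have sub: "processed que qh e \<subseteq> {..<N}" by (auto simp: processed_def)
  then show "finite (processed que qh e)" by (rule finite_subset) simp
  show "card (processed que qh e) \<le> N" using card_mono[OF _ sub] by simp
qed

lemma queue_bound:
  assumes "search_inv rm Z r vis par que qh qt e u"
  shows "qt \<le> L"
proof -
  have "inj_on que {..qt - 1}"
    using assms by (simp add: search_inv_def alternating_forest_def)
  then have "inj_on que {..<qt}" by (rule inj_on_subset) auto
  moreover have "que ` {..<qt} \<subseteq> {..<L}" using assms by (auto simp: search_inv_def)
  ultimately have "card {..<qt} \<le> card {..<L}" by (intro card_inj_on_le) auto
  then show ?thesis by simp
qed

text \<open>A freshly popped row has all its edges pending, so the progress of this step lies in
  \<open>qh\<close> alone.\<close>

lemma processed_pop:
  "processed que (Suc qh) (latest (que qh) N) = processed que qh 0"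
proof -
  have "\<not> (hd k = que qh \<and> latest (que qh) N \<le> k)" if "k < N" for k
    using latest_bound[OF that refl] by auto
  then show ?thesis unfolding processed_def by (auto simp: less_Suc_eq)
qed

lemma processed_append:
  assumes "qh \<le> qt"
  shows "processed (que(qt := w)) qh e = processed que qh e"
proof -
  have "m < qh \<and> hd k = (que(qt := w)) m \<and> R \<longleftrightarrow> m < qh \<and> hd k = que m \<and> R" for m k R
    using assms by auto
  then show ?thesis unfolding processed_def by (simp only:)
qed

lemma search_inv_pop:
  assumes "search_inv rm Z r vis par que qh qt 0 u" "qh < qt"
  shows "search_inv rm Z r vis par que (Suc qh) qt (latest (que qh) N) (que qh)"
  using assms latest_le[of "que qh" N] latest_Suc[of "que qh" N "latest (que qh) N - 1"]
  unfolding search_inv_def processed_pop by auto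

text \<open>The cost measure relies on each scan consuming exactly one edge. The queue has no
  repetitions, so no earlier position carries the head of edge \<open>k\<close>; and no edge with
  that head lies between \<open>latest (hd k) k\<close> and \<open>k\<close>.\<close>

lemma processed_edge:
  assumes inv: "search_inv rm Z r vis par que qh qt (Suc k) u"
  shows "processed que qh (latest (hd k) k) = insert k (processed que qh (Suc k))"
    and "k \<notin> processed que qh (Suc k)"
proof -
  have k: "k < N" "0 < qh" "hd k = que (qh - 1)" "qh \<le> qt"
    using inv by (auto simp: search_inv_def)
  have inj: "inj_on que {..qt - 1}" using inv by (simp add: search_inv_def alternating_forest_def)
  have last: "Suc m = qh" if "que m = hd k" "m < qh" for m
  proof -
    have "m \<in> {..qt - 1}" "qh - 1 \<in> {..qt - 1}" using that k by auto
    then have "m = qh - 1" using inj_onD[OF inj] that k(3) by metis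
    then show ?thesis using k(2) by simp
  qed
  have char: "processed que qh e = {k'. k' < N \<and> hd k' \<in> que ` {..<qh} \<and> (hd k' = hd k \<longrightarrow> e \<le> k')}"
    (is "_ = ?R") for e
  proof
    show "processed que qh e \<subseteq> ?R" using last by (auto simp: processed_def)
    show "?R \<subseteq> processed que qh e"
    proof
      fix k' assume "k' \<in> ?R"
      then obtain m where m: "k' < N" "m < qh" "hd k' = que m" "hd k' = hd k \<longrightarrow> e \<le> k'" by auto
      moreover have "e \<le> k'" if "Suc m = qh" using m(3,4) k(3) that by auto
      ultimately show "k' \<in> processed que qh e" unfolding processed_def by blast
    qed
  qed
  show "k \<notin> processed que qh (Suc k)" by (simp add: char)
  have "latest (hd k) k \<le> k' \<longleftrightarrow> k' = k \<or> Suc k \<le> k'" if "hd k' = hd k" for k'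
    using latest_bound[of k' k "hd k"] latest_le[of "hd k" k] that by linarith
  then show "processed que qh (latest (hd k) k) = insert k (processed que qh (Suc k))"
    using k unfolding char by auto
qed

lemma search_inv_visited:
  assumes inv: "search_inv rm Z r vis par que qh qt (Suc k) u" and "vis (tl k) \<noteq> 0"
  shows "search_inv rm Z r vis par que qh qt (latest (hd k) k) u"
  using inv assms(2) latest_le[of "hd k" k] latest_Suc[of "hd k" k "latest (hd k) k - 1"]
  unfolding search_inv_def processed_edge(1)[OF inv] by auto

text \<open>The partner of the new column cannot be queued already: it is not the root, since
  \<open>r\<close> is unmatched, and at any later position it would have made its column visited.
  Appending it thus keeps the queue injective.\<close>

lemma search_inv_matched:
  assumes inv: "search_inv rm Z r vis par que qh qt (Suc k) u" and "vis (tl k) = 0"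
    and M: "matching_state adj L rm cm Z" and "r \<notin> Z" and cm: "cm (tl k) \<noteq> 0"
  shows "search_inv rm Z r (vis(tl k := 1)) (par(tl k := u)) (que(qt := cm (tl k) - 1))
    qh (Suc qt) (latest (hd k) k) u"
proof -
  define c w where "c = tl k" and "w = cm c - 1"
  have F: "alternating_forest adj rm par que Z r (qt - 1)" and qt: "1 \<le> qt" "qh \<le> qt"
    and que: "\<And>m. m < qt \<Longrightarrow> que m < L"
    and vis: "\<And>c. c < L \<Longrightarrow> c \<notin> C \<Longrightarrow> vis c \<noteq> 0 \<longleftrightarrow> (\<exists>m. 0 < m \<and> m < qt \<and> rm (que m) = Suc c)"
    and visC: "\<And>c. c < L \<Longrightarrow> c \<in> C \<Longrightarrow> vis c \<noteq> 0"
    and k: "k < N" "0 < qh" "hd k = u" "u = que (qh - 1)"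
    using inv by (auto simp: search_inv_def)
  have c: "c < L" "c \<notin> C"
    using tl_less[OF k(1)] visC[OF tl_less[OF k(1)]] assms(2) by (auto simp: c_def)
  have w: "w \<in> Z" "rm w = Suc c" "w < L"
    using M c cm by (auto simp: matching_state_def c_def w_def)
  have "adj u c" using c k by (auto simp: adj_def c_def)
  have new: "que m \<noteq> w" if "m < qt" for m
  proof (cases "m = 0")
    case True
    then show ?thesis using F w(1) \<open>r \<notin> Z\<close> by (auto simp: alternating_forest_def)
  next
    case False
    then show ?thesis using vis[OF c] w(2) assms(2) that by (auto simp: c_def)
  qed
  have par: "rm (que m) - 1 \<noteq> c" if "0 < m" "m < qt" for m
  proof
    assume "rm (que m) - 1 = c"
    moreover have "que m \<in> Z" using F that by (auto simp: alternating_forest_def)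
    then have "rm (que m) \<noteq> 0" using M by (auto simp: matching_state_def)
    ultimately have "rm (que m) = Suc c" by simp
    then show False using vis[OF c] that assms(2) by (auto simp: c_def)
  qed
  have F': "alternating_forest adj rm (par(c := u)) (que(qt := w)) Z r qt"
    unfolding alternating_forest_def
  proof (intro conjI allI impI)
    show "(que(qt := w)) 0 = r" using F qt by (auto simp: alternating_forest_def)
    have inj: "inj_on que {..qt - 1}" using F by (simp add: alternating_forest_def)
    show "inj_on (que(qt := w)) {..qt}"
    proof (rule inj_onI)
      fix a b assume ab: "a \<in> {..qt}" "b \<in> {..qt}" "(que(qt := w)) a = (que(qt := w)) b"
      have "a = b" if "a < qt" "b < qt"
      proof -
        have "a \<in> {..qt - 1}" "b \<in> {..qt - 1}" using that by auto
        moreover have "que a = que b" using ab(3) that by simp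
        ultimately show ?thesis using inj_onD[OF inj] by blast
      qed
      moreover have "a \<noteq> qt \<or> b = qt"
        using ab(2,3) new[of b] by (cases "b = qt") (auto split: if_splits)
      moreover have "b \<noteq> qt \<or> a = qt"
        using ab(1,3) new[of a] by (cases "a = qt") (auto split: if_splits)
      moreover have "a < qt \<or> a = qt" "b < qt \<or> b = qt" using ab(1,2) by auto
      ultimately show "a = b" by blast
    qed
    fix m assume m: "0 < m \<and> m \<le> qt"
    show "(que(qt := w)) m \<in> Z"
      using m F w(1) by (auto simp: alternating_forest_def)
    show "\<exists>m'<m. (par(c := u)) (rm ((que(qt := w)) m) - 1) = (que(qt := w)) m' \<and>
        adj ((que(qt := w)) m') (rm ((que(qt := w)) m) - 1)"
    proof (cases "m = qt")
      case True
      then show ?thesis using w(2) k qt \<open>adj u c\<close> by (intro exI[of _ "qh - 1"]) auto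
    next
      case False
      then have "0 < m" "m \<le> qt - 1" using m qt by auto
      then obtain m' where "m' < m" "par (rm (que m) - 1) = que m'" "adj (que m') (rm (que m) - 1)"
        using F unfolding alternating_forest_def by blast
      then show ?thesis using par[of m] m False by (intro exI[of _ m']) auto
    qed
  qed
  have proc: "processed (que(qt := w)) qh e = processed que qh e" for e
    using qt(2) by (rule processed_append)
  have "vis (tl k') \<noteq> 0 \<or> tl k' = c" if "k' \<in> processed que qh (latest (hd k) k)" for k'
    using that processed_edge(1)[OF inv] inv by (auto simp: search_inv_def c_def)
  then have P: "\<forall>k'\<in>processed (que(qt := w)) qh (latest (hd k) k). (vis(c := 1)) (tl k') \<noteq> 0"
    unfolding proc by auto
  have V: "(vis(c := 1)) c' \<noteq> 0 \<longleftrightarrow> (\<exists>m. 0 < m \<and> m < Suc qt \<and> rm ((que(qt := w)) m) = Suc c')"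
    if "c' < L" "c' \<notin> C" for c'
    using vis[OF that] qt w(2) by (auto simp: less_Suc_eq)
  have "search_inv rm Z r (vis(c := 1)) (par(c := u)) (que(qt := w)) qh (Suc qt) (latest (hd k) k) u"
    unfolding search_inv_def using F' qt que w(3) visC V P k latest_le[of "hd k" k]
      latest_Suc[of "hd k" k "latest (hd k) k - 1"]
    by (auto simp: less_Suc_eq)
  then show ?thesis by (simp add: c_def w_def)
qed

text \<open>The augmenting path starts at the row being scanned, at position \<open>qh - 1\<close>,
  so the forest is cut there. Setting the parent of a free column overwrites no tree link, as no row
  is matched to that column.\<close>

lemma search_inv_unmatched:
  assumes inv: "search_inv rm Z r vis par que qh qt (Suc k) u" and "vis (tl k) = 0"
    and M: "matching_state adj L rm cm Z" and cm: "cm (tl k) = 0"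
  shows "matching_except adj L rm cm Z (Suc (tl k))"
    "alternating_forest adj rm (par(tl k := u)) que Z r (qh - 1)"
    "adj (que (qh - 1)) (tl k)" "(par(tl k := u)) (tl k) = que (qh - 1)" "qh - 1 < L"
proof -
  have F: "alternating_forest adj rm par que Z r (qt - 1)" and qt: "1 \<le> qt" "qh \<le> qt"
    and visC: "\<And>c. c < L \<Longrightarrow> c \<in> C \<Longrightarrow> vis c \<noteq> 0"
    and k: "k < N" "0 < qh" "hd k = u" "u = que (qh - 1)"
    using inv by (auto simp: search_inv_def)
  show "adj (que (qh - 1)) (tl k)" using visC[OF tl_less[OF k(1)]] assms(2) k by (auto simp: adj_def)
  show "(par(tl k := u)) (tl k) = que (qh - 1)" using k by simp
  have free: "rm w - 1 \<noteq> tl k" if "w \<in> Z" for w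
    using M that cm by (auto simp: matching_state_def)
  then have "rm w \<noteq> Suc (tl k)" if "w \<in> Z" for w using that by fastforce
  then show "matching_except adj L rm cm Z (Suc (tl k))"
    using M unfolding matching_except_def matching_state_def by auto
  show "alternating_forest adj rm (par(tl k := u)) que Z r (qh - 1)"
    unfolding alternating_forest_def
  proof (intro conjI allI impI)
    have "inj_on que {..qt - 1}" using F by (simp add: alternating_forest_def)
    then show "inj_on que {..qh - 1}" by (rule inj_on_subset) (use qt in auto)
    fix m assume m: "0 < m \<and> m \<le> qh - 1"
    then have "m \<le> qt - 1" using qt by arith
    then have "que m \<in> Z \<and> (\<exists>m'<m. par (rm (que m) - 1) = que m' \<and> adj (que m') (rm (que m) - 1))"
      using F m unfolding alternating_forest_def by blast
    then show "que m \<in> Z" "\<exists>m'<m. (par(tl k := u)) (rm (que m) - 1) = que m' \<and> adj (que m') (rm (que m) - 1)"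
      using free[of "que m"] by auto
  qed (use F in \<open>auto simp: alternating_forest_def\<close>)
  show "qh - 1 < L" using queue_bound[OF inv] qt k(2) by simp
qed

text \<open>With the queue exhausted, all edges at queued rows have been scanned, so each unmeasured
  column they reach is visited and hence the partner of a queued row. The certificate is the queue
  without its root.\<close>

lemma search_inv_blocked:
  assumes inv: "search_inv rm Z r vis par que qt qt 0 u" and M: "matching_state adj L rm cm Z"
  shows "blocked adj r Z"
  unfolding blocked_def
proof (intro exI conjI)
  let ?X = "que ` {0<..<qt}"
  have F: "alternating_forest adj rm par que Z r (qt - 1)" and qt: "1 \<le> qt"
    and vis: "\<And>c. c < L \<Longrightarrow> c \<notin> C \<Longrightarrow> vis c \<noteq> 0 \<longleftrightarrow> (\<exists>m. 0 < m \<and> m < qt \<and> rm (que m) = Suc c)"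
    and pr: "\<And>k. k \<in> processed que qt 0 \<Longrightarrow> vis (tl k) \<noteq> 0"
    using inv by (auto simp: search_inv_def)
  show sub: "?X \<subseteq> Z" using F by (auto simp: alternating_forest_def)
  show "matching adj (\<lambda>r. rm r - 1) ?X" using M sub by (rule matching_stateI_matching)
  show "\<forall>r'\<in>insert r ?X. \<forall>c. adj r' c \<longrightarrow> c \<in> (\<lambda>r. rm r - 1) ` ?X"
  proof (intro ballI allI impI)
    fix r' c assume r': "r' \<in> insert r ?X" and "adj r' c"
    then obtain k where k: "k < N" "hd k = r'" "tl k = c" "c \<notin> C" by (auto simp: adj_def)
    have "que 0 = r" using F by (simp add: alternating_forest_def)
    then obtain m where "m < qt" "r' = que m" using r' qt by (cases "r' = r") auto
    then have "k \<in> processed que qt 0" using k by (auto simp: processed_def)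
    then obtain m where "0 < m" "m < qt" "rm (que m) = Suc c"
      using pr[of k] vis[of c] k tl_less[of k] by blast
    then have "que m \<in> ?X" "c = rm (que m) - 1" by auto
    then show "c \<in> (\<lambda>r. rm r - 1) ` ?X" by blast
  qed
qed

end

section \<open>The search program and its running time\<close>

definition search_step_com :: com where
  "search_step_com = Cond (Reg ''e'')
    (Seq (SetReg ''c'' (Elem ''src'' (Sub (Reg ''e'') (Const 1))))
    (Seq (SetReg ''e'' (Elem ''next'' (Sub (Reg ''e'') (Const 1))))
      (Cond (Elem ''vis'' (Reg ''c'')) Skip
        (Seq (SetElem ''vis'' (Reg ''c'') (Const 1))
        (Seq (SetElem ''par'' (Reg ''c'') (Reg ''u''))
          (Cond (Elem ''cm'' (Reg ''c''))
            (Seq (SetElem ''que'' (Reg ''qt'') (Sub (Elem ''cm'' (Reg ''c'')) (Const 1)))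
                 (SetReg ''qt'' (Add (Reg ''qt'') (Const 1))))
            (Seq (SetReg ''found'' (Add (Reg ''c'') (Const 1)))
            (Seq (SetReg ''e'' (Const 0))
                 (SetReg ''qt'' (Reg ''qh''))))))))))
    (Seq (SetReg ''u'' (Elem ''que'' (Reg ''qh'')))
    (Seq (SetReg ''qh'' (Add (Reg ''qh'') (Const 1)))
         (SetReg ''e'' (Elem ''first'' (Reg ''u'')))))"

definition search_loop_com :: com where
  "search_loop_com = While (Add (Reg ''e'') (Sub (Reg ''qt'') (Reg ''qh''))) search_step_com"

definition search_com :: com where
  "search_com =
    Seq (for_loop ''v'' ''L'' (SetElem ''vis'' (Reg ''v'') (Elem ''meas'' (Reg ''v''))))
    (Seq (SetElem ''que'' (Const 0) (Reg ''r''))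
    (Seq (SetReg ''qh'' (Const 0))
    (Seq (SetReg ''qt'' (Const 1))
    (Seq (SetReg ''e'' (Const 0))
    (Seq (SetReg ''found'' (Const 0))
    (Seq search_loop_com
    (Seq (SetReg ''a'' (Reg ''found''))
         augment_com)))))))"

lemma written_augment_com [simp]:
  "written_regs augment_com = {''c'', ''u'', ''a''}"
  "written_arrs augment_com = {''cm'', ''rm''}"
  by (auto simp: augment_com_def)

lemma written_search_com [simp]:
  "written_regs search_com = {''v'', ''qh'', ''qt'', ''e'', ''found'', ''c'', ''u'', ''a''}"
  "written_arrs search_com = {''vis'', ''que'', ''par'', ''cm'', ''rm''}"
  by (auto simp: search_com_def search_loop_com_def search_step_com_def)

context row_graph
begin

definition ready :: "state \<Rightarrow> bool" where
  "ready s \<longleftrightarrow> reg s ''L'' = L \<and> (\<forall>c<L. arr s ''meas'' c \<noteq> 0 \<longleftrightarrow> c \<in> C) \<and>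
     (\<forall>k<N. arr s ''src'' k = tl k \<and> arr s ''next'' k = latest (hd k) k) \<and>
     (\<forall>v<L. arr s ''first'' v = latest v N)"

lemma ready_cong:
  assumes "reg s' ''L'' = reg s ''L''"
    "\<And>a. a \<in> {''meas'', ''src'', ''next'', ''first''} \<Longrightarrow> arr s' a = arr s a"
  shows "ready s' = ready s"
  unfolding ready_def using assms by simp

lemma ready_set_reg [simp]: "x \<noteq> ''L'' \<Longrightarrow> ready (set_reg x v s) = ready s"
  by (intro ready_cong) auto

lemma ready_set_elem [simp]:
  "a \<notin> {''meas'', ''src'', ''next'', ''first''} \<Longrightarrow> ready (set_elem a k v s) = ready s"
  by (intro ready_cong) auto

abbreviation search_inv_state where
  "search_inv_state rm Z r s \<equiv> search_inv rm Z r (arr s ''vis'') (arr s ''par'') (arr s ''que'')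
     (reg s ''qh'') (reg s ''qt'') (reg s ''e'') (reg s ''u'')"

definition path_found where
  "path_found rm cm Z r a par que \<longleftrightarrow> (\<exists>n<L. matching_except adj L rm cm Z a \<and>
     alternating_forest adj rm par que Z r n \<and> adj (que n) (a - 1) \<and> par (a - 1) = que n)"

text \<open>The budget is 60 operations for each unscanned edge and for each pop still possible.
  When a free column is found, \<open>e = 0\<close> and \<open>qt = qh\<close> make the loop test
  fail, and what the augmentation needs takes the place of the search invariant.\<close>

definition search_loop_inv where
  "search_loop_inv rm cm Z r m s \<longleftrightarrow> ready s \<and> arr s ''rm'' = rm \<and> arr s ''cm'' = cm \<and>
     (if reg s ''found'' = 0 then search_inv_state rm Z r s \<and>
        60 * (N - card (processed (arr s ''que'') (reg s ''qh'') (reg s ''e''))) +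
        60 * (L - reg s ''qh'') \<le> m
      else reg s ''e'' = 0 \<and> reg s ''qt'' = reg s ''qh'' \<and>
        path_found rm cm Z r (reg s ''found'') (arr s ''par'') (arr s ''que''))"

lemma runs_search_step_com:
  assumes M: "matching_state adj L rm cm Z" and "r \<notin> Z"
    and I: "search_loop_inv rm cm Z r m s"
    and cond: "reg s ''e'' + (reg s ''qt'' - reg s ''qh'') \<noteq> 0"
  shows "runs search_step_com s (\<lambda>s' t. \<exists>m'. search_loop_inv rm cm Z r m' s' \<and> m' + 6 + t \<le> m)"
proof -
  define vis par que where "vis = arr s ''vis''" and "par = arr s ''par''" and "que = arr s ''que''"
  define qh qt u where "qh = reg s ''qh''" and "qt = reg s ''qt''" and "u = reg s ''u''"
  have found: "reg s ''found'' = 0"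
    using I cond unfolding search_loop_inv_def by (auto split: if_splits)
  have rm: "arr s ''rm'' = rm" and cm: "arr s ''cm'' = cm" and "ready s"
    using I unfolding search_loop_inv_def by auto
  show ?thesis
  proof (cases "reg s ''e''")
    case 0
    have inv: "search_inv rm Z r vis par que qh qt 0 u"
      and m: "60 * (N - card (processed que qh 0)) + 60 * (L - qh) \<le> m"
      using I found 0 unfolding search_loop_inv_def vis_def par_def que_def qh_def qt_def u_def by auto
    have "qh < qt" using cond 0 by (simp add: qh_def qt_def)
    have "qh < L" using queue_bound[OF inv] \<open>qh < qt\<close> by simp
    have "que qh < L" using inv \<open>qh < qt\<close> by (simp add: search_inv_def)
    then have first: "arr s ''first'' (que qh) = latest (que qh) N"
      using \<open>ready s\<close> by (simp add: ready_def)
    have "60 * (N - card (processed que (Suc qh) (latest (que qh) N))) + 60 * (L - Suc qh) + 60 \<le> m"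
      using m \<open>qh < L\<close> unfolding processed_pop by simp
    then show ?thesis
      using search_inv_pop[OF inv \<open>qh < qt\<close>] 0 rm cm \<open>ready s\<close> found first
      unfolding search_step_com_def
      by (simp add: search_loop_inv_def flip: vis_def par_def que_def qh_def qt_def u_def)
        (intro exI[of _ "m - 60"], simp)
  next
    case (Suc k)
    have inv: "search_inv rm Z r vis par que qh qt (Suc k) u"
      and m: "60 * (N - card (processed que qh (Suc k))) + 60 * (L - qh) \<le> m"
      using I found Suc unfolding search_loop_inv_def vis_def par_def que_def qh_def qt_def u_def by auto
    have "k < N" using inv by (simp add: search_inv_def)
    then have src: "arr s ''src'' k = tl k" "arr s ''next'' k = latest (hd k) k"
      using \<open>ready s\<close> by (auto simp: ready_def)
    have "card (processed que qh (latest (hd k) k)) = Suc (card (processed que qh (Suc k)))"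
      using processed_edge[OF inv] finite_processed by simp
    moreover have "card (processed que qh (latest (hd k) k)) \<le> N" by (rule card_processed)
    ultimately have m': "60 * (N - card (processed que qh (latest (hd k) k))) + 60 * (L - qh) + 60 \<le> m"
      using m by simp
    consider (visited) "vis (tl k) \<noteq> 0" | (matched) "vis (tl k) = 0" "cm (tl k) \<noteq> 0"
      | (unmatched) "vis (tl k) = 0" "cm (tl k) = 0" by blast
    then show ?thesis
    proof cases
      case visited
      then show ?thesis
        using search_inv_visited[OF inv visited] Suc rm cm \<open>ready s\<close> found src m'
        unfolding search_step_com_def
        by (simp add: search_loop_inv_def flip: vis_def par_def que_def qh_def qt_def u_def)
          (intro exI[of _ "m - 60"], simp)
    next
      case matched
      have "qh \<le> qt" using inv by (simp add: search_inv_def)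
      then have "processed (que(qt := cm (tl k) - 1)) qh e = processed que qh e" for e
        by (rule processed_append)
      then show ?thesis
        using search_inv_matched[OF inv matched(1) M \<open>r \<notin> Z\<close> matched(2)]
          Suc rm cm \<open>ready s\<close> found src m' matched
        unfolding search_step_com_def
        by (simp add: search_loop_inv_def flip: vis_def par_def que_def qh_def qt_def u_def)
          (intro exI[of _ "m - 60"], simp)
    next
      case unmatched
      have "path_found rm cm Z r (Suc (tl k)) (par(tl k := u)) que"
        unfolding path_found_def
        using search_inv_unmatched[OF inv unmatched(1) M unmatched(2)]
        by (intro exI[of _ "qh - 1"]) simp
      then show ?thesis
        using Suc rm cm \<open>ready s\<close> found src m' unmatched
        unfolding search_step_com_def
        by (simp add: search_loop_inv_def flip: vis_def par_def que_def qh_def qt_def u_def)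
          (intro exI[of _ "m - 60"], simp)
    qed
  qed
qed

lemma search_inv_initial:
  assumes "r < L" "que 0 = r" "\<And>c. c < L \<Longrightarrow> vis c \<noteq> 0 \<longleftrightarrow> c \<in> C"
  shows "search_inv rm Z r vis par que 0 1 0 u"
  using assms by (auto simp: search_inv_def alternating_forest_def processed_def)

definition search_result where
  "search_result r Z s \<longleftrightarrow> ready s \<and>
     (if reg s ''found'' = 0
      then matching_state adj L (arr s ''rm'') (arr s ''cm'') Z \<and> blocked adj r Z
      else matching_state adj L (arr s ''rm'') (arr s ''cm'') (insert r Z))"

text \<open>The cost splits into \<open>12 * L + 6\<close> for copying the measured flags,
  \<open>60 * N + 60 * L + 6\<close> for the loop and 30 per row of the augmenting path, which has
  at most \<open>L\<close> rows.\<close>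

lemma runs_search_com:
  assumes "ready s" and M: "matching_state adj L (arr s ''rm'') (arr s ''cm'') Z"
    and r: "reg s ''r'' = r" "r < L" "r \<notin> Z"
  shows "runs search_com s (\<lambda>s' t. search_result r Z s' \<and> t \<le> 120 * (L + N + 1))"
proof -
  define rm cm where "rm = arr s ''rm''" and "cm = arr s ''cm''"
  let ?R = "Seq (SetElem ''que'' (Const 0) (Reg ''r''))
    (Seq (SetReg ''qh'' (Const 0))
    (Seq (SetReg ''qt'' (Const 1))
    (Seq (SetReg ''e'' (Const 0))
    (Seq (SetReg ''found'' (Const 0))
    (Seq search_loop_com
    (Seq (SetReg ''a'' (Reg ''found''))
         augment_com))))))"
  have "runs (for_loop ''v'' ''L'' (SetElem ''vis'' (Reg ''v'') (Elem ''meas'' (Reg ''v'')))) s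
      (\<lambda>s' t. ((\<forall>c<L. arr s' ''vis'' c = arr s ''meas'' c) \<and> ready s') \<and> t \<le> 12 * L + 6)"
  proof (rule runs_for_loop[where k = 4 and
        I = "\<lambda>v s'. (\<forall>c<v. arr s' ''vis'' c = arr s ''meas'' c) \<and> ready s' \<and> arr s' ''meas'' = arr s ''meas''"])
  qed (use \<open>ready s\<close> in \<open>auto simp: less_Suc_eq ready_def\<close>)
  then have "runs (for_loop ''v'' ''L'' (SetElem ''vis'' (Reg ''v'') (Elem ''meas'' (Reg ''v'')))) s
      (\<lambda>s' t. ready s' \<and> (\<forall>c<L. arr s' ''vis'' c \<noteq> 0 \<longleftrightarrow> c \<in> C) \<and> arr s' ''rm'' = rm \<and> arr s' ''cm'' = cm \<and>
        reg s' ''r'' = r \<and> t \<le> 12 * L + 6)"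
    by (rule runs_frame) (use \<open>ready s\<close> r in \<open>auto simp: rm_def cm_def ready_def\<close>)
  then show ?thesis
    unfolding search_com_def runs_Seq[of _ ?R]
  proof (rule runs_conseq)
    fix s1 t1
    assume H: "ready s1 \<and> (\<forall>c<L. arr s1 ''vis'' c \<noteq> 0 \<longleftrightarrow> c \<in> C) \<and> arr s1 ''rm'' = rm \<and>
        arr s1 ''cm'' = cm \<and> reg s1 ''r'' = r \<and> t1 \<le> 12 * L + 6"
    define s2 where "s2 = set_reg ''found'' 0 (set_reg ''e'' 0 (set_reg ''qt'' 1 (set_reg ''qh'' 0
      (set_elem ''que'' 0 r s1))))"
    have I: "search_loop_inv rm cm Z r (60 * N + 60 * L) s2"
      using H search_inv_initial[OF \<open>r < L\<close>, of "(arr s1 ''que'')(0 := r)" "arr s1 ''vis''"]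
      by (auto simp: s2_def search_loop_inv_def intro!: add_mono mult_le_mono)
    have loop: "runs search_loop_com s2 (\<lambda>s3 t. (\<exists>m. search_loop_inv rm cm Z r m s3) \<and>
        reg s3 ''e'' + (reg s3 ''qt'' - reg s3 ''qh'') = 0 \<and> t \<le> 60 * N + 60 * L + 6)"
      unfolding search_loop_com_def
    proof (rule runs_While[where I = "search_loop_inv rm cm Z r"])
      fix m s' assume "search_loop_inv rm cm Z r m s'"
        "eval_exp (Add (Reg ''e'') (Sub (Reg ''qt'') (Reg ''qh''))) s' \<noteq> 0"
      then have "runs search_step_com s' (\<lambda>s' t. \<exists>m'. search_loop_inv rm cm Z r m' s' \<and> m' + 6 + t \<le> m)"
        by (intro runs_search_step_com) (use M \<open>r \<notin> Z\<close> in \<open>auto simp: rm_def cm_def\<close>)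
      then show "runs search_step_com s' (\<lambda>s' t. \<exists>m'. search_loop_inv rm cm Z r m' s' \<and>
          m' + 1 + exp_cost (Add (Reg ''e'') (Sub (Reg ''qt'') (Reg ''qh''))) + t \<le> m)"
        by (rule runs_conseq) auto
    qed (use I in auto)
    have "runs (Seq search_loop_com (Seq (SetReg ''a'' (Reg ''found'')) augment_com)) s2
        (\<lambda>s' t. search_result r Z s' \<and> t \<le> 60 * N + 90 * L + 50)"
      unfolding runs_Seq runs_SetReg
    proof (rule runs_conseq[OF loop])
      fix s3 t3
      assume H3: "(\<exists>m. search_loop_inv rm cm Z r m s3) \<and>
        reg s3 ''e'' + (reg s3 ''qt'' - reg s3 ''qh'') = 0 \<and> t3 \<le> 60 * N + 60 * L + 6"
      then obtain m where I3: "search_loop_inv rm cm Z r m s3" by blast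
      then have s3: "ready s3" "arr s3 ''rm'' = rm" "arr s3 ''cm'' = cm"
        by (auto simp: search_loop_inv_def)
      let ?s = "set_reg ''a'' (eval_exp (Reg ''found'') s3) s3"
      show "runs augment_com ?s (\<lambda>s' t'. search_result r Z s' \<and>
          t3 + (1 + exp_cost (Reg ''found'') + t') \<le> 60 * N + 90 * L + 50)"
      proof (cases "reg s3 ''found'' = 0")
        case True
        then have inv: "search_inv_state rm Z r s3" using I3 by (simp add: search_loop_inv_def)
        then have "reg s3 ''qh'' = reg s3 ''qt''" using H3 by (simp add: search_inv_def)
        then have "blocked adj r Z"
          using search_inv_blocked[of rm Z r _ _ _ "reg s3 ''qt''"] inv H3 M
          by (simp add: rm_def cm_def)
        \<comment> \<open>With \<open>a = 0\<close> the augmentation ends at its first test, at cost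
          2.\<close>
        moreover have "runs augment_com ?s (\<lambda>s' t. s' = ?s \<and> t = Suc (Suc 0))"
          unfolding augment_com_def using exec_WhileFalse[of "Reg ''a''" ?s] True
          by (intro runsI) auto
        ultimately show ?thesis
          by (elim runs_conseq) (use True s3 M H3 in \<open>auto simp: search_result_def rm_def cm_def\<close>)
      next
        case False
        then obtain n where n: "n < L" "matching_except adj L rm cm Z (reg s3 ''found'')"
          "alternating_forest adj rm (arr s3 ''par'') (arr s3 ''que'') Z r n"
          "adj (arr s3 ''que'' n) (reg s3 ''found'' - 1)"
          "arr s3 ''par'' (reg s3 ''found'' - 1) = arr s3 ''que'' n"
          using I3 by (auto simp: search_loop_inv_def path_found_def)
        have "runs augment_com ?s (\<lambda>s' t. matching_state adj L (arr s' ''rm'') (arr s' ''cm'') (insert r Z) \<and>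
            t \<le> 30 * n + 40)"
          by (rule runs_augment_com)
            (use n s3 False \<open>r < L\<close> \<open>r \<notin> Z\<close> in \<open>auto simp: adj_def tl_less\<close>)
        then show ?thesis
        proof (rule runs_frame)
          fix s' :: state and t
          assume A: "matching_state adj L (arr s' ''rm'') (arr s' ''cm'') (insert r Z) \<and> t \<le> 30 * n + 40"
            and frame: "\<And>x. x \<notin> written_regs augment_com \<Longrightarrow> reg s' x = reg ?s x"
            "\<And>a. a \<notin> written_arrs augment_com \<Longrightarrow> arr s' a = arr ?s a"
          have "ready s' = ready ?s"
            by (rule ready_cong) (auto simp: frame)
          moreover have "reg s' ''found'' = reg s3 ''found''"
            by (simp add: frame)
          ultimately show "search_result r Z s' \<and>
              t3 + (1 + exp_cost (Reg ''found'') + t) \<le> 60 * N + 90 * L + 50"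
            using A s3 H3 n(1) False by (simp add: search_result_def)
        qed
      qed
    qed
    then show "runs ?R s1 (\<lambda>s' t. search_result r Z s' \<and> t1 + t \<le> 120 * (L + N + 1))"
      using H by (simp add: s2_def) (elim runs_conseq, auto)
  qed
qed

end

section \<open>The decision programs\<close>

definition setup_com :: com where
  "setup_com =
    Seq (for_loop ''v'' ''p'' (SetElem ''meas'' (Elem ''measured'' (Reg ''v'')) (Const 1)))
    (Seq (for_loop ''v'' ''L''
      (Seq (SetElem ''src'' (Reg ''v'') (Reg ''v''))
           (SetElem ''first'' (Reg ''v'') (Add (Reg ''v'') (Const 1)))))
    (for_loop ''v'' ''n''
      (Seq (SetElem ''src'' (Add (Reg ''L'') (Reg ''v'')) (Elem ''tail'' (Reg ''v'')))
      (Seq (SetElem ''next'' (Add (Reg ''L'') (Reg ''v'')) (Elem ''first'' (Elem ''head'' (Reg ''v''))))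
           (SetElem ''first'' (Elem ''head'' (Reg ''v'')) (Add (Add (Reg ''L'') (Reg ''v'')) (Const 1)))))))"

text \<open>The two truncated differences add up to the distance between the tail and
  \<open>i\<close>, which is 0 exactly for edges leaving \<open>i\<close>; \<open>excl\<close> marks
  the heads of these edges. The searches then run over the remaining rows, on which both networks
  vanish in column \<open>i\<close>.\<close>

definition match_com :: com where
  "match_com =
    Seq (for_loop ''v'' ''L''
      (Seq (SetElem ''rm'' (Reg ''v'') (Const 0))
      (Seq (SetElem ''cm'' (Reg ''v'') (Const 0))
           (SetElem ''excl'' (Reg ''v'') (Const 0)))))
    (Seq (for_loop ''v'' ''n''
      (Cond (Add (Sub (Elem ''tail'' (Reg ''v'')) (Reg ''i'')) (Sub (Reg ''i'') (Elem ''tail'' (Reg ''v''))))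
        Skip (SetElem ''excl'' (Elem ''head'' (Reg ''v'')) (Const 1))))
    (for_loop ''r'' ''L'' (Cond (Elem ''excl'' (Reg ''r'')) Skip search_com)))"

definition edge_com :: com where
  "edge_com = Seq match_com (Seq (SetReg ''r'' (Reg ''j'')) search_com)"

definition edge_program :: com where
  "edge_program = Seq setup_com (Seq edge_com (SetReg ''answer'' (Less (Reg ''found'') (Const 1))))"

text \<open>The matching is rebuilt for every edge, because a successful search from
  \<open>j\<close> leaves \<open>j\<close> in it.\<close>

definition all_edges_program :: com where
  "all_edges_program = Seq setup_com (for_loop ''k'' ''n''
    (Seq (SetReg ''i'' (Elem ''tail'' (Reg ''k'')))
    (Seq (SetReg ''j'' (Elem ''head'' (Reg ''k'')))
    (Seq edge_com
         (SetElem ''answer'' (Reg ''k'') (Less (Reg ''found'') (Const 1)))))))"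

text \<open>All edges leaving \<open>i\<close> share one matching: a failed search keeps the set of
  matched rows, and a successful one settles the answer for the whole network, so the change it
  makes does no harm.\<close>

definition node_com :: com where
  "node_com = for_loop ''r'' ''L'' (Cond (Elem ''excl'' (Reg ''r''))
     (Seq search_com (Cond (Reg ''found'') (SetReg ''answer'' (Const 0)) Skip)) Skip)"

definition network_program :: com where
  "network_program = Seq setup_com (Seq (SetReg ''answer'' (Const 1))
    (for_loop ''i'' ''L'' (Seq match_com node_com)))"

lemma written_match_com [simp]:
  "written_regs match_com = {''v'', ''r'', ''qh'', ''qt'', ''e'', ''found'', ''c'', ''u'', ''a''}"
  "written_arrs match_com = {''rm'', ''cm'', ''excl'', ''vis'', ''que'', ''par''}"
  by (auto simp: match_com_def)

lemma written_edge_com [simp]: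
  "written_regs edge_com = {''v'', ''r'', ''qh'', ''qt'', ''e'', ''found'', ''c'', ''u'', ''a''}"
  "written_arrs edge_com = {''rm'', ''cm'', ''excl'', ''vis'', ''que'', ''par''}"
  by (auto simp: edge_com_def)

text \<open>
  The edges with added loops: edge \<open>k < L\<close> is the loop at \<open>k\<close>, edge \<open>L + k\<close> is \<open>es ! k\<close>. The loops
  stand for the diagonal of \<open>I - G\<close>.
\<close>

definition loop_tail :: "nat \<Rightarrow> edge list \<Rightarrow> nat \<Rightarrow> nat" where
  "loop_tail L es k = (if k < L then k else fst (es ! (k - L)))"

definition loop_head :: "nat \<Rightarrow> edge list \<Rightarrow> nat \<Rightarrow> nat" where
  "loop_head L es k = (if k < L then k else snd (es ! (k - L)))"

locale network =
  fixes L :: nat and es :: "edge list" and cs :: "nat list"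
  assumes inst: "network_instance L es cs"
begin

lemma dig: "digraph L (set es)" and cs: "set cs \<subseteq> {..<L}"
  using inst by (auto simp: network_instance_def)

lemma es_nth_less: "k < length es \<Longrightarrow> fst (es ! k) < L \<and> snd (es ! k) < L"
proof -
  assume "k < length es"
  then have "es ! k \<in> {..<L} \<times> {..<L}" using dig nth_mem unfolding digraph_def by blast
  then show ?thesis by (auto simp: mem_Times_iff)
qed

end

sublocale network \<subseteq> row_graph L "L + length es" "loop_head L es" "loop_tail L es" "set cs"
  by standard (auto simp: loop_head_def loop_tail_def es_nth_less)

context network
begin

lemma L_pos: "0 < L"
  using dig by (simp add: digraph_def)

lemma adj_eq: "adj = row_column L (set es) (set cs)"
proof (intro ext iffI)
  fix r c
  assume "adj r c"
  then obtain k where k: "c \<notin> set cs" "k < L + length es" "loop_head L es k = r" "loop_tail L es k = c"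
    by (auto simp: adj_def)
  have "c < L" using k(2,4) tl_less by blast
  moreover have "c = r \<or> (c, r) \<in> set es"
  proof (cases "k < L")
    case False
    then have "k - L < length es" using k(2) by simp
    then have "es ! (k - L) \<in> set es" by simp
    moreover have "es ! (k - L) = (c, r)"
      using k(3,4) False by (simp add: loop_head_def loop_tail_def prod_eq_iff)
    ultimately show ?thesis by simp
  qed (use k in \<open>auto simp: loop_head_def loop_tail_def\<close>)
  ultimately show "row_column L (set es) (set cs) r c" using k(1) by (simp add: row_column_def)
next
  fix r c
  assume H: "row_column L (set es) (set cs) r c"
  show "adj r c"
  proof (cases "c = r")
    case True
    then show ?thesis using H unfolding adj_def row_column_def
      by (auto simp: loop_head_def loop_tail_def intro!: exI[of _ r])
  next
    case False
    then have "(c, r) \<in> set es" using H by (simp add: row_column_def)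
    then obtain k where "k < length es" "es ! k = (c, r)" by (auto simp: in_set_conv_nth)
    then show ?thesis using H unfolding adj_def row_column_def
      by (auto simp: loop_head_def loop_tail_def intro!: exI[of _ "L + k"])
  qed
qed

definition base :: "state \<Rightarrow> bool" where
  "base s \<longleftrightarrow> ready s \<and> reg s ''n'' = length es \<and>
     (\<forall>k<length es. arr s ''tail'' k = fst (es ! k) \<and> arr s ''head'' k = snd (es ! k))"

lemma base_cong:
  assumes "\<And>x. x \<in> {''L'', ''n''} \<Longrightarrow> reg s' x = reg s x"
    "\<And>a. a \<in> {''meas'', ''src'', ''next'', ''first'', ''tail'', ''head''} \<Longrightarrow> arr s' a = arr s a"
  shows "base s' = base s"
proof -
  have "ready s' = ready s" by (rule ready_cong) (use assms in auto)
  then show ?thesis unfolding base_def using assms by simp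
qed

lemma base_set_reg [simp]: "x \<notin> {''L'', ''n''} \<Longrightarrow> base (set_reg x v s) = base s"
  by (intro base_cong) auto

lemma base_set_elem [simp]:
  "a \<notin> {''meas'', ''src'', ''next'', ''first'', ''tail'', ''head''} \<Longrightarrow> base (set_elem a k v s) = base s"
  by (intro base_cong) auto

lemma base_regs: "base s \<Longrightarrow> reg s ''L'' = L" "base s \<Longrightarrow> reg s ''n'' = length es"
  by (simp_all add: base_def ready_def)

text \<open>Together with \<open>matched\<close>, this says that the rows of \<open>Z\<close>,
  restricted to unmeasured columns, are generically a basis of the span of all rows without an edge
  from \<open>i\<close>.\<close>

definition maximal :: "nat \<Rightarrow> nat set \<Rightarrow> bool" where
  "maximal i Z \<longleftrightarrow> Z \<subseteq> {r. r < L \<and> (i, r) \<notin> set es} \<and>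
     (\<forall>r<L. (i, r) \<notin> set es \<longrightarrow> r \<notin> Z \<longrightarrow> blocked adj r Z)"

definition matched :: "state \<Rightarrow> nat set \<Rightarrow> bool" where
  "matched s Z \<longleftrightarrow> matching_state adj L (arr s ''rm'') (arr s ''cm'') Z"

lemma matched_set_reg [simp]: "matched (set_reg x v s) Z = matched s Z"
  by (simp add: matched_def)

abbreviation identifiable :: "edge \<Rightarrow> bool" where
  "identifiable e \<equiv> generically_identifiable L (set es) cs {e}"

lemma identifiable_if_blocked:
  assumes "(i, j) \<in> set es" "maximal i Z" "blocked adj j Z"
  shows "identifiable (i, j)"
  using assms unfolding maximal_def adj_eq
  by (intro blocked_imp_generically_identifiable[OF dig cs]) auto

lemma not_identifiable_if_matched:
  assumes "(i, j) \<in> set es" "maximal i Z" "matched s (insert j Z)"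
  shows "\<not> identifiable (i, j)"
  using assms(1,2) matching_stateI_matching[OF assms(3)[unfolded matched_def] order.refl]
  unfolding maximal_def adj_eq
  by (intro augmentable_imp_not_generically_identifiable[OF dig cs]) auto

text \<open>The edge list includes the \<open>L\<close> loops, so the search runs with
  \<open>N = L + length es\<close>; this doubles the constant to 240.\<close>

lemma runs_search:
  assumes "base s" "matched s Z" "reg s ''r'' = r" "r < L" "r \<notin> Z"
    and Q: "\<And>s' t. base s' \<Longrightarrow>
      (if reg s' ''found'' = 0 then matched s' Z \<and> blocked adj r Z else matched s' (insert r Z)) \<Longrightarrow>
      t \<le> 240 * (L + length es + 1) \<Longrightarrow>
      (\<And>x. x \<notin> written_regs search_com \<Longrightarrow> reg s' x = reg s x) \<Longrightarrow>
      (\<And>a. a \<notin> written_arrs search_com \<Longrightarrow> arr s' a = arr s a) \<Longrightarrow> Q s' t"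
  shows "runs search_com s Q"
proof -
  have "runs search_com s (\<lambda>s' t. search_result r Z s' \<and> t \<le> 120 * (L + (L + length es) + 1))"
    by (rule runs_search_com) (use assms in \<open>auto simp: base_def matched_def\<close>)
  then show ?thesis
  proof (rule runs_frame)
    fix s' t
    assume H: "search_result r Z s' \<and> t \<le> 120 * (L + (L + length es) + 1)"
      and frame: "\<And>x. x \<notin> written_regs search_com \<Longrightarrow> reg s' x = reg s x"
      "\<And>a. a \<notin> written_arrs search_com \<Longrightarrow> arr s' a = arr s a"
    have "base s' = base s" by (rule base_cong) (auto simp: frame)
    then show "Q s' t"
      using H \<open>base s\<close> frame by (intro Q) (auto simp: search_result_def matched_def split: if_splits)
  qed
qed

definition edges_inserted where
  "edges_inserted K src next first \<longleftrightarrow>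
     (\<forall>k<K. src k = loop_tail L es k \<and> next k = latest (loop_head L es k) k) \<and>
     (\<forall>k\<ge>K. next k = (0::nat)) \<and> (\<forall>v<L. first v = latest v K)"

lemma edges_inserted_Suc:
  assumes "edges_inserted K src next first" "v = loop_head L es K"
  shows "edges_inserted (Suc K) (src(K := loop_tail L es K)) (next(K := latest v K)) (first(v := Suc K))"
  using assms by (auto simp: edges_inserted_def less_Suc_eq)

lemma latest_loops: "K \<le> v \<Longrightarrow> K \<le> L \<Longrightarrow> latest v K = 0"
  by (induction K) (auto simp: loop_head_def)

lemma length_cs: "length cs \<le> L"
proof -
  have "length cs = card (set cs)" using inst by (simp add: network_instance_def distinct_card)
  also have "\<dots> \<le> card {..<L}" using cs by (intro card_mono) auto
  finally show ?thesis by simp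
qed

definition input :: "state \<Rightarrow> bool" where
  "input s \<longleftrightarrow> reg s ''L'' = L \<and> reg s ''n'' = length es \<and> reg s ''p'' = length cs \<and>
     (\<forall>k<length es. arr s ''tail'' k = fst (es ! k) \<and> arr s ''head'' k = snd (es ! k)) \<and>
     (\<forall>k<length cs. arr s ''measured'' k = cs ! k)"

lemma runs_setup_com:
  assumes "input s" and zero: "arr s ''meas'' = (\<lambda>_. 0)" "arr s ''next'' = (\<lambda>_. 0)" "arr s ''first'' = (\<lambda>_. 0)"
  shows "runs setup_com s (\<lambda>s' t. base s' \<and> t \<le> 60 * (L + length es + 1))"
proof -
  let ?n = "length es"
  let ?ins = "\<lambda>K s'. edges_inserted K (arr s' ''src'') (arr s' ''next'') (arr s' ''first'')"
  let ?J = "\<lambda>s'. input s' \<and> (\<forall>c. arr s' ''meas'' c \<noteq> 0 \<longleftrightarrow> c \<in> set cs)"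
  have input_set_reg: "input (set_reg ''v'' v s') = input s'" for v s'
    by (simp add: input_def)
  have loop1: "runs (for_loop ''v'' ''p'' (SetElem ''meas'' (Elem ''measured'' (Reg ''v'')) (Const 1))) s
      (\<lambda>s' t. ?J s' \<and> ?ins 0 s' \<and> t \<le> 12 * length cs + 6)"
  proof (rule runs_for_loop[where k = 4 and I = "\<lambda>v s'. input s' \<and> ?ins 0 s' \<and>
      (\<forall>c. arr s' ''meas'' c \<noteq> 0 \<longleftrightarrow> c \<in> set (take v cs))"])
    show "input (set_reg ''v'' 0 s) \<and> ?ins 0 (set_reg ''v'' 0 s) \<and>
        (\<forall>c. arr (set_reg ''v'' 0 s) ''meas'' c \<noteq> 0 \<longleftrightarrow> c \<in> set (take 0 cs))"
      using assms by (simp add: input_set_reg edges_inserted_def)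
  next
    fix v s'
    assume "input s' \<and> ?ins 0 s' \<and> (\<forall>c. arr s' ''meas'' c \<noteq> 0 \<longleftrightarrow> c \<in> set (take v cs))"
      "v < reg s ''p''" "reg s' ''v'' = v"
    then show "runs (SetElem ''meas'' (Elem ''measured'' (Reg ''v'')) (Const 1)) s'
      (\<lambda>s'' t. (input (set_reg ''v'' (Suc v) s'') \<and> ?ins 0 (set_reg ''v'' (Suc v) s'') \<and>
        (\<forall>c. arr (set_reg ''v'' (Suc v) s'') ''meas'' c \<noteq> 0 \<longleftrightarrow> c \<in> set (take (Suc v) cs))) \<and> t \<le> 4)"
      using \<open>input s\<close> by (auto simp: input_def take_Suc_conv_app_nth)
  next
    fix s' t
    assume "input s' \<and> ?ins 0 s' \<and> (\<forall>c. arr s' ''meas'' c \<noteq> 0 \<longleftrightarrow> c \<in> set (take (reg s ''p'') cs))"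
      "t \<le> (4 + 8) * reg s ''p'' + 6"
    then show "?J s' \<and> ?ins 0 s' \<and> t \<le> 12 * length cs + 6"
      using \<open>input s\<close> by (simp add: input_def)
  qed auto
  have loop2: "runs (for_loop ''v'' ''L'' (Seq (SetElem ''src'' (Reg ''v'') (Reg ''v''))
      (SetElem ''first'' (Reg ''v'') (Add (Reg ''v'') (Const 1))))) s1
      (\<lambda>s' t. ?J s' \<and> ?ins L s' \<and> t \<le> 20 * L + 6)"
    if s1: "?J s1" "?ins 0 s1" for s1
  proof (rule runs_for_loop[where k = 12 and I = "\<lambda>v s'. ?J s' \<and> ?ins v s'"])
    show "?J (set_reg ''v'' 0 s1) \<and> ?ins 0 (set_reg ''v'' 0 s1)"
      using s1 by (simp add: input_set_reg)
  next
    fix v s'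
    assume H: "?J s' \<and> ?ins v s'" "v < reg s1 ''L''" "reg s' ''v'' = v"
    then have "v < L" using s1 by (simp add: input_def)
    \<comment> \<open>The loop is the first edge inserted at \<open>v\<close>, so its
      \<open>next\<close> cell keeps the initial zero and the program does not write it.\<close>
    have "latest v v = 0" using \<open>v < L\<close> by (intro latest_loops) auto
    then have next_eq: "(arr s' ''next'')(v := latest v v) = arr s' ''next''"
      using H(1) by (intro ext) (auto simp: edges_inserted_def)
    have "?ins v s'" "v = loop_head L es v" using H(1) \<open>v < L\<close> by (auto simp: loop_head_def)
    then have "edges_inserted (Suc v) ((arr s' ''src'')(v := loop_tail L es v))
        ((arr s' ''next'')(v := latest v v)) ((arr s' ''first'')(v := Suc v))"
      by (rule edges_inserted_Suc)
    then have "edges_inserted (Suc v) ((arr s' ''src'')(v := v)) (arr s' ''next'') ((arr s' ''first'')(v := Suc v))"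
      using \<open>v < L\<close> unfolding next_eq by (simp add: loop_tail_def)
    then show "runs (Seq (SetElem ''src'' (Reg ''v'') (Reg ''v''))
      (SetElem ''first'' (Reg ''v'') (Add (Reg ''v'') (Const 1)))) s'
      (\<lambda>s'' t. (?J (set_reg ''v'' (Suc v) s'') \<and> ?ins (Suc v) (set_reg ''v'' (Suc v) s'')) \<and> t \<le> 12)"
      using H by (simp add: input_def)
  next
    fix s' t
    assume "?J s' \<and> ?ins (reg s1 ''L'') s'" "t \<le> (12 + 8) * reg s1 ''L'' + 6"
    then show "?J s' \<and> ?ins L s' \<and> t \<le> 20 * L + 6" using s1 by (simp add: input_def)
  qed auto
  let ?body3 = "Seq (SetElem ''src'' (Add (Reg ''L'') (Reg ''v'')) (Elem ''tail'' (Reg ''v'')))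
      (Seq (SetElem ''next'' (Add (Reg ''L'') (Reg ''v'')) (Elem ''first'' (Elem ''head'' (Reg ''v''))))
           (SetElem ''first'' (Elem ''head'' (Reg ''v'')) (Add (Add (Reg ''L'') (Reg ''v'')) (Const 1))))"
  have loop3: "runs (for_loop ''v'' ''n'' ?body3) s2
      (\<lambda>s' t. ?J s' \<and> ?ins (L + ?n) s' \<and> t \<le> 38 * ?n + 6)"
    if s2: "?J s2" "?ins L s2" for s2
  proof (rule runs_for_loop[where k = 30 and I = "\<lambda>v s'. ?J s' \<and> ?ins (L + v) s'"])
    show "?J (set_reg ''v'' 0 s2) \<and> ?ins (L + 0) (set_reg ''v'' 0 s2)"
      using s2 by (simp add: input_set_reg)
  next
    fix v s'
    assume H: "?J s' \<and> ?ins (L + v) s'" "v < reg s2 ''n''" "reg s' ''v'' = v"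
    then have v: "v < ?n" using s2 by (simp add: input_def)
    have "snd (es ! v) < L" using es_nth_less[OF v] by simp
    then have "arr s' ''first'' (snd (es ! v)) = latest (snd (es ! v)) (L + v)"
      using H(1) by (simp add: edges_inserted_def)
    then have "edges_inserted (Suc (L + v)) ((arr s' ''src'')(L + v := fst (es ! v)))
        ((arr s' ''next'')(L + v := arr s' ''first'' (snd (es ! v))))
        ((arr s' ''first'')(snd (es ! v) := Suc (L + v)))"
      using edges_inserted_Suc[of "L + v" _ _ _ "snd (es ! v)"] H(1) by (simp add: loop_head_def loop_tail_def)
    then show "runs ?body3 s'
      (\<lambda>s'' t. (?J (set_reg ''v'' (Suc v) s'') \<and> ?ins (L + Suc v) (set_reg ''v'' (Suc v) s'')) \<and> t \<le> 30)"
      using H v by (simp add: input_def)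
  next
    fix s' t
    assume "?J s' \<and> ?ins (L + reg s2 ''n'') s'" "t \<le> (30 + 8) * reg s2 ''n'' + 6"
    then show "?J s' \<and> ?ins (L + ?n) s' \<and> t \<le> 38 * ?n + 6" using s2 by (simp add: input_def)
  qed auto
  show ?thesis
    unfolding setup_com_def runs_Seq
    apply (rule runs_conseq[OF loop1])
    apply (elim conjE)
    apply (rule runs_conseq[OF loop2])
      apply (simp; fail)+
    apply (elim conjE)
    apply (rule runs_conseq[OF loop3])
      apply (simp; fail)+
    using length_cs by (auto simp: base_def ready_def input_def edges_inserted_def)
qed

lemma runs_match_com:
  assumes "base s" "reg s ''i'' = i"
    and Q: "\<And>s' t Z. base s' \<Longrightarrow> matched s' Z \<Longrightarrow> maximal i Z \<Longrightarrow>
      (\<forall>r<L. arr s' ''excl'' r \<noteq> 0 \<longleftrightarrow> (i, r) \<in> set es) \<Longrightarrow>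
      t \<le> 500 * (L * (L + length es + 1)) \<Longrightarrow>
      (\<And>x. x \<notin> written_regs match_com \<Longrightarrow> reg s' x = reg s x) \<Longrightarrow>
      (\<And>a. a \<notin> written_arrs match_com \<Longrightarrow> arr s' a = arr s a) \<Longrightarrow> Q s' t"
  shows "runs match_com s Q"
proof -
  let ?n = "length es"
  let ?B = "\<lambda>s'. base s' \<and> reg s' ''i'' = i"
  let ?X = "\<lambda>s'. \<forall>r<L. arr s' ''excl'' r \<noteq> 0 \<longleftrightarrow> (i, r) \<in> set es"
  have loop1: "runs (for_loop ''v'' ''L'' (Seq (SetElem ''rm'' (Reg ''v'') (Const 0))
      (Seq (SetElem ''cm'' (Reg ''v'') (Const 0)) (SetElem ''excl'' (Reg ''v'') (Const 0))))) s
      (\<lambda>s' t. ?B s' \<and> matched s' {} \<and> (\<forall>r<L. arr s' ''excl'' r = 0) \<and> t \<le> 20 * L + 6)"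
  proof (rule runs_for_loop[where k = 12 and I = "\<lambda>v s'. ?B s' \<and>
      (\<forall>r<v. arr s' ''rm'' r = 0 \<and> arr s' ''cm'' r = 0 \<and> arr s' ''excl'' r = 0)"])
    fix v s'
    assume "?B s' \<and> (\<forall>r<v. arr s' ''rm'' r = 0 \<and> arr s' ''cm'' r = 0 \<and> arr s' ''excl'' r = 0)"
      "reg s' ''v'' = v"
    then show "runs (Seq (SetElem ''rm'' (Reg ''v'') (Const 0))
      (Seq (SetElem ''cm'' (Reg ''v'') (Const 0)) (SetElem ''excl'' (Reg ''v'') (Const 0)))) s'
      (\<lambda>s'' t. (?B (set_reg ''v'' (Suc v) s'') \<and> (\<forall>r<Suc v. arr (set_reg ''v'' (Suc v) s'') ''rm'' r = 0 \<and>
        arr (set_reg ''v'' (Suc v) s'') ''cm'' r = 0 \<and> arr (set_reg ''v'' (Suc v) s'') ''excl'' r = 0)) \<and> t \<le> 12)"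
      by (simp add: less_Suc_eq)
  qed (use assms(1,2) in \<open>auto simp: matched_def matching_state_def base_regs\<close>)
  let ?body2 = "Cond (Add (Sub (Elem ''tail'' (Reg ''v'')) (Reg ''i'')) (Sub (Reg ''i'') (Elem ''tail'' (Reg ''v''))))
        Skip (SetElem ''excl'' (Elem ''head'' (Reg ''v'')) (Const 1))"
  have loop2: "runs (for_loop ''v'' ''n'' ?body2) s1 (\<lambda>s' t. ?B s' \<and> matched s' {} \<and> ?X s' \<and> t \<le> 38 * ?n + 6)"
    if s1: "?B s1" "matched s1 {}" "\<forall>r<L. arr s1 ''excl'' r = 0" for s1
  proof (rule runs_for_loop[where k = 30 and I = "\<lambda>v s'. ?B s' \<and> matched s' {} \<and>
      (\<forall>r<L. arr s' ''excl'' r \<noteq> 0 \<longleftrightarrow> (\<exists>k<v. es ! k = (i, r)))"])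
    fix v s'
    assume H: "?B s' \<and> matched s' {} \<and> (\<forall>r<L. arr s' ''excl'' r \<noteq> 0 \<longleftrightarrow> (\<exists>k<v. es ! k = (i, r)))"
      "v < reg s1 ''n''" "reg s' ''v'' = v"
    then have v: "v < ?n" using s1 by (simp add: base_regs)
    then have th: "arr s' ''tail'' v = fst (es ! v)" "arr s' ''head'' v = snd (es ! v)"
      using H(1) by (auto simp: base_def)
    have "matched (set_elem ''excl'' k x s') {}" for k x
      using H(1) by (simp add: matched_def)
    moreover have "fst (es ! v) - i + (i - fst (es ! v)) = 0 \<longleftrightarrow> fst (es ! v) = i" by auto
    ultimately show "runs ?body2 s' (\<lambda>s'' t. (?B (set_reg ''v'' (Suc v) s'') \<and> matched (set_reg ''v'' (Suc v) s'') {} \<and>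
        (\<forall>r<L. arr (set_reg ''v'' (Suc v) s'') ''excl'' r \<noteq> 0 \<longleftrightarrow> (\<exists>k<Suc v. es ! k = (i, r)))) \<and> t \<le> 30)"
      using H th by (cases "es ! v") (auto simp: less_Suc_eq)
  next
    fix s' t
    assume "?B s' \<and> matched s' {} \<and> (\<forall>r<L. arr s' ''excl'' r \<noteq> 0 \<longleftrightarrow> (\<exists>k<reg s1 ''n''. es ! k = (i, r)))"
      "t \<le> (30 + 8) * reg s1 ''n'' + 6"
    then show "?B s' \<and> matched s' {} \<and> ?X s' \<and> t \<le> 38 * ?n + 6"
      using s1 by (auto simp: base_regs in_set_conv_nth)
  qed (use s1 in auto)
  let ?body3 = "Cond (Elem ''excl'' (Reg ''r'')) Skip search_com"
  let ?M = "\<lambda>v s'. \<exists>Z. matched s' Z \<and> Z \<subseteq> {r. r < L \<and> r < v \<and> (i, r) \<notin> set es} \<and>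
      (\<forall>r<v. (i, r) \<notin> set es \<longrightarrow> r \<notin> Z \<longrightarrow> blocked adj r Z)"
  let ?k = "240 * (L + ?n + 1) + 10"
  have loop3: "runs (for_loop ''r'' ''L'' ?body3) s2
      (\<lambda>s' t. base s' \<and> (\<exists>Z. matched s' Z \<and> maximal i Z) \<and> ?X s' \<and> t \<le> (?k + 8) * L + 6)"
    if s2: "?B s2" "matched s2 {}" "?X s2" for s2
  proof (rule runs_for_loop[where k = ?k and I = "\<lambda>v s'. base s' \<and> ?X s' \<and> ?M v s'"])
    show "base (set_reg ''r'' 0 s2) \<and> ?X (set_reg ''r'' 0 s2) \<and> ?M 0 (set_reg ''r'' 0 s2)"
      using s2 by (auto intro!: exI[of _ "{}"])
  next
    fix v s'
    assume H: "base s' \<and> ?X s' \<and> ?M v s'" "v < reg s2 ''L''" "reg s' ''r'' = v"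
    then have v: "v < L" using s2 by (simp add: base_regs)
    obtain Z where Z: "matched s' Z" "Z \<subseteq> {r. r < L \<and> r < v \<and> (i, r) \<notin> set es}"
      "\<forall>r<v. (i, r) \<notin> set es \<longrightarrow> r \<notin> Z \<longrightarrow> blocked adj r Z"
      using H(1) by blast
    show "runs ?body3 s' (\<lambda>s'' t. (base (set_reg ''r'' (Suc v) s'') \<and> ?X (set_reg ''r'' (Suc v) s'') \<and>
        ?M (Suc v) (set_reg ''r'' (Suc v) s'')) \<and> t \<le> ?k)"
    proof (cases "(i, v) \<in> set es")
      case True
      then have "arr s' ''excl'' v \<noteq> 0" using H(1) v by blast
      moreover have "?M (Suc v) s'"
        using Z True by (intro exI[of _ Z]) (auto simp: less_Suc_eq)
      ultimately show ?thesis using H by simp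
    next
      case False
      then have excl: "arr s' ''excl'' v = 0" using H(1) v by blast
      have "runs search_com s' (\<lambda>s'' t. base s'' \<and> ?X s'' \<and> ?M (Suc v) s'' \<and> t \<le> 240 * (L + ?n + 1))"
      proof (rule runs_search[OF _ Z(1) H(3) v])
        show "base s'" "v \<notin> Z" using H(1) Z(2) by auto
        fix s'' t
        assume b: "base s''" and res: "if reg s'' ''found'' = 0 then matched s'' Z \<and> blocked adj v Z
            else matched s'' (insert v Z)"
          and t: "t \<le> 240 * (L + ?n + 1)"
          and frame: "\<And>a. a \<notin> written_arrs search_com \<Longrightarrow> arr s'' a = arr s' a"
        have "?M (Suc v) s''"
        proof (cases "reg s'' ''found'' = 0")
          case True
          then show ?thesis using res Z by (intro exI[of _ Z]) (auto simp: less_Suc_eq)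
        next
          case False
          \<comment> \<open>Rows that failed earlier need no second search: their certificates lie
            inside the old \<open>Z\<close>.\<close>
          have "blocked adj r (insert v Z)" if "blocked adj r Z" for r
            using that by (rule blocked_mono) auto
          then show ?thesis using False res Z v \<open>(i, v) \<notin> set es\<close>
            by (intro exI[of _ "insert v Z"]) (auto simp: less_Suc_eq)
        qed
        moreover have "?X s''" using H(1) by (simp add: frame)
        ultimately show "base s'' \<and> ?X s'' \<and> ?M (Suc v) s'' \<and> t \<le> 240 * (L + ?n + 1)"
          using b t by blast
      qed
      then show ?thesis using excl H(3) by simp (elim runs_conseq, simp)
    qed
  next
    fix s' t
    assume "base s' \<and> ?X s' \<and> ?M (reg s2 ''L'') s'" "t \<le> (?k + 8) * reg s2 ''L'' + 6"
    moreover have "reg s2 ''L'' = L" using s2 by (simp add: base_regs)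
    ultimately show "base s' \<and> (\<exists>Z. matched s' Z \<and> maximal i Z) \<and> ?X s' \<and> t \<le> (?k + 8) * L + 6"
      unfolding maximal_def by (auto 0 4)
  qed auto
  have bound: "20 * L + 6 + (38 * ?n + 6 + ((?k + 8) * L + 6)) \<le> 500 * (L * (L + ?n + 1))"
  proof -
    have n: "?n \<le> L * ?n" and "1 \<le> L" using L_pos by auto
    have eq: "(?k + 8) * L = 240 * (L * L) + 240 * (L * ?n) + 258 * L"
      "L * (L + ?n + 1) = L * L + L * ?n + L"
      by (simp_all add: algebra_simps)
    \<comment> \<open>Replacing the products by variables leaves a linear inequality, in which
      \<open>1 \<le> l\<close> absorbs the constants.\<close>
    have "20 * l + 6 + (38 * n + 6 + ((240 * a + 240 * b + 258 * l) + 6)) \<le> 500 * (a + b + l)"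
      if "n \<le> b" "1 \<le> l" for a b l n :: nat
      using that by simp
    from this[OF n \<open>1 \<le> L\<close>] show ?thesis unfolding eq .
  qed
  have "runs match_com s (\<lambda>s' t. base s' \<and> (\<exists>Z. matched s' Z \<and> maximal i Z) \<and> ?X s' \<and>
      t \<le> 500 * (L * (L + ?n + 1)))"
    unfolding match_com_def runs_Seq
    apply (rule runs_conseq[OF loop1])
    apply (elim conjE)
    apply (rule runs_conseq[OF loop2])
       apply (simp; fail)+
    apply (elim conjE)
    apply (rule runs_conseq[OF loop3])
       apply (simp; fail)+
    by (elim conjE, intro conjI order_trans[OF add_mono[OF _ add_mono] bound]) assumption+
  then show ?thesis
    by (rule runs_frame) (use Q in blast)
qed

text \<open>Either outcome of the last search is conclusive: failure blocks \<open>j\<close>,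
  success matches \<open>insert j Z\<close>, and these are the premises of the two halves of the
  criterion.\<close>

lemma runs_edge_com:
  assumes "base s" "reg s ''i'' = i" "reg s ''j'' = j" "(i, j) \<in> set es"
    and Q: "\<And>s' t. base s' \<Longrightarrow> (reg s' ''found'' = 0 \<longleftrightarrow> identifiable (i, j)) \<Longrightarrow>
      t \<le> 800 * (L * (L + length es + 1)) \<Longrightarrow>
      (\<And>x. x \<notin> written_regs edge_com \<Longrightarrow> reg s' x = reg s x) \<Longrightarrow>
      (\<And>a. a \<notin> written_arrs edge_com \<Longrightarrow> arr s' a = arr s a) \<Longrightarrow> Q s' t"
  shows "runs edge_com s Q"
proof -
  let ?W = "L * (L + length es + 1)"
  have "1 * (L + length es + 1) \<le> ?W" by (rule mult_le_mono1) (use L_pos in simp)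
  then have bound: "500 * ?W + (2 + 240 * (L + length es + 1)) \<le> 800 * ?W"
    by simp
  have "j < L" using dig assms(4) by (auto simp: digraph_def)
  have "runs edge_com s (\<lambda>s' t. base s' \<and> (reg s' ''found'' = 0 \<longleftrightarrow> identifiable (i, j)) \<and> t \<le> 800 * ?W)"
    unfolding edge_com_def runs_Seq runs_SetReg
  proof (rule runs_match_com[OF assms(1,2)])
    fix s1 t1 Z
    assume s1: "base s1" "matched s1 Z" "maximal i Z" and t1: "t1 \<le> 500 * ?W"
      and frame: "\<And>x. x \<notin> written_regs match_com \<Longrightarrow> reg s1 x = reg s x"
    have "j \<notin> Z" using s1(3) assms(4) by (auto simp: maximal_def)
    show "runs search_com (set_reg ''r'' (eval_exp (Reg ''j'') s1) s1)
        (\<lambda>s' t'. base s' \<and> (reg s' ''found'' = 0 \<longleftrightarrow> identifiable (i, j)) \<and>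
          t1 + (1 + exp_cost (Reg ''j'') + t') \<le> 800 * ?W)"
    proof (rule runs_search[OF _ _ _ \<open>j < L\<close> \<open>j \<notin> Z\<close>])
      show "reg (set_reg ''r'' (eval_exp (Reg ''j'') s1) s1) ''r'' = j"
        using frame[of "''j''"] assms(3) by simp
      fix s2 t2
      assume s2: "base s2"
        and res: "if reg s2 ''found'' = 0 then matched s2 Z \<and> blocked adj j Z else matched s2 (insert j Z)"
        and t2: "t2 \<le> 240 * (L + length es + 1)"
      have "reg s2 ''found'' = 0 \<longleftrightarrow> identifiable (i, j)"
        using res identifiable_if_blocked[OF assms(4) s1(3)]
          not_identifiable_if_matched[OF assms(4) s1(3), of s2] by (auto split: if_splits)
      then show "base s2 \<and> (reg s2 ''found'' = 0 \<longleftrightarrow> identifiable (i, j)) \<and>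
          t1 + (1 + exp_cost (Reg ''j'') + t2) \<le> 800 * ?W"
        using s2 t1 t2 bound by simp
    qed (use s1 in auto)
  qed
  then show ?thesis
  proof (rule runs_frame)
    fix s' t
    assume "base s' \<and> (reg s' ''found'' = 0 \<longleftrightarrow> identifiable (i, j)) \<and> t \<le> 800 * ?W"
      "\<And>x. x \<notin> written_regs edge_com \<Longrightarrow> reg s' x = reg s x"
      "\<And>a. a \<notin> written_arrs edge_com \<Longrightarrow> arr s' a = arr s a"
    then show "Q s' t" by (intro Q) blast+
  qed
qed

text \<open>Maximality of \<open>Z\<close> is claimed only while the answer is 1. A success puts the
  head \<open>v\<close> into \<open>Z\<close> and destroys it, but then an unidentifiable edge is
  known. From there on the matching has only to stay valid and to avoid the heads not yet searched,
  which is the bound on \<open>Z\<close> in the invariant.\<close>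

lemma runs_node_com:
  assumes "base s" "matched s Z" "maximal i Z" "i < L"
    and excl: "\<forall>r<L. arr s ''excl'' r \<noteq> 0 \<longleftrightarrow> (i, r) \<in> set es"
    and ans: "if reg s ''answer'' = 1 then \<forall>(a, b)\<in>set es. a < i \<longrightarrow> identifiable (a, b)
      else \<exists>e\<in>set es. \<not> identifiable e"
  shows "runs node_com s (\<lambda>s' t. base s' \<and>
    (if reg s' ''answer'' = 1 then \<forall>(a, b)\<in>set es. a < Suc i \<longrightarrow> identifiable (a, b)
      else \<exists>e\<in>set es. \<not> identifiable e) \<and> t \<le> 300 * (L * (L + length es + 1)))"
proof -
  let ?body = "Cond (Elem ''excl'' (Reg ''r''))
     (Seq search_com (Cond (Reg ''found'') (SetReg ''answer'' (Const 0)) Skip)) Skip"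
  let ?X = "\<lambda>s'. \<forall>r<L. arr s' ''excl'' r \<noteq> 0 \<longleftrightarrow> (i, r) \<in> set es"
  let ?I = "\<lambda>v s'. base s' \<and> ?X s' \<and> (\<exists>Z. matched s' Z \<and> Z \<subseteq> {r. r < L \<and> ((i, r) \<in> set es \<longrightarrow> r < v)} \<and>
      (if reg s' ''answer'' = 1
       then maximal i Z \<and> (\<forall>(a, b)\<in>set es. a < i \<or> a = i \<and> b < v \<longrightarrow> identifiable (a, b))
       else \<exists>e\<in>set es. \<not> identifiable e))"
  let ?k = "240 * (L + length es + 1) + 20"
  have bound: "(?k + 8) * L + 6 \<le> 300 * (L * (L + length es + 1))"
  proof -
    have "1 \<le> L" using L_pos by simp
    have eq: "(?k + 8) * L = 240 * (L * L) + 240 * (L * length es) + 268 * L"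
      "L * (L + length es + 1) = L * L + L * length es + L"
      by (simp_all add: algebra_simps)
    have "240 * a + 240 * b + 268 * l + 6 \<le> 300 * (a + b + l)" if "1 \<le> l" for a b l :: nat
      using that by simp
    from this[OF \<open>1 \<le> L\<close>] show ?thesis unfolding eq .
  qed
  have regL: "reg s ''L'' = L" using \<open>base s\<close> by (simp add: base_regs)
  show ?thesis
    unfolding node_com_def
  proof (rule runs_for_loop[where k = ?k and I = ?I])
    show "?I 0 (set_reg ''r'' 0 s)"
      using assms by (auto simp: maximal_def intro!: exI[of _ Z])
  next
    fix v s'
    assume I: "?I v s'" and "v < reg s ''L''" and r: "reg s' ''r'' = v"
    then have v: "v < L" using regL by simp
    obtain Z where Z: "matched s' Z" "Z \<subseteq> {r. r < L \<and> ((i, r) \<in> set es \<longrightarrow> r < v)}"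
      "if reg s' ''answer'' = 1
       then maximal i Z \<and> (\<forall>(a, b)\<in>set es. a < i \<or> a = i \<and> b < v \<longrightarrow> identifiable (a, b))
       else \<exists>e\<in>set es. \<not> identifiable e"
      using I by blast
    show "runs ?body s' (\<lambda>s'' t. ?I (Suc v) (set_reg ''r'' (Suc v) s'') \<and> t \<le> ?k)"
    proof (cases "(i, v) \<in> set es")
      case False
      then have "arr s' ''excl'' v = 0" using I v by blast
      moreover have "\<exists>Z. matched s' Z \<and> Z \<subseteq> {r. r < L \<and> ((i, r) \<in> set es \<longrightarrow> r < Suc v)} \<and>
        (if reg s' ''answer'' = 1
         then maximal i Z \<and> (\<forall>(a, b)\<in>set es. a < i \<or> a = i \<and> b < Suc v \<longrightarrow> identifiable (a, b))
         else \<exists>e\<in>set es. \<not> identifiable e)"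
        using Z False by (intro exI[of _ Z]) (auto simp: less_Suc_eq split: if_splits)
      ultimately show ?thesis using I r by simp
    next
      case True
      then have excl: "arr s' ''excl'' v \<noteq> 0" using I v by blast
      have "runs search_com s' (\<lambda>s1 t1. runs (Cond (Reg ''found'') (SetReg ''answer'' (Const 0)) Skip) s1
        (\<lambda>s'' t. ?I (Suc v) (set_reg ''r'' (Suc v) s'') \<and> 1 + exp_cost (Elem ''excl'' (Reg ''r'')) + (t1 + t) \<le> ?k))"
      proof (rule runs_search[OF _ Z(1) r v])
        show "base s'" "v \<notin> Z" using I Z(2) True by auto
        fix s1 t1
        assume b: "base s1" and res: "if reg s1 ''found'' = 0 then matched s1 Z \<and> blocked adj v Z
            else matched s1 (insert v Z)"
          and t: "t1 \<le> 240 * (L + length es + 1)"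
          and frame: "\<And>x. x \<notin> written_regs search_com \<Longrightarrow> reg s1 x = reg s' x"
            "\<And>a. a \<notin> written_arrs search_com \<Longrightarrow> arr s1 a = arr s' a"
        have X: "?X s1" using I by (simp add: frame)
        have ans: "reg s1 ''answer'' = reg s' ''answer''" by (simp add: frame)
        show "runs (Cond (Reg ''found'') (SetReg ''answer'' (Const 0)) Skip) s1
          (\<lambda>s'' t. ?I (Suc v) (set_reg ''r'' (Suc v) s'') \<and> 1 + exp_cost (Elem ''excl'' (Reg ''r'')) + (t1 + t) \<le> ?k)"
        proof (cases "reg s1 ''found'' = 0")
          case True
          then have m: "matched s1 Z" "blocked adj v Z" using res by auto
          have "identifiable (i, v)" if "reg s1 ''answer'' = 1"
            using Z(3) that ans identifiable_if_blocked[OF \<open>(i, v) \<in> set es\<close> _ m(2)] by simp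
          then have "\<exists>Z. matched s1 Z \<and> Z \<subseteq> {r. r < L \<and> ((i, r) \<in> set es \<longrightarrow> r < Suc v)} \<and>
            (if reg s1 ''answer'' = 1
             then maximal i Z \<and> (\<forall>(a, b)\<in>set es. a < i \<or> a = i \<and> b < Suc v \<longrightarrow> identifiable (a, b))
             else \<exists>e\<in>set es. \<not> identifiable e)"
            using Z m(1) ans by (intro exI[of _ Z]) (auto simp: less_Suc_eq split: if_splits)
          then show ?thesis using True b X t by simp
        next
          case False
          then have m: "matched s1 (insert v Z)" using res by auto
          have "\<exists>e\<in>set es. \<not> identifiable e"
            using Z(3) not_identifiable_if_matched[OF \<open>(i, v) \<in> set es\<close> _ m] \<open>(i, v) \<in> set es\<close>
            by (cases "reg s' ''answer'' = 1") auto
          moreover have "insert v Z \<subseteq> {r. r < L \<and> ((i, r) \<in> set es \<longrightarrow> r < Suc v)}"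
            using Z(2) v by auto
          ultimately show ?thesis using False b X t m by simp blast
        qed
      qed
      then show ?thesis using excl r by simp
    qed
  next
    fix s' t
    assume I: "?I (reg s ''L'') s'" and t: "t \<le> (?k + 8) * reg s ''L'' + 6"
    have "b < L" if "(a, b) \<in> set es" for a b using dig that by (auto simp: digraph_def)
    then show "base s' \<and> (if reg s' ''answer'' = 1 then \<forall>(a, b)\<in>set es. a < Suc i \<longrightarrow> identifiable (a, b)
      else \<exists>e\<in>set es. \<not> identifiable e) \<and> t \<le> 300 * (L * (L + length es + 1))"
      using I t bound unfolding regL by (auto simp: less_Suc_eq split: if_splits)
  qed auto
qed

text \<open>Grow a set of nodes from node 0. Weak connectivity supplies an edge across the boundary;
  adding its outer end brings at least that edge inside, so \<open>k\<close> nodes span at least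
  \<open>k - 1\<close> edges.\<close>

lemma edges_ge_nodes: "L \<le> length es + 1"
proof -
  have "\<exists>A\<subseteq>{..<L}. card A = k \<and> k \<le> card {e \<in> set es. fst e \<in> A \<and> snd e \<in> A} + 1"
    if "1 \<le> k" "k \<le> L" for k
    using that
  proof (induction k rule: dec_induct)
    case base
    then show ?case using L_pos by (intro exI[of _ "{0}"]) auto
  next
    case (step k)
    then obtain A where A: "A \<subseteq> {..<L}" "card A = k" "k \<le> card {e \<in> set es. fst e \<in> A \<and> snd e \<in> A} + 1"
      by auto
    have "A \<noteq> {}" using A(2) step.hyps by auto
    moreover have "{..<L} - A \<noteq> {}" using A step.prems by auto
    ultimately obtain u v where uv: "(u, v) \<in> set es" "u \<in> A \<and> v \<in> {..<L} - A \<or> u \<in> {..<L} - A \<and> v \<in> A"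
      using inst A(1) unfolding network_instance_def weakly_connected_def
      by (metis (no_types, lifting) Diff_disjoint Un_Diff_cancel case_prodE sup.absorb2)
    define w where "w = (if u \<in> A then v else u)"
    have w: "w \<in> {..<L}" "w \<notin> A" using uv(2) by (auto simp: w_def)
    let ?E = "\<lambda>A. {e \<in> set es. fst e \<in> A \<and> snd e \<in> A}"
    have "insert (u, v) (?E A) \<subseteq> ?E (insert w A)" using uv by (auto simp: w_def)
    moreover have "(u, v) \<notin> ?E A" using uv(2) by auto
    ultimately have "Suc (card (?E A)) \<le> card (?E (insert w A))"
      using card_mono[of "?E (insert w A)" "insert (u, v) (?E A)"] by simp
    moreover have "card (insert w A) = Suc k" using A w finite_subset[OF A(1)] by simp
    ultimately show ?case using A w(1) by (intro exI[of _ "insert w A"]) auto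
  qed
  from this[of L] obtain A where "L \<le> card {e \<in> set es. fst e \<in> A \<and> snd e \<in> A} + 1"
    using L_pos by auto
  also have "card {e \<in> set es. fst e \<in> A \<and> snd e \<in> A} \<le> card (set es)"
    by (intro card_mono) auto
  also have "\<dots> \<le> length es" by (rule card_length)
  finally show ?thesis by simp
qed

text \<open>By the previous lemma the left side is at most \<open>2 * length es + 2\<close>. A
  single node without edges makes the right side 0, hence the premise.\<close>

lemma size_bound: "0 < length es \<Longrightarrow> L + length es + 1 \<le> 4 * length es"
  using edges_ge_nodes by linarith

lemma input_input_state: "input (input_state L es cs)"
  by (auto simp: input_def input_state_def list_to_array_def)

text \<open>The cost of the setup is known only up to a bound, so the continuation must meet the
  postcondition for every setup cost within it.\<close>

lemma runs_setup_input:
  assumes "\<And>s'. base s' \<Longrightarrow> (\<And>x. x \<notin> {''v''} \<Longrightarrow> reg s' x = reg s x) \<Longrightarrow>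
      runs c s' (\<lambda>s'' t. \<forall>t'\<le>60 * (L + length es + 1). Q s'' (t' + t))"
    and "input s" "arr s ''meas'' = (\<lambda>_. 0)" "arr s ''next'' = (\<lambda>_. 0)" "arr s ''first'' = (\<lambda>_. 0)"
  shows "runs (Seq setup_com c) s Q"
  unfolding runs_Seq
proof (rule runs_frame[OF runs_setup_com[OF assms(2-5)]])
  fix s' t
  assume H: "base s' \<and> t \<le> 60 * (L + length es + 1)"
    and frame: "\<And>x. x \<notin> written_regs setup_com \<Longrightarrow> reg s' x = reg s x"
  have "runs c s' (\<lambda>s'' t. \<forall>t'\<le>60 * (L + length es + 1). Q s'' (t' + t))"
    using H frame by (intro assms(1)) (auto simp: setup_com_def)
  then show "runs c s' (\<lambda>s'' t'. Q s'' (t + t'))"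
    by (rule runs_conseq) (use H in auto)
qed

section \<open>Running times of the three programs\<close>

lemma runs_edge_program:
  assumes e: "(i, j) \<in> set es"
  shows "runs edge_program (edge_input_state L es cs (i, j)) (\<lambda>s t.
    (reg s ''answer'' = 1 \<longleftrightarrow> identifiable (i, j)) \<and> t \<le> 4000 * (L * length es))"
proof -
  let ?n = "length es"
  have "0 < ?n" using e by (cases es) auto
  then have size: "L + ?n + 1 \<le> 4 * ?n" by (rule size_bound)
  have W: "L * (L + ?n + 1) \<le> 4 * (L * ?n)" using mult_le_mono2[OF size, of L] by simp
  have n: "?n \<le> L * ?n" using L_pos by simp
  \<comment> \<open>The setup contributes at most \<open>240 * M\<close>, the edge test
    \<open>3200 * M\<close> and the final assignment 4.\<close>
  have "60 * S + (800 * W + 4) \<le> 4000 * M" if "S \<le> 4 * n" "W \<le> 4 * M" "n \<le> M" "0 < n" for S W M n :: nat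
    using that by simp
  from this[OF size W n \<open>0 < ?n\<close>]
  have bound: "60 * (L + ?n + 1) + (800 * (L * (L + ?n + 1)) + 4) \<le> 4000 * (L * ?n)" .
  show ?thesis
    unfolding edge_program_def
  proof (rule runs_setup_input)
    fix s'
    assume b: "base s'" and frame: "\<And>x. x \<notin> {''v''} \<Longrightarrow> reg s' x = reg (edge_input_state L es cs (i, j)) x"
    show "runs (Seq edge_com (SetReg ''answer'' (Less (Reg ''found'') (Const 1)))) s'
      (\<lambda>s'' t. \<forall>t'\<le>60 * (L + ?n + 1). (reg s'' ''answer'' = 1 \<longleftrightarrow> identifiable (i, j)) \<and>
        t' + t \<le> 4000 * (L * ?n))"
      unfolding runs_Seq
    proof (rule runs_edge_com[OF b _ _ e])
      show "reg s' ''i'' = i" "reg s' ''j'' = j"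
        using frame[of "''i''"] frame[of "''j''"] by (simp_all add: edge_input_state_def)
      fix s'' :: state and t
      assume "reg s'' ''found'' = 0 \<longleftrightarrow> identifiable (i, j)" "t \<le> 800 * (L * (L + ?n + 1))"
      then show "runs (SetReg ''answer'' (Less (Reg ''found'') (Const 1))) s''
        (\<lambda>s'' t'. \<forall>ta\<le>60 * (L + ?n + 1). (reg s'' ''answer'' = 1 \<longleftrightarrow> identifiable (i, j)) \<and>
          ta + (t + t') \<le> 4000 * (L * ?n))"
        using bound by auto
    qed
  qed (use input_input_state in \<open>auto simp: edge_input_state_def input_def input_state_def\<close>)
qed

lemma runs_all_edges_program:
  "runs all_edges_program (input_state L es cs) (\<lambda>s t.
    (\<forall>k<length es. arr s ''answer'' k = 1 \<longleftrightarrow> identifiable (es ! k)) \<and>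
    (0 < length es \<longrightarrow> t \<le> 4000 * (length es ^ 2 * L)))"
proof -
  let ?n = "length es"
  let ?k = "800 * (L * (L + ?n + 1)) + 20"
  have bound: "60 * (L + ?n + 1) + ((?k + 8) * ?n + 6) \<le> 4000 * (?n ^ 2 * L)" if "0 < ?n"
  proof -
    have size: "L + ?n + 1 \<le> 4 * ?n" using that by (rule size_bound)
    have W: "L * (L + ?n + 1) * ?n \<le> 4 * (?n ^ 2 * L)"
      using mult_le_mono2[OF size, of "L * ?n"] by (simp add: power2_eq_square algebra_simps)
    have "?n * 1 \<le> ?n * (?n * L)" by (rule mult_le_mono2) (use that L_pos in \<open>simp add: Suc_le_eq\<close>)
    then have n: "?n \<le> ?n ^ 2 * L" by (simp add: power2_eq_square mult.assoc)
    have eq: "(?k + 8) * ?n = 800 * (L * (L + ?n + 1) * ?n) + 28 * ?n"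
      by (simp add: algebra_simps)
    have "60 * S + (800 * W + 28 * n + 6) \<le> 4000 * M" if "S \<le> 4 * n" "W \<le> 4 * M" "n \<le> M" "0 < n"
      for S W M n :: nat
      using that by simp
    from this[OF size W n that] show ?thesis unfolding eq .
  qed
  let ?body = "Seq (SetReg ''i'' (Elem ''tail'' (Reg ''k'')))
    (Seq (SetReg ''j'' (Elem ''head'' (Reg ''k'')))
    (Seq edge_com
         (SetElem ''answer'' (Reg ''k'') (Less (Reg ''found'') (Const 1)))))"
  show ?thesis
    unfolding all_edges_program_def
  proof (rule runs_setup_input)
    fix s' assume b: "base s'"
    show "runs (for_loop ''k'' ''n'' ?body) s'
      (\<lambda>s'' t. \<forall>t'\<le>60 * (L + ?n + 1). (\<forall>k<?n. arr s'' ''answer'' k = 1 \<longleftrightarrow> identifiable (es ! k)) \<and>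
        (0 < ?n \<longrightarrow> t' + t \<le> 4000 * (?n ^ 2 * L)))"
    proof (rule runs_for_loop[where k = ?k and
          I = "\<lambda>v s''. base s'' \<and> (\<forall>k<v. arr s'' ''answer'' k = 1 \<longleftrightarrow> identifiable (es ! k))"])
      show "base (set_reg ''k'' 0 s') \<and> (\<forall>k<0. arr (set_reg ''k'' 0 s') ''answer'' k = 1 \<longleftrightarrow> identifiable (es ! k))"
        using b by simp
    next
      fix v s1
      assume H: "base s1 \<and> (\<forall>k<v. arr s1 ''answer'' k = 1 \<longleftrightarrow> identifiable (es ! k))"
        and "v < reg s' ''n''" and k: "reg s1 ''k'' = v"
      then have v: "v < ?n" using b by (simp add: base_regs)
      let ?s = "set_reg ''j'' (snd (es ! v)) (set_reg ''i'' (fst (es ! v)) s1)"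
      have th: "arr s1 ''tail'' v = fst (es ! v)" "arr s1 ''head'' v = snd (es ! v)"
        using H v by (auto simp: base_def)
      have "runs edge_com ?s (\<lambda>s2 t. base s2 \<and> (reg s2 ''found'' = 0 \<longleftrightarrow> identifiable (es ! v)) \<and>
          reg s2 ''k'' = v \<and> arr s2 ''answer'' = arr s1 ''answer'' \<and> t \<le> 800 * (L * (L + ?n + 1)))"
        by (rule runs_edge_com[where i = "fst (es ! v)" and j = "snd (es ! v)"]) (use H v k in auto)
      then have "runs edge_com ?s (\<lambda>s2 t. (base (set_reg ''k'' (Suc v) (set_elem ''answer'' v (if reg s2 ''found'' < 1 then 1 else 0) s2)) \<and>
          (\<forall>k<Suc v. ((arr s2 ''answer'')(v := if reg s2 ''found'' < 1 then 1 else 0)) k = 1 \<longleftrightarrow> identifiable (es ! k))) \<and>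
          reg s2 ''k'' = v \<and> t \<le> 800 * (L * (L + ?n + 1)))"
        by (rule runs_conseq) (use H in \<open>auto simp: less_Suc_eq\<close>)
      then show "runs ?body s1 (\<lambda>s'' t. (base (set_reg ''k'' (Suc v) s'') \<and>
          (\<forall>k<Suc v. arr (set_reg ''k'' (Suc v) s'') ''answer'' k = 1 \<longleftrightarrow> identifiable (es ! k))) \<and> t \<le> ?k)"
        by (simp add: th k) (elim runs_conseq, auto)
    next
      fix s'' t
      assume "base s'' \<and> (\<forall>k<reg s' ''n''. arr s'' ''answer'' k = 1 \<longleftrightarrow> identifiable (es ! k))"
        "t \<le> (?k + 8) * reg s' ''n'' + 6"
      moreover have "reg s' ''n'' = ?n" using b by (simp add: base_regs)
      ultimately show "\<forall>t'\<le>60 * (L + ?n + 1). (\<forall>k<?n. arr s'' ''answer'' k = 1 \<longleftrightarrow> identifiable (es ! k)) \<and>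
        (0 < ?n \<longrightarrow> t' + t \<le> 4000 * (?n ^ 2 * L))"
        using bound by auto
    qed auto
  qed (use input_input_state in \<open>auto simp: input_state_def\<close>)
qed

lemma runs_network_program:
  "runs network_program (input_state L es cs) (\<lambda>s t.
    (reg s ''answer'' = 1 \<longleftrightarrow> generically_identifiable L (set es) cs (set es)) \<and>
    (0 < length es \<longrightarrow> t \<le> 4000 * (L ^ 2 * length es)))"
proof -
  let ?n = "length es"
  let ?k = "800 * (L * (L + ?n + 1))"
  have bound: "60 * (L + ?n + 1) + (2 + ((?k + 8) * L + 6)) \<le> 4000 * (L ^ 2 * ?n)" if "0 < ?n"
  proof -
    have size: "L + ?n + 1 \<le> 4 * ?n" using that by (rule size_bound)
    have W: "L * (L + ?n + 1) * L \<le> 4 * (L ^ 2 * ?n)"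
      using mult_le_mono2[OF size, of "L * L"] by (simp add: power2_eq_square algebra_simps)
    have "1 * ?n \<le> L ^ 2 * ?n" by (rule mult_le_mono1) (use L_pos in simp)
    then have n: "?n \<le> L ^ 2 * ?n" by simp
    have "L * 1 \<le> L * (L * ?n)" by (rule mult_le_mono2) (use that L_pos in \<open>simp add: Suc_le_eq\<close>)
    then have l: "L \<le> L ^ 2 * ?n" by (simp add: power2_eq_square mult.assoc)
    have eq: "(?k + 8) * L = 800 * (L * (L + ?n + 1) * L) + 8 * L"
      by (simp add: algebra_simps)
    have "60 * S + (2 + (800 * W + 8 * l + 6)) \<le> 4000 * M"
      if "S \<le> 4 * n" "W \<le> 4 * M" "n \<le> M" "l \<le> M" "0 < n" for S W M n l :: nat
      using that by simp
    from this[OF size W n l that] show ?thesis unfolding eq .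
  qed
  let ?A = "\<lambda>i s. if reg s ''answer'' = 1 then \<forall>(a, b)\<in>set es. a < i \<longrightarrow> identifiable (a, b)
      else \<exists>e\<in>set es. \<not> identifiable e"
  show ?thesis
    unfolding network_program_def
  proof (rule runs_setup_input)
    fix s' assume b: "base s'"
    have regL: "reg s' ''L'' = L" using b by (simp add: base_regs)
    let ?s = "set_reg ''answer'' 1 s'"
    have "runs (for_loop ''i'' ''L'' (Seq match_com node_com)) ?s
      (\<lambda>s'' t. ?A L s'' \<and> t \<le> (?k + 8) * L + 6)"
    proof (rule runs_for_loop[where k = ?k and I = "\<lambda>v s''. base s'' \<and> ?A v s''"])
      show "base (set_reg ''i'' 0 ?s) \<and> ?A 0 (set_reg ''i'' 0 ?s)" using b by simp
    next
      fix v s1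
      assume H: "base s1 \<and> ?A v s1" and "v < reg ?s ''L''" and i: "reg s1 ''i'' = v"
      then have v: "v < L" using regL by simp
      show "runs (Seq match_com node_com) s1 (\<lambda>s'' t. (base (set_reg ''i'' (Suc v) s'') \<and>
          ?A (Suc v) (set_reg ''i'' (Suc v) s'')) \<and> t \<le> ?k)"
        unfolding runs_Seq
      proof (rule runs_match_com[OF conjunct1[OF H] i])
        fix s2 t2 Z
        assume s2: "base s2" "matched s2 Z" "maximal v Z"
          "\<forall>r<L. arr s2 ''excl'' r \<noteq> 0 \<longleftrightarrow> (v, r) \<in> set es"
          and t2: "t2 \<le> 500 * (L * (L + ?n + 1))"
          and frame: "\<And>x. x \<notin> written_regs match_com \<Longrightarrow> reg s2 x = reg s1 x"
        have "?A v s2" using H by (simp add: frame)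
        from runs_node_com[OF s2(1-3) v s2(4) this]
        show "runs node_com s2 (\<lambda>s'' t'. (base (set_reg ''i'' (Suc v) s'') \<and>
          ?A (Suc v) (set_reg ''i'' (Suc v) s'')) \<and> t2 + t' \<le> ?k)"
          by (rule runs_conseq) (use t2 in auto)
      qed
    qed (use regL in \<open>auto simp: node_com_def\<close>)
    then show "runs (Seq (SetReg ''answer'' (Const 1)) (for_loop ''i'' ''L'' (Seq match_com node_com))) s'
      (\<lambda>s'' t. \<forall>t'\<le>60 * (L + ?n + 1). (reg s'' ''answer'' = 1 \<longleftrightarrow> generically_identifiable L (set es) cs (set es)) \<and>
        (0 < ?n \<longrightarrow> t' + t \<le> 4000 * (L ^ 2 * ?n)))"
      unfolding runs_Seq runs_SetReg eval_exp.simps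
    proof (rule runs_conseq)
      fix s'' :: state and t
      assume H: "?A L s'' \<and> t \<le> (?k + 8) * L + 6"
      have "a < L" if "(a, b) \<in> set es" for a b using dig that by (auto simp: digraph_def)
      then have "reg s'' ''answer'' = 1 \<longleftrightarrow> (\<forall>e\<in>set es. identifiable e)"
        using H by (auto split: if_splits)
      then show "\<forall>t'\<le>60 * (L + ?n + 1). (reg s'' ''answer'' = 1 \<longleftrightarrow> generically_identifiable L (set es) cs (set es)) \<and>
        (0 < ?n \<longrightarrow> t' + (1 + exp_cost (Const 1) + t) \<le> 4000 * (L ^ 2 * ?n))"
        using H bound generically_identifiable_iff_singletons[of "set es" L "set es" cs] by auto
    qed
  qed (use input_input_state in \<open>auto simp: input_state_def\<close>)
qed

end

theorem mainTheorem7: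
  shows
    "(\<exists>prog c. \<forall>L es cs. network_instance L es cs \<longrightarrow>
        (\<exists>t s. exec prog (input_state L es cs) t s \<and>
           (reg s ''answer'' = 1 \<longleftrightarrow> generically_identifiable L (set es) cs (set es)) \<and>
           (0 < length es \<longrightarrow> t \<le> c * (L ^ 2 * length es))))
     \<and>
     (\<exists>prog c. \<forall>L es cs i j. network_instance L es cs \<and> (i, j) \<in> set es \<longrightarrow>
        (\<exists>t s. exec prog (edge_input_state L es cs (i, j)) t s \<and>
           (reg s ''answer'' = 1 \<longleftrightarrow> generically_identifiable L (set es) cs {(i, j)}) \<and>
           t \<le> c * (L * length es)))
     \<and>
     (\<exists>prog c. \<forall>L es cs. network_instance L es cs \<longrightarrow>
        (\<exists>t s. exec prog (input_state L es cs) t s \<and>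
           {es ! k |k. k < length es \<and> arr s ''answer'' k = 1} =
             {e \<in> set es. generically_identifiable L (set es) cs {e}} \<and>
           (0 < length es \<longrightarrow> t \<le> c * ((length es) ^ 2 * L))))"
proof (intro conjI)
  show "\<exists>prog c. \<forall>L es cs. network_instance L es cs \<longrightarrow>
        (\<exists>t s. exec prog (input_state L es cs) t s \<and>
           (reg s ''answer'' = 1 \<longleftrightarrow> generically_identifiable L (set es) cs (set es)) \<and>
           (0 < length es \<longrightarrow> t \<le> c * (L ^ 2 * length es)))"
    using network.runs_network_program[unfolded runs_def] network.intro by blast
  show "\<exists>prog c. \<forall>L es cs i j. network_instance L es cs \<and> (i, j) \<in> set es \<longrightarrow>
        (\<exists>t s. exec prog (edge_input_state L es cs (i, j)) t s \<and>
           (reg s ''answer'' = 1 \<longleftrightarrow> generically_identifiable L (set es) cs {(i, j)}) \<and>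
           t \<le> c * (L * length es))"
    using network.runs_edge_program[unfolded runs_def] network.intro by blast
  have "\<exists>t s. exec all_edges_program (input_state L es cs) t s \<and>
           {es ! k |k. k < length es \<and> arr s ''answer'' k = 1} =
             {e \<in> set es. generically_identifiable L (set es) cs {e}} \<and>
           (0 < length es \<longrightarrow> t \<le> 4000 * ((length es) ^ 2 * L))"
    if net: "network_instance L es cs" for L es cs
  proof -
    obtain t s where s: "exec all_edges_program (input_state L es cs) t s"
      "\<forall>k<length es. arr s ''answer'' k = 1 \<longleftrightarrow> generically_identifiable L (set es) cs {es ! k}"
      "0 < length es \<longrightarrow> t \<le> 4000 * ((length es) ^ 2 * L)"
      using network.runs_all_edges_program[OF network.intro[OF net]] unfolding runs_def by blast
    have "{es ! k |k. k < length es \<and> arr s ''answer'' k = 1} =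
        {e \<in> set es. generically_identifiable L (set es) cs {e}}"
    proof (intro equalityI subsetI)
      fix e assume "e \<in> {e \<in> set es. generically_identifiable L (set es) cs {e}}"
      then obtain k where "k < length es" "e = es ! k" "generically_identifiable L (set es) cs {e}"
        by (auto simp: in_set_conv_nth)
      then show "e \<in> {es ! k |k. k < length es \<and> arr s ''answer'' k = 1}" using s(2) by blast
    qed (use s(2) in auto)
    with s show ?thesis by blast
  qed
  then show "\<exists>prog c. \<forall>L es cs. network_instance L es cs \<longrightarrow>
        (\<exists>t s. exec prog (input_state L es cs) t s \<and>
           {es ! k |k. k < length es \<and> arr s ''answer'' k = 1} =
             {e \<in> set es. generically_identifiable L (set es) cs {e}} \<and>
           (0 < length es \<longrightarrow> t \<le> c * ((length es) ^ 2 * L)))"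
    by blast
qed

end
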